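(* Let $g\ge 1$ be an integer. The minimal spectral radius $>1$ among all skew-reciprocal nonnegative irreducible matrices $A\in\mathrm{GL}_{2g}(\mathbb{Z})$ exists and equals $\lambda_{2g}$, where $\lambda_{2g}$ is the largest real root of the polynomial \[ t^{2g}-t^{g}-1 \] if $g$ is odd, and the largest real root of the polynomial \[ t^{2g}-t^{g+1}-t^{g-1}-1 \] if $g$ is even.
   Context: A matrix is nonnegative if all its coefficients are nonnegative. A matrix is irreducible if it is not conjugate via a permutation matrix to an upper triangular block matrix (with at least two square diagonal blocks). A matrix is skew-reciprocal if the set of its eigenvalues, counted with multiplicity, is invariant under the transformation $t\mapsto -t^{-1}$. The spectral radius of a matrix is the maximal modulus of its eigenvalues. *)

theory Defs
  imports "Jordan_Normal_Form.Spectral_Radius" "HOL-Combinatorics.Permutations"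
begin

definition nonneg_mat :: "'a::{zero,ord} mat \<Rightarrow> bool" where
  "nonneg_mat A \<longleftrightarrow> (\<forall>i<dim_row A. \<forall>j<dim_col A. 0 \<le> A $$ (i, j))"

definition permutation_mat :: "nat \<Rightarrow> 'a::semiring_1 mat \<Rightarrow> bool" where
  "permutation_mat n P \<longleftrightarrow>
     (\<exists>p. p permutes {..<n} \<and> P = mat n n (\<lambda>(i, j). if i = p j then 1 else 0))"

text \<open>The list \<open>ns\<close> contains the sizes of the square diagonal blocks. An entry lies below the
  diagonal blocks iff some block boundary \<open>sum_list (take k ns)\<close> separates its column index from
  its row index.\<close>

definition block_upper_triangular :: "nat list \<Rightarrow> 'a::zero mat \<Rightarrow> bool" where
  "block_upper_triangular ns A \<longleftrightarrow>
     A \<in> carrier_mat (sum_list ns) (sum_list ns) \<and>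
     (\<forall>k<length ns. \<forall>i j.
        j < sum_list (take k ns) \<and> sum_list (take k ns) \<le> i \<and> i < sum_list ns
        \<longrightarrow> A $$ (i, j) = 0)"

definition irreducible_mat :: "'a::semiring_1 mat \<Rightarrow> bool" where
  "irreducible_mat A \<longleftrightarrow> square_mat A \<and>
     \<not> (\<exists>B P Q ns. permutation_mat (dim_row A) P \<and> similar_mat_wit A B P Q \<and>
          2 \<le> length ns \<and> 0 \<notin> set ns \<and> block_upper_triangular ns B)"

definition eigenvalue_mset :: "complex mat \<Rightarrow> complex multiset" where
  "eigenvalue_mset A = proots (char_poly A)"

text \<open>The eigenvalue \<open>0\<close> is excluded explicitly because \<open>inverse 0 = 0\<close> in HOL.\<close>

definition skew_reciprocal :: "complex mat \<Rightarrow> bool" where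
  "skew_reciprocal A \<longleftrightarrow> 0 \<notin># eigenvalue_mset A \<and>
     image_mset (\<lambda>t. - inverse t) (eigenvalue_mset A) = eigenvalue_mset A"

definition GL_int :: "nat \<Rightarrow> int mat set" where
  "GL_int n = {A \<in> carrier_mat n n. invertible_mat A}"

definition largest_real_root :: "real poly \<Rightarrow> real" where
  "largest_real_root p = Max {x. poly p x = 0}"

definition lambda_poly :: "nat \<Rightarrow> real poly" where
  "lambda_poly g =
     (if odd g then monom 1 (2 * g) - monom 1 g - 1
      else monom 1 (2 * g) - monom 1 (g + 1) - monom 1 (g - 1) - 1)"

definition skew_reciprocal_nonneg_irreducible :: "nat \<Rightarrow> int mat set" where
  "skew_reciprocal_nonneg_irreducible n =
     {A \<in> GL_int n. skew_reciprocal (map_mat complex_of_int A) \<and> nonneg_mat A \<and> irreducible_mat A}"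

end

theory Submission
  imports Defs "HOL-Combinatorics.Cycles"
begin

text \<open>
  The determinant of \<open>1 - t A\<close> is the signed sum, over all sets of pairwise disjoint cycles of the
  graph of \<open>A\<close>, of \<open>t\<close> to the total length (a clique polynomial in the sense of McMullen). At the
  inverse \<open>t\<close> of the spectral radius this sum vanishes, and for every subset of the cycles the
  corresponding sum is nonnegative; applied to a few cycles this gives strong inequalities.

  Skew-reciprocity relates the coefficients of degrees \<open>k\<close> and \<open>2 * g - k\<close> by a sign. The constant
  coefficient yields a family of disjoint cycles covering all vertices. For odd \<open>g\<close>, a covering cycle
  and a cycle of length at most \<open>g\<close> already give the bound. For even \<open>g\<close>, assuming that the spectral
  radius is too small, irreducibility provides a long cycle meeting all short cycles (those of length
  at most \<open>g\<close>), whence there are at most two short cycles. These determine the whole polynomial: two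
  short cycles lead to a contradiction, and a single one of odd length \<open>k\<close> gives
  \<open>1 - t^k - t^(2 g - k) - t^(2 g) = 0\<close>, which is extremal for \<open>k = g - 1\<close>. The bound is attained by a
  companion matrix.
\<close>

section \<open>Clique sums\<close>

text \<open>The sign property of subset sums does the work of Perron-Frobenius theory: the zero of
  least modulus of a clique sum may be replaced by its modulus. After that, the estimates rest on
  two facts: every subset sum is nonnegative at \<open>t\<close>, and disjoint cycles fit into
  \<open>2 * g\<close> vertices, so that the product of their weights is at least
  \<open>x\<^sup>2\<close>, where \<open>x = t ^ g\<close>. For odd \<open>g\<close> the extremal
  equation is \<open>x + x\<^sup>2 = 1\<close>. For even \<open>g\<close> the extremal
  \<open>x\<close> varies with \<open>g\<close>; at \<open>g = 2\<close> it is the inverse square of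
  the golden ratio. A spectral radius that is too small always gives
  \<open>3 * x > 1 + x\<^sup>2\<close>, and the combinatorics uses this single condition, which is
  independent of \<open>g\<close> and sharp at \<open>g = 2\<close>. It leaves little slack, hence
  the fine rational constants. The dependence on \<open>g\<close> returns only at the end, when the
  surviving identity is compared with the extremal one.\<close>

definition cliques :: "('c \<Rightarrow> 'v set) \<Rightarrow> 'c set \<Rightarrow> 'c set set" where
  "cliques s F = {K. K \<subseteq> F \<and> pairwise (\<lambda>c d. disjnt (s c) (s d)) K}"

text \<open>The weighted independence polynomial of the intersection graph of the supports. Members
  are indices rather than supports, so that different cycles on the same vertices count
  separately.\<close>

definition clique_sum :: "('c \<Rightarrow> 'v set) \<Rightarrow> 'c set \<Rightarrow> 'a::comm_ring_1 \<Rightarrow> 'a" where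
  "clique_sum s F t = (\<Sum>K\<in>cliques s F. \<Prod>c\<in>K. - (t ^ card (s c)))"

lemma finite_cliques [simp]: "finite F \<Longrightarrow> finite (cliques s F)"
  by (rule finite_subset[of _ "Pow F"]) (auto simp: cliques_def)

lemma cliques_empty [simp]: "cliques s {} = {{}}"
  by (auto simp: cliques_def)

lemma empty_in_cliques [simp]: "{} \<in> cliques s F"
  by (simp add: cliques_def)

lemma clique_sum_empty [simp]: "clique_sum s {} t = 1"
  by (simp add: clique_sum_def)

lemma cliques_insert:
  assumes "c \<notin> F"
  shows "cliques s (insert c F) = cliques s F \<union> insert c ` cliques s {d \<in> F. disjnt (s c) (s d)}"
proof (intro subset_antisym subsetI)
  fix K assume K: "K \<in> cliques s (insert c F)"
  show "K \<in> cliques s F \<union> insert c ` cliques s {d \<in> F. disjnt (s c) (s d)}"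
  proof (cases "c \<in> K")
    case True
    have "K - {c} \<in> cliques s {d \<in> F. disjnt (s c) (s d)}"
      using K True by (auto simp: cliques_def pairwise_def)
    moreover have "K = insert c (K - {c})" using True by auto
    ultimately show ?thesis by blast
  next
    case False
    thus ?thesis using K by (auto simp: cliques_def)
  qed
next
  fix K assume "K \<in> cliques s F \<union> insert c ` cliques s {d \<in> F. disjnt (s c) (s d)}"
  thus "K \<in> cliques s (insert c F)"
  proof
    assume "K \<in> insert c ` cliques s {d \<in> F. disjnt (s c) (s d)}"
    then obtain L where L: "K = insert c L" "L \<subseteq> {d \<in> F. disjnt (s c) (s d)}"
      "pairwise (\<lambda>c d. disjnt (s c) (s d)) L"
      by (auto simp: cliques_def)
    moreover have "disjnt (s c) (s d) \<and> disjnt (s d) (s c)" if "d \<in> L" for d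
      using L(2) that by (auto intro: disjnt_sym)
    ultimately show ?thesis by (auto simp: cliques_def pairwise_insert)
  qed (auto simp: cliques_def)
qed

lemma clique_sum_insert:
  assumes "finite F" "c \<notin> F"
  shows "clique_sum s (insert c F) t
    = clique_sum s F t - t ^ card (s c) * clique_sum s {d \<in> F. disjnt (s c) (s d)} t"
proof -
  let ?N = "{d \<in> F. disjnt (s c) (s d)}"
  have fin: "finite K" if "K \<in> cliques s F" for K
    using that assms(1) by (auto simp: cliques_def intro: finite_subset)
  have "c \<notin> K" if "K \<in> cliques s ?N" for K
    using that assms(2) by (auto simp: cliques_def)
  hence "inj_on (insert c) (cliques s ?N)"
    by (intro inj_onI) (metis insert_ident)
  moreover have "cliques s F \<inter> insert c ` cliques s ?N = {}"
    using assms(2) by (auto simp: cliques_def)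
  ultimately have "clique_sum s (insert c F) t = clique_sum s F t
      + (\<Sum>K\<in>cliques s ?N. \<Prod>d\<in>insert c K. - (t ^ card (s d)))"
    unfolding clique_sum_def cliques_insert[OF assms(2)]
    by (subst sum.union_disjoint) (use assms(1) in \<open>simp_all add: sum.reindex\<close>)
  also have "(\<Sum>K\<in>cliques s ?N. \<Prod>d\<in>insert c K. - (t ^ card (s d)))
      = (\<Sum>K\<in>cliques s ?N. - (t ^ card (s c)) * (\<Prod>d\<in>K. - (t ^ card (s d))))"
  proof (rule sum.cong[OF refl])
    fix K assume K: "K \<in> cliques s ?N"
    have "finite K" "c \<notin> K" using K assms by (auto simp: cliques_def intro: finite_subset)
    thus "(\<Prod>d\<in>insert c K. - (t ^ card (s d))) = - (t ^ card (s c)) * (\<Prod>d\<in>K. - (t ^ card (s d)))"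
      by simp
  qed
  finally show ?thesis by (simp add: clique_sum_def sum_distrib_left sum_negf)
qed

text \<open>A set difference in place of a comprehension lets the simplifier evaluate sums over
  explicit sets, deciding each element by the known disjointness facts.\<close>

lemma clique_sum_insert_Diff:
  assumes "finite F" "c \<notin> F"
  shows "clique_sum s (insert c F) t
    = clique_sum s F t - t ^ card (s c) * clique_sum s (F - {d. \<not> disjnt (s c) (s d)}) t"
proof -
  have "F - {d. \<not> disjnt (s c) (s d)} = {d \<in> F. disjnt (s c) (s d)}" by auto
  thus ?thesis using clique_sum_insert[OF assms] by simp
qed

lemma clique_sum_remove:
  assumes "finite F" "c \<in> F"
  shows "clique_sum s F t
    = clique_sum s (F - {c}) t - t ^ card (s c) * clique_sum s {d \<in> F - {c}. disjnt (s c) (s d)} t"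
  using clique_sum_insert[of "F - {c}" c s t] assms by (simp add: insert_absorb)

text \<open>A clique contains at most one member of \<open>H\<close>. This is the shape of the
  expansion along all cycles through one vertex.\<close>

lemma clique_sum_pairwise_meeting:
  assumes "finite F" "finite H" "F \<inter> H = {}"
    and "\<And>c d. c \<in> H \<Longrightarrow> d \<in> H \<Longrightarrow> \<not> disjnt (s c) (s d)"
  shows "clique_sum s (F \<union> H) t
    = clique_sum s F t - (\<Sum>c\<in>H. t ^ card (s c) * clique_sum s {d \<in> F. disjnt (s c) (s d)} t)"
  using assms(2,3,4)
proof (induction H)
  case (insert c H)
  have "{d \<in> F \<union> H. disjnt (s c) (s d)} = {d \<in> F. disjnt (s c) (s d)}"
    using insert.prems(2) by blast
  moreover have "c \<notin> F \<union> H" using insert by auto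
  ultimately show ?case
    using insert assms(1) by (simp add: clique_sum_insert)
qed simp

lemma clique_sum_0:
  assumes "finite F" "\<And>c. c \<in> F \<Longrightarrow> card (s c) > 0"
  shows "clique_sum s F (0 :: 'b :: comm_ring_1) = 1"
  using assms
proof (induction F)
  case (insert c F)
  have "card (s c) \<noteq> 0" using insert.prems[of c] by simp
  moreover have "clique_sum s F (0 :: 'b) = 1" using insert by simp
  ultimately show ?case using insert.hyps by (simp add: clique_sum_insert power_0_left)
qed simp

lemma continuous_on_clique_sum [continuous_intros]:
  "continuous_on A (clique_sum s F :: real \<Rightarrow> real)"
  unfolding clique_sum_def by (intro continuous_intros)

lemma clique_sum_of_real:
  "clique_sum s F (of_real t :: 'a :: {real_algebra_1,comm_ring_1}) = of_real (clique_sum s F t)"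
  by (simp add: clique_sum_def)

section \<open>Signs of clique sums up to the first zero\<close>

lemma nonneg_at_right_end:
  fixes f :: "real \<Rightarrow> real"
  assumes "continuous_on UNIV f" "0 < r" "\<And>t. 0 \<le> t \<Longrightarrow> t < r \<Longrightarrow> f t \<ge> 0"
  shows "f r \<ge> 0"
proof (rule tendsto_lowerbound)
  show "(f \<longlongrightarrow> f r) (at_left r)"
    using assms(1) by (simp add: continuous_on_def filterlim_at_split)
  show "\<forall>\<^sub>F t in at_left r. 0 \<le> f t"
    using eventually_at_left_real[OF assms(2)] by eventually_elim (use assms(3) in auto)
qed simp

lemma pos_of_no_zero:
  fixes f :: "real \<Rightarrow> real"
  assumes "continuous_on UNIV f" "0 < f 0" "\<And>t. 0 \<le> t \<Longrightarrow> t \<le> r \<Longrightarrow> f t \<noteq> 0" "0 \<le> t" "t \<le> r"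
  shows "f t > 0"
proof (rule ccontr)
  assume "\<not> f t > 0"
  hence "\<exists>x\<ge>0. x \<le> t \<and> f x = 0"
    using assms by (intro IVT2') (auto intro: continuous_on_subset)
  thus False using assms by force
qed

text \<open>The smallest zero of the sum over \<open>G - {c}\<close> would be a point where the sum over \<open>G\<close>
  is not positive, because it differs by a nonnegative multiple of the sum over a subset of
  \<open>G - {c}\<close>.\<close>
lemma clique_sum_pos_subset:
  fixes r :: real
  assumes "finite G" "\<And>c. c \<in> G \<Longrightarrow> card (s c) > 0"
    and "\<And>t. 0 \<le> t \<Longrightarrow> t \<le> r \<Longrightarrow> clique_sum s G t > 0"
    and "H \<subseteq> G" "0 \<le> t" "t \<le> r"
  shows "clique_sum s H t > 0"
  using assms
proof (induction G arbitrary: H r t rule: finite_psubset_induct)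
  case (psubset G H r t)
  show ?case
  proof (cases "H = G")
    case False
    then obtain c where c: "c \<in> G" "H \<subseteq> G - {c}" using psubset.prems by blast
    let ?F = "G - {c}" and ?N = "{d \<in> G - {c}. disjnt (s c) (s d)}"
    have F: "?F \<subset> G" using c by auto
    have card: "card (s d) > 0" if "d \<in> G" for d using psubset.prems(1) that .
    have no_zero: "clique_sum s ?F t1 \<noteq> 0" if t1: "0 \<le> t1" "t1 \<le> r" for t1 :: real
    proof
      assume zero: "clique_sum s ?F t1 = 0"
      define Z where "Z = {0..r} \<inter> {x. clique_sum s ?F x = 0}"
      have "closed {x::real. clique_sum s ?F x = 0}"
        by (rule closed_Collect_eq[OF continuous_on_clique_sum continuous_on_const])
      hence "compact Z" unfolding Z_def by (rule compact_Int_closed[OF compact_Icc])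
      moreover have "Z \<noteq> {}" using t1 zero by (auto simp: Z_def)
      ultimately have "\<exists>m\<in>Z. \<forall>x\<in>Z. m \<le> x" by (rule compact_attains_inf)
      then obtain m where m: "m \<in> Z" "\<And>x. x \<in> Z \<Longrightarrow> m \<le> x" by (elim bexE) simp
      have c0: "clique_sum s ?F 0 = (1::real)"
        by (rule clique_sum_0) (use psubset.hyps card in auto)
      have "m \<noteq> 0" using c0 m(1) by (auto simp: Z_def)
      hence m0: "m > 0" "m \<le> r" using m(1) by (auto simp: Z_def)
      have N: "clique_sum s ?N x \<ge> 0" if x: "0 \<le> x" "x < m" for x :: real
      proof (rule less_imp_le, rule psubset.IH[OF F])
        show "card (s d) > 0" if "d \<in> ?F" for d using card that by auto
        show "clique_sum s ?F y > 0" if y: "0 \<le> y" "y \<le> x" for y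
        proof (rule pos_of_no_zero[OF continuous_on_clique_sum _ _ y])
          show "clique_sum s ?F z \<noteq> 0" if "0 \<le> z" "z \<le> x" for z :: real
          proof
            assume "clique_sum s ?F z = 0"
            hence "z \<in> Z" using that y x m0 by (auto simp: Z_def)
            from m(2)[OF this] show False using that y x by simp
          qed
        qed (use c0 in simp)
      qed (use x in auto)
      have "clique_sum s ?N m \<ge> 0"
        by (rule nonneg_at_right_end[OF continuous_on_clique_sum m0(1) N])
      moreover have "clique_sum s G m = clique_sum s ?F m - m ^ card (s c) * clique_sum s ?N m"
        by (rule clique_sum_remove[OF psubset.hyps c(1)])
      moreover have "clique_sum s G m > 0" using psubset.prems m0 by simp
      ultimately show False using m(1) m0 by (simp add: Z_def mult_less_0_iff)
    qed
    have "clique_sum s ?F 0 = (1::real)"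
      by (rule clique_sum_0) (use psubset.hyps card in auto)
    hence "clique_sum s ?F x > 0" if "0 \<le> x" "x \<le> r" for x
      by (intro pos_of_no_zero[OF continuous_on_clique_sum _ _ that] no_zero) auto
    thus ?thesis using psubset.IH[OF F, of r H t] psubset.prems card c by auto
  qed (use psubset.prems in simp)
qed

text \<open>Positivity of all subset sums at \<open>r\<close> excludes zeros in the closed disc of
  radius \<open>r\<close>. Nonvanishing alone does not pass through the induction; the comparison of
  ratios with their values at \<open>r\<close> does.\<close>

lemma clique_sum_norm_ratio:
  fixes z :: complex
  assumes "finite G" "\<And>H. H \<subseteq> G \<Longrightarrow> clique_sum s H r > 0" "norm z \<le> r" "H \<subseteq> G"
  shows "clique_sum s G z \<noteq> 0 \<and>
    norm (clique_sum s H z) / norm (clique_sum s G z) \<le> clique_sum s H r / clique_sum s G r"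
  using assms
proof (induction G arbitrary: H rule: finite_psubset_induct)
  case (psubset G H)
  have r0: "r \<ge> 0" using psubset.prems norm_ge_zero order_trans by blast
  have step: "clique_sum s G z \<noteq> 0 \<and> norm (clique_sum s (G - {c}) z) / norm (clique_sum s G z)
      \<le> clique_sum s (G - {c}) r / clique_sum s G r" if c: "c \<in> G" for c
  proof -
    let ?F = "G - {c}" and ?N = "{d \<in> G - {c}. disjnt (s c) (s d)}"
    have F: "?F \<subset> G" using c by auto
    have IH: "clique_sum s ?F z \<noteq> 0"
      "norm (clique_sum s ?N z) / norm (clique_sum s ?F z) \<le> clique_sum s ?N r / clique_sum s ?F r"
      using psubset.IH[OF F, of ?N] psubset.prems F by auto
    have pos: "clique_sum s ?F r > 0" "clique_sum s ?N r > 0" "clique_sum s G r > 0"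
      using psubset.prems(1) by auto
    note rec = clique_sum_remove[OF psubset.hyps c]
    define q where "q = norm (clique_sum s ?N z) / norm (clique_sum s ?F z)"
    \<comment> \<open>Divided by the sum over \<open>?F\<close>, the recursion involves only the
      ratio of \<open>?N\<close> to \<open>?F\<close>, which the induction hypothesis
      controls.\<close>
    have "norm (z ^ card (s c)) * q \<le> r ^ card (s c) * (clique_sum s ?N r / clique_sum s ?F r)"
      using IH(2) psubset.prems(2) r0 pos unfolding q_def
      by (intro mult_mono) (auto simp: norm_power intro: power_mono)
    hence "1 - r ^ card (s c) * (clique_sum s ?N r / clique_sum s ?F r)
        \<le> 1 - norm (z ^ card (s c) * clique_sum s ?N z) / norm (clique_sum s ?F z)"
      by (simp add: q_def norm_mult)
    also have "\<dots> = (norm (clique_sum s ?F z) - norm (z ^ card (s c) * clique_sum s ?N z))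
        / norm (clique_sum s ?F z)"
      using IH(1) by (simp add: diff_divide_distrib)
    also have "\<dots> \<le> norm (clique_sum s G z) / norm (clique_sum s ?F z)"
      unfolding rec by (intro divide_right_mono norm_triangle_ineq2) simp
    finally have "clique_sum s G r / clique_sum s ?F r
        \<le> norm (clique_sum s G z) / norm (clique_sum s ?F z)"
      using pos unfolding rec[of s r] by (simp add: diff_divide_distrib)
    moreover have "clique_sum s G r / clique_sum s ?F r > 0" using pos by simp
    ultimately have le: "0 < norm (clique_sum s G z) / norm (clique_sum s ?F z)"
      "clique_sum s G r / clique_sum s ?F r \<le> norm (clique_sum s G z) / norm (clique_sum s ?F z)"
      by linarith+
    hence "clique_sum s G z \<noteq> 0" by auto
    moreover have "inverse (norm (clique_sum s G z) / norm (clique_sum s ?F z))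
      \<le> inverse (clique_sum s G r / clique_sum s ?F r)"
      using le pos by (intro le_imp_inverse_le) auto
    ultimately show ?thesis by simp
  qed
  show ?case
  proof (cases "H = G")
    case True
    have "clique_sum s G z \<noteq> 0"
    proof (cases "G = {}")
      case False
      thus ?thesis using step by blast
    qed simp
    thus ?thesis using True psubset.prems(1)[of G] by simp
  next
    case False
    then obtain c where c: "c \<in> G" "H \<subseteq> G - {c}" using psubset.prems by blast
    let ?F = "G - {c}"
    have F: "?F \<subset> G" using c by auto
    have 1: "clique_sum s ?F z \<noteq> 0 \<and>
        norm (clique_sum s H z) / norm (clique_sum s ?F z) \<le> clique_sum s H r / clique_sum s ?F r"
      using psubset.IH[OF F, of H] psubset.prems F c by auto
    have pos: "clique_sum s ?F r > 0" "clique_sum s H r > 0" "clique_sum s G r > 0"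
      using psubset.prems by auto
    have "norm (clique_sum s H z) / norm (clique_sum s ?F z)
          * (norm (clique_sum s ?F z) / norm (clique_sum s G z))
        \<le> clique_sum s H r / clique_sum s ?F r * (clique_sum s ?F r / clique_sum s G r)"
      using 1 step[OF c(1)] pos by (intro mult_mono) auto
    thus ?thesis using 1 step[OF c(1)] pos by simp
  qed
qed

text \<open>Subset sums are positive below \<open>norm z\<close>, hence nonnegative there by
  continuity. If the full sum were positive at \<open>norm z\<close>, all subset sums would be, and
  the ratio bound would forbid the zero \<open>z\<close> on that circle.\<close>

lemma clique_sum_first_zero:
  fixes z :: complex
  assumes fin: "finite G" and card: "\<And>c. c \<in> G \<Longrightarrow> card (s c) > 0"
    and z: "clique_sum s G z = 0" "z \<noteq> 0"
    and min: "\<And>w::complex. norm w < norm z \<Longrightarrow> clique_sum s G w \<noteq> 0"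
  shows "clique_sum s G (norm z) = 0" and "F \<subseteq> G \<Longrightarrow> clique_sum s F (norm z) \<ge> 0"
proof -
  have nz: "clique_sum s G t \<noteq> 0" if "0 \<le> t" "t < norm z" for t :: real
    using min[of "of_real t"] that unfolding clique_sum_of_real by simp
  have pos: "clique_sum s G t > 0" if "0 \<le> t" "t < norm z" for t :: real
    by (rule pos_of_no_zero[OF continuous_on_clique_sum _ _ that(1) order.refl])
      (use nz that in \<open>auto simp: clique_sum_0[OF fin card]\<close>)
  have "clique_sum s F t \<ge> 0" if "F \<subseteq> G" "0 \<le> t" "t < norm z" for F and t :: real
    by (rule less_imp_le, rule clique_sum_pos_subset[OF fin card _ that(1,2) order.refl])
      (use pos that in auto)
  note less = this
  have nonneg: "clique_sum s F (norm z) \<ge> 0" if F: "F \<subseteq> G" for F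
  proof (rule nonneg_at_right_end[OF continuous_on_clique_sum])
    show "clique_sum s F t \<ge> 0" if "0 \<le> t" "t < norm z" for t :: real
      using less[OF F that] .
  qed (use z in simp)
  show "F \<subseteq> G \<Longrightarrow> clique_sum s F (norm z) \<ge> 0" by (rule nonneg)
  show "clique_sum s G (norm z) = 0"
  proof (rule ccontr)
    assume "clique_sum s G (norm z) \<noteq> 0"
    hence *: "clique_sum s G (norm z) > 0" using nonneg[of G] by simp
    have "clique_sum s F (norm z) > 0" if "F \<subseteq> G" for F
    proof (rule clique_sum_pos_subset[OF fin card _ that norm_ge_zero order.refl])
      show "clique_sum s G t > 0" if "0 \<le> t" "t \<le> norm z" for t
        using pos[of t] * that by (cases "t = norm z") auto
    qed
    from clique_sum_norm_ratio[OF fin this order.refl order.refl] z(1) show False by simp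
  qed
qed

section \<open>Clique sums as polynomials\<close>

lemma cliques_total:
  assumes "finite F" "\<And>c. c \<in> F \<Longrightarrow> finite (s c)" "K \<in> cliques s F"
  shows "(\<Sum>c\<in>K. card (s c)) = card (\<Union>c\<in>K. s c)"
proof (rule card_UN_disjoint[symmetric])
  show "finite K" using assms by (auto simp: cliques_def intro: finite_subset)
qed (use assms in \<open>auto simp: cliques_def pairwise_def disjnt_def\<close>)

lemma clique_sum_expand:
  assumes fin: "finite F" and s: "\<And>c. c \<in> F \<Longrightarrow> s c \<subseteq> {..<n}"
  shows "clique_sum s F t = (\<Sum>k\<le>n.
    (\<Sum>K | K \<in> cliques s F \<and> (\<Sum>c\<in>K. card (s c)) = k. (- 1) ^ card K) * t ^ k)"
proof -
  have total: "(\<Sum>c\<in>K. card (s c)) \<le> n" if K: "K \<in> cliques s F" for K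
  proof -
    have "(\<Sum>c\<in>K. card (s c)) = card (\<Union>c\<in>K. s c)"
      by (rule cliques_total[OF fin _ K]) (use s finite_subset in blast)
    also have "\<dots> \<le> card {..<n}"
      by (rule card_mono) (use s K in \<open>auto simp: cliques_def\<close>)
    finally show ?thesis by simp
  qed
  have prod_eq: "(\<Prod>c\<in>K. - (t ^ card (s c))) = (- 1) ^ card K * t ^ (\<Sum>c\<in>K. card (s c))" for K
    by (simp add: power_sum prod.distrib[symmetric] flip: prod_constant)
  have "clique_sum s F t = (\<Sum>K\<in>cliques s F. (- 1) ^ card K * t ^ (\<Sum>c\<in>K. card (s c)))"
    by (simp add: clique_sum_def prod_eq)
  also have "\<dots> = (\<Sum>k\<le>n. \<Sum>K | K \<in> cliques s F \<and> (\<Sum>c\<in>K. card (s c)) = k.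
      (- 1) ^ card K * t ^ (\<Sum>c\<in>K. card (s c)))"
    by (rule sum.group[symmetric]) (use fin total in auto)
  finally show ?thesis by (simp add: sum_distrib_right)
qed


section \<open>Numerical inequalities\<close>

lemma twice_le_sum_of_mult_eq:
  fixes a b x :: real
  assumes "a * b = x\<^sup>2" "0 \<le> a" "0 \<le> b"
  shows "2 * x \<le> a + b"
proof (rule power2_le_imp_le)
  have "0 \<le> (a - b)\<^sup>2" by simp
  thus "(2 * x)\<^sup>2 \<le> (a + b)\<^sup>2" using assms(1) by (simp add: power2_eq_square algebra_simps)
qed (use assms in simp)

lemma mult_one_minus_le_quarter: "u * (1 - u) \<le> (1/4 :: real)"
proof -
  have "0 \<le> (u - 1/2)\<^sup>2" by simp
  thus ?thesis by (simp add: power2_eq_square algebra_simps)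
qed

text \<open>Multiplying the opposite inequality by \<open>a * b * c\<close> pairs each factor with
  its complement. Three products of size at most 1/4 give \<open>q * q \<le> 1/64\<close>, whence
  the constant 1/8. In the applications \<open>q\<close> is \<open>x\<^sup>2\<close>.\<close>

lemma prod_three_lt:
  fixes a b c q :: real
  assumes "0 < a" "a \<le> 1" "0 < b" "b \<le> 1" "0 < c" "c \<le> 1" "q \<le> a * b * c" "1/8 < q"
  shows "(1 - a) * (1 - b) * (1 - c) < q"
proof (rule ccontr)
  assume "\<not> ?thesis"
  hence "q * q \<le> (a * b * c) * ((1 - a) * (1 - b) * (1 - c))"
    using assms by (intro mult_mono) auto
  also have "\<dots> = (a * (1 - a)) * ((b * (1 - b)) * (c * (1 - c)))" by simp
  also have "\<dots> \<le> 1/4 * (1/4 * (1/4))"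
    using assms by (intro mult_mono mult_one_minus_le_quarter) auto
  finally have "q * q \<le> 1/8 * (1/8)" by simp
  moreover have "1/8 * (1/8) < q * q" using assms by (intro mult_strict_mono) auto
  ultimately show False by simp
qed

text \<open>With \<open>m = b * (1 - a) + a * (1 - b)\<close>, the arithmetic-geometric mean inequality bounds the
  left-hand side by \<open>m\<^sup>2 / 4\<close>, and it is at most \<open>1/16\<close> as well.\<close>
lemma prod_two_lt:
  fixes a b q :: real
  assumes "0 < a" "a < 1" "0 < b" "b < 1" "1/8 < q"
  shows "(a * (1 - a)) * (b * (1 - b)) < q * (b * (1 - a) + a * (1 - b))"
proof (rule ccontr)
  define m where "m = b * (1 - a) + a * (1 - b)"
  assume "\<not> ?thesis"
  hence le: "q * m \<le> (a * (1 - a)) * (b * (1 - b))" by (simp add: m_def)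
  have m: "m > 0" using assms unfolding m_def by (intro add_pos_pos mult_pos_pos) auto
  have "0 \<le> (b * (1 - a) - a * (1 - b))\<^sup>2" by simp
  hence "(a * (1 - a)) * (b * (1 - b)) \<le> m * m / 4"
    by (simp add: m_def power2_eq_square algebra_simps)
  with le have "q * m \<le> (m / 4) * m" by simp
  hence "q \<le> m / 4" using m by (rule mult_right_le_imp_le)
  hence "1/2 < m" using assms by simp
  hence "1/8 * (1/2) < q * m" using assms by (intro mult_strict_mono) auto
  moreover have "(a * (1 - a)) * (b * (1 - b)) \<le> 1/4 * (1/4)"
    using assms by (intro mult_mono mult_one_minus_le_quarter) auto
  ultimately show False using le by simp
qed

text \<open>Multiplying by \<open>u * w\<close> makes both products on the right bounded below by
  \<open>q\<close>, which reduces the claim to \<open>prod_two_lt\<close>.\<close>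

lemma path_of_four_lt:
  fixes u v w d q :: real
  assumes "0 < u" "u < 1" "0 < w" "w < 1" "q \<le> u * v" "q \<le> d * w" "1/8 < q"
  shows "(1 - u) * (1 - w) < v * (1 - u) + d * (1 - w)"
proof (rule ccontr)
  assume "\<not> ?thesis"
  hence "(u * w) * (v * (1 - u) + d * (1 - w)) \<le> (u * w) * ((1 - u) * (1 - w))"
    using assms by (intro mult_left_mono) auto
  moreover have "q * (w * (1 - u)) \<le> (u * v) * (w * (1 - u))"
    "q * (u * (1 - w)) \<le> (d * w) * (u * (1 - w))"
    using assms by (auto intro!: mult_right_mono)
  ultimately have "q * (w * (1 - u) + u * (1 - w)) \<le> (u * (1 - u)) * (w * (1 - w))"
    by (simp add: algebra_simps)
  with prod_two_lt[of u w q] assms show False by linarith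
qed

text \<open>After multiplication by \<open>a * c\<close> and the estimate
  \<open>1 - b \<le> 1\<close>, this is \<open>prod_two_lt\<close> for the two ends \<open>a\<close>
  and \<open>c\<close>.\<close>

lemma path_meeting_lt:
  fixes a b c d e q :: real
  assumes "0 < a" "a < 1" "0 < b" "b < 1" "0 < c" "c < 1"
    and "q \<le> a * b * c" "1/8 < q" "a * b \<le> d" "b * c \<le> e"
  shows "(1 - a) * (1 - b) * (1 - c) < d * (1 - c) + e * (1 - a)"
proof (rule ccontr)
  assume "\<not> ?thesis"
  moreover have "a * b * (1 - c) \<le> d * (1 - c)" "b * c * (1 - a) \<le> e * (1 - a)"
    using assms by (auto intro!: mult_right_mono)
  ultimately have "a * b * (1 - c) + b * c * (1 - a) \<le> (1 - a) * (1 - b) * (1 - c)" by linarith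
  hence "(a * c) * (a * b * (1 - c) + b * c * (1 - a)) \<le> (a * c) * ((1 - a) * (1 - b) * (1 - c))"
    using assms by (intro mult_left_mono) auto
  hence "(a * b * c) * (c * (1 - a) + a * (1 - c)) \<le> (1 - b) * ((a * (1 - a)) * (c * (1 - c)))"
    by (simp add: algebra_simps)
  moreover have "(1 - b) * ((a * (1 - a)) * (c * (1 - c))) \<le> 1 * ((a * (1 - a)) * (c * (1 - c)))"
    using assms by (intro mult_right_mono) auto
  ultimately show False using prod_two_lt[of a c "a * b * c"] assms by linarith
qed

text \<open>Multiplying by \<open>d * e\<close> produces \<open>d * (1 - a - d)\<close>, which is at
  most \<open>(1 - a)\<^sup>2 / 4\<close>, and likewise for \<open>e\<close>. Cancelling
  \<open>(1 - a) * (1 - c)\<close> and multiplying by \<open>a * c\<close> then bounds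
  \<open>q * q\<close> by 1/256.\<close>

lemma path_disjoint_lt:
  fixes a b c d e q :: real
  assumes "0 < a" "a < 1" "0 < b" "b < 1" "0 < c" "c < 1" "0 < d" "0 < e"
    and "q \<le> a * b * c" "1/8 < q" "q \<le> d * e" "d \<le> 1 - a" "e \<le> 1 - c"
  shows "(1 - a - d) * (1 - c - e) < b * ((1 - a) * (1 - c))"
proof (rule ccontr)
  assume "\<not> ?thesis"
  hence "(d * e) * (b * ((1 - a) * (1 - c))) \<le> (d * e) * ((1 - a - d) * (1 - c - e))"
    using assms by (intro mult_left_mono) auto
  also have "\<dots> = (d * (1 - a - d)) * (e * (1 - c - e))" by simp
  also have "\<dots> \<le> ((1 - a) * (1 - a) / 4) * ((1 - c) * (1 - c) / 4)"
  proof (rule mult_mono)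
    have "0 \<le> ((1 - a) / 2 - d)\<^sup>2" "0 \<le> ((1 - c) / 2 - e)\<^sup>2" by simp_all
    thus "d * (1 - a - d) \<le> (1 - a) * (1 - a) / 4" "e * (1 - c - e) \<le> (1 - c) * (1 - c) / 4"
      by (simp_all add: power2_eq_square field_simps)
  qed (use assms in auto)
  finally have "((1 - a) * (1 - c)) * (d * e * b) \<le> ((1 - a) * (1 - c)) * ((1 - a) * (1 - c) / 16)"
    by (simp add: algebra_simps)
  hence "d * e * b \<le> (1 - a) * (1 - c) / 16"
    using assms by (subst (asm) mult_le_cancel_left_pos) auto
  hence "(a * c) * (d * e * b) \<le> (a * c) * ((1 - a) * (1 - c) / 16)"
    using assms by (intro mult_left_mono) auto
  also have "\<dots> = (a * (1 - a)) * (c * (1 - c)) / 16" by simp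
  also have "\<dots> \<le> (1/4) * (1/4) / 16"
    using assms by (intro divide_right_mono mult_mono mult_one_minus_le_quarter) auto
  finally have "(d * e) * (a * b * c) \<le> 1/256" by (simp add: algebra_simps)
  moreover have "q * q \<le> (d * e) * (a * b * c)" using assms by (intro mult_mono) auto
  moreover have "1/8 * (1/8) < q * q" using assms by (intro mult_strict_mono) auto
  ultimately show False by simp
qed

text \<open>The hypothesis \<open>x\<^sup>2 - 3 * x + 1 < 0\<close> says that \<open>x\<close> exceeds the inverse of the square of the
  golden ratio.\<close>
locale above_golden =
  fixes x :: real
  assumes x01: "0 < x" "x < 1" and golden: "x\<^sup>2 - 3 * x + 1 < 0"
begin

lemma x_gt: "19/50 < x"
proof (rule ccontr)
  assume "\<not> ?thesis"
  \<comment> \<open>131/50 is \<open>3 - 19/50\<close>, so that the linear term agrees with the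
    golden inequality while the constant term stays below 1.\<close>
  hence "0 \<le> (19/50 - x) * (131/50 - x)" by (intro mult_nonneg_nonneg) auto
  also have "\<dots> = x\<^sup>2 - 3 * x + 2489/2500" by (simp add: power2_eq_square field_simps)
  finally show False using golden by simp
qed

lemma xx_gt: "361/2500 < x\<^sup>2"
  using mult_strict_mono[OF x_gt x_gt] x01 by (simp add: power2_eq_square)

lemma one_minus_sq: "(1 - x)\<^sup>2 < x"
  using golden by (simp add: power2_eq_square algebra_simps)

lemma one_disjoint_lt:
  assumes "x \<le> a" "a \<le> 1" "x \<le> b" "x \<le> c"
  shows "(1 - a) * (1 - b) < c"
proof (cases "b \<le> 1")
  case True
  hence "(1 - a) * (1 - b) \<le> (1 - x) * (1 - x)" using assms by (intro mult_mono) auto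
  thus ?thesis using one_minus_sq assms by (simp add: power2_eq_square)
next
  case False
  hence "(1 - a) * (1 - b) \<le> 0" using assms by (intro mult_nonneg_nonpos) auto
  thus ?thesis using assms x01 by simp
qed

text \<open>In the extreme case the left-hand side is \<open>(1 - x) * (1 - 2 * x)\<close>, which
  differs from \<open>x\<^sup>2\<close> by exactly \<open>x\<^sup>2 - 3 * x + 1\<close>; no slack is
  lost.\<close>

lemma two_disjoint_lt:
  assumes "x \<le> a" "a \<le> 1" "x \<le> b" "x \<le> c" "x\<^sup>2 \<le> z"
  shows "(1 - a) * (1 - b - c) < z"
proof (cases "b + c \<le> 1")
  case True
  hence "(1 - a) * (1 - b - c) \<le> (1 - x) * (1 - 2 * x)" using assms by (intro mult_mono) auto
  also have "\<dots> = 1 - 3 * x + 2 * x\<^sup>2" by (simp add: power2_eq_square algebra_simps)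
  finally show ?thesis using golden assms by simp
next
  case False
  hence "(1 - a) * (1 - b - c) \<le> 0" using assms by (intro mult_nonneg_nonpos) auto
  moreover have "0 < x\<^sup>2" using x01 by simp
  ultimately show ?thesis using assms by linarith
qed

text \<open>Eliminating \<open>u + w\<close> by \<open>4 * P \<le> (u + w)\<^sup>2\<close> leaves a
  quadratic inequality in \<open>P\<close> with roots \<open>(1 - x)\<^sup>2\<close> and
  \<open>(1 + x)\<^sup>2\<close>. Since \<open>P < 1\<close>, it lies below the smaller root, which
  is less than \<open>x\<close>.\<close>

lemma product_lt_disjoint:
  assumes "x \<le> u" "u < 1" "x \<le> w" "w < 1" "x\<^sup>2 \<le> (1 - u) * (1 - w)"
  shows "u * w < x"
proof -
  define P where "P = u * w"
  have P: "0 < P" "P < 1" using assms x01 mult_strict_mono[of u 1 w 1] by (auto simp: P_def)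
  have "u + w \<le> 1 + P - x\<^sup>2" using assms by (simp add: P_def algebra_simps)
  hence "(u + w) * (u + w) \<le> (1 + P - x\<^sup>2) * (1 + P - x\<^sup>2)"
    using assms x01 by (intro mult_mono) auto
  moreover have "4 * P \<le> (u + w) * (u + w)"
    using zero_le_power2[of "u - w"] by (simp add: P_def power2_eq_square algebra_simps)
  ultimately have "0 \<le> (1 + P - x\<^sup>2) * (1 + P - x\<^sup>2) - 4 * P" by linarith
  also have "\<dots> = ((1 + x)\<^sup>2 - P) * ((1 - x)\<^sup>2 - P)"
    by (simp add: power2_eq_square algebra_simps)
  finally have "0 \<le> ((1 + x)\<^sup>2 - P) * ((1 - x)\<^sup>2 - P)" .
  moreover have "1 \<le> (1 + x)\<^sup>2" using x01 by (intro one_le_power) simp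
  hence "0 < (1 + x)\<^sup>2 - P" using P by linarith
  ultimately have "P \<le> (1 - x)\<^sup>2" by (simp add: zero_le_mult_iff)
  thus ?thesis using one_minus_sq by (simp add: P_def)
qed

lemma product_lt_meeting:
  assumes "x \<le> u" "x \<le> w" "u + w \<le> 1"
  shows "u * w < x"
proof -
  have "u * w \<le> u * (1 - u)" using assms x01 by (intro mult_left_mono) auto
  thus ?thesis using mult_one_minus_le_quarter[of u] x_gt by simp
qed

lemma sq_gt_of_long:
  assumes "0 < p" "p < x" "p * u\<^sup>2 = x\<^sup>2"
  shows "x < u\<^sup>2"
proof (rule ccontr)
  assume "\<not> ?thesis"
  hence "p * u\<^sup>2 \<le> p * x" using assms by (intro mult_left_mono) auto
  also have "\<dots> < x * x" using assms x01 by simp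
  finally show False using assms by (simp add: power2_eq_square)
qed

lemma gt_of_sq_gt:
  assumes "x < u\<^sup>2" "0 < u"
  shows "77/125 < u"
proof (rule power2_less_imp_less)
  \<comment> \<open>77/125 is a rational number slightly below the square root of 19/50.\<close>
  have "(77/125)\<^sup>2 < (19/50 :: real)" by (simp add: power2_eq_square)
  thus "(77/125)\<^sup>2 < u\<^sup>2" using assms x_gt by linarith
qed (use assms in simp)

lemma meeting_sq_False:
  assumes "x < u\<^sup>2" "0 < u" "x \<le> w" "u + w \<le> 1"
  shows False
proof -
  have "u\<^sup>2 \<le> (1 - x)\<^sup>2" using assms by (intro power_mono) auto
  thus False using assms(1) one_minus_sq by linarith
qed

text \<open>A bootstrap: the lower bound on \<open>u\<close> keeps \<open>1 - w - p\<close> away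
  from 0, which makes \<open>p\<close> small; then \<open>p * u\<^sup>2 = x\<^sup>2\<close> pushes
  \<open>u\<close> up to 769/1000, and the product becomes too small.\<close>

lemma disjoint_long_False:
  assumes "0 < p" "p < x" "p * u\<^sup>2 = x\<^sup>2" "x \<le> w" "0 < u" "u < 1" "x\<^sup>2 \<le> (1 - u) * (1 - w - p)"
  shows False
proof -
  have u: "77/125 < u" using gt_of_sq_gt sq_gt_of_long assms by blast
  have pos: "0 < 1 - w - p"
  proof (rule ccontr)
    assume "\<not> ?thesis"
    hence "(1 - u) * (1 - w - p) \<le> 0" using assms by (intro mult_nonneg_nonpos) auto
    thus False using assms xx_gt by linarith
  qed
  have "(1 - u) * (1 - w - p) \<le> 48/125 * (1 - w - p)"
    using u pos by (intro mult_right_mono) auto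
  from order_trans[OF assms(7) this] have "361/960 \<le> 1 - w - p"
    using xx_gt by (simp add: field_simps)
  hence "p \<le> 61/250" using assms(4) x_gt by linarith
  hence "p * u\<^sup>2 \<le> 61/250 * u\<^sup>2" by (intro mult_right_mono) auto
  hence "361/2500 \<le> 61/250 * u\<^sup>2" using assms(3) xx_gt by linarith
  moreover have "(769/1000)\<^sup>2 \<le> (361/610 :: real)" by (simp add: power2_eq_square)
  ultimately have "(769/1000)\<^sup>2 \<le> u\<^sup>2" by linarith
  hence "769/1000 \<le> u" by (rule power2_le_imp_le) (use assms in simp)
  hence "(1 - u) * (1 - w - p) \<le> 231/1000 * (31/50)"
    using pos assms x_gt by (intro mult_mono) auto
  from order_trans[OF assms(7) this] show False using xx_gt by simp
qed

text \<open>\<open>u\<close> exceeds \<open>y = sqrt x\<close>, which exceeds 1/2, where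
  \<open>u * (1 - u)\<close> decreases. The golden inequality reads \<open>1 - x < y\<close>; using
  it twice bounds \<open>y * (1 - y) * (1 - x)\<close> by \<open>x\<^sup>2\<close>.\<close>

lemma complementary_sq_False:
  assumes "x\<^sup>2 \<le> u * (1 - u) * (1 - w)" "x \<le> w" "w < 1" "0 < u" "u < 1" "x < u\<^sup>2"
  shows False
proof -
  define y where "y = sqrt x"
  have y: "0 < y" "y * y = x" "y < 1" using x01 by (simp_all add: y_def)
  have y2: "y\<^sup>2 = x" using y by (simp add: power2_eq_square)
  have "(1 - x) < y"
    by (rule power2_less_imp_less) (use one_minus_sq y2 y(1) in simp_all)
  have yu: "y < u"
    by (rule power2_less_imp_less) (use assms y2 in simp_all)
  have half: "1/2 < y"
  proof (rule ccontr)
    assume "\<not> ?thesis"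
    hence "y * y \<le> 1/2 * (1/2)" using y by (intro mult_mono) auto
    thus False using y x_gt by simp
  qed
  have "0 < (u - y) * (u + y - 1)" using yu half by (intro mult_pos_pos) auto
  hence "u * (1 - u) < y * (1 - y)" by (simp add: algebra_simps)
  hence "u * (1 - u) * (1 - w) \<le> (y * (1 - y)) * (1 - x)"
    by (rule mult_mono[OF less_imp_le]) (use assms x01 y in auto)
  also have "\<dots> \<le> (y * x) * (1 - x)"
    using \<open>1 - x < y\<close> x01 y by (intro mult_right_mono mult_left_mono) auto
  also have "\<dots> < (y * x) * y" using \<open>1 - x < y\<close> x01 y by (intro mult_strict_left_mono) auto
  also have "\<dots> = x\<^sup>2" using y(2) by (simp add: power2_eq_square)
  finally show False using assms by simp
qed

lemma complementary_sq_other_False: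
  assumes "x\<^sup>2 \<le> u * (1 - u) * (1 - w)" "w < 1" "0 < w" "x < w\<^sup>2"
  shows False
proof -
  have "u * (1 - u) * (1 - w) \<le> 1/4 * (48/125)"
    using gt_of_sq_gt[of w] assms mult_one_minus_le_quarter by (intro mult_mono) auto
  thus False using assms xx_gt by linarith
qed

text \<open>Dividing by \<open>u\<^sup>2\<close>-type factors gives \<open>u + w \<le> 1\<close>, so
  \<open>x\<^sup>2 \<le> u\<^sup>2 * (1 - u)\<close>. This cubic increases up to 2/3, and
  \<open>u \<le> 1 - x < 31/50\<close>, so its value is at most that at \<open>1 - x\<close>, which
  is \<open>(1 - x)\<^sup>2 * x < x\<^sup>2\<close>.\<close>

lemma complementary_exact_False:
  assumes "x\<^sup>2 \<le> u * (1 - u) * (1 - w)" "x \<le> w" "w < 1" "x \<le> u" "u < 1" "x\<^sup>2 = u\<^sup>2 * w"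
  shows False
proof -
  have u0: "0 < u" using assms x01 by simp
  have "u * (u * w) \<le> u * ((1 - u) * (1 - w))" using assms by (simp add: power2_eq_square)
  hence "u * w \<le> (1 - u) * (1 - w)" using u0 by simp
  hence uw: "u + w \<le> 1" by (simp add: algebra_simps)
  define r where "r = 1 - x"
  have r: "u \<le> r" "r < 31/50" "0 < r" using uw assms x_gt x01 by (auto simp: r_def)
  have "r\<^sup>2 + r * u + u\<^sup>2 \<le> r + u"
  proof -
    have "r * r \<le> r * (31/50)" "r * u \<le> 31/50 * u" "u * u \<le> u * (31/50)" using r u0 by simp_all
    thus ?thesis using r unfolding power2_eq_square by linarith
  qed
  hence "0 \<le> (r - u) * (r + u - (r\<^sup>2 + r * u + u\<^sup>2))" using r by (intro mult_nonneg_nonneg) auto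
  hence "u\<^sup>2 * (1 - u) \<le> r\<^sup>2 * (1 - r)" by (simp add: power2_eq_square algebra_simps)
  also have "\<dots> < x * x" using one_minus_sq x01 by (simp add: r_def)
  finally have "u\<^sup>2 * (1 - u) < x\<^sup>2" by (simp add: power2_eq_square)
  moreover have "u\<^sup>2 * w \<le> u\<^sup>2 * (1 - u)" using uw by (intro mult_left_mono) auto
  ultimately show False using assms by simp
qed

text \<open>The first hypothesis caps \<open>w\<close>, so the exact relation forces
  \<open>u \<ge> 4/5\<close>; then \<open>(1 - u) * (1 - w)\<close> cannot reach
  \<open>w\<^sup>2\<close>.\<close>

lemma complementary_exact_other_False:
  assumes "x\<^sup>2 \<le> u * (1 - u) * (1 - w)" "x \<le> w" "w < 1" "x \<le> u" "u < 1" "x\<^sup>2 = w\<^sup>2 * u"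
  shows False
proof -
  have u0: "0 < u" using assms x01 by simp
  have "u * w\<^sup>2 \<le> u * ((1 - u) * (1 - w))" using assms by (simp add: algebra_simps)
  hence 1: "w\<^sup>2 \<le> (1 - u) * (1 - w)" using u0 by simp
  have "u * (1 - u) * (1 - w) \<le> 1/4 * (1 - w)"
    using assms mult_one_minus_le_quarter by (intro mult_right_mono) auto
  from order_trans[OF assms(1) this] have w: "w \<le> 264/625" using xx_gt by (simp add: field_simps)
  have "w * w \<le> 264/625 * (264/625)" using w assms x01 by (intro mult_mono) auto
  hence "w\<^sup>2 * u \<le> 264/625 * (264/625) * u"
    using u0 by (intro mult_right_mono) (auto simp: power2_eq_square)
  hence "4/5 \<le> u" using assms xx_gt by simp
  hence "(1 - u) * (1 - w) \<le> 1/5 * (31/50)" using assms x_gt by (intro mult_mono) auto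
  moreover have "x\<^sup>2 \<le> w\<^sup>2" using assms x01 by (intro power_mono) auto
  ultimately show False using 1 xx_gt by linarith
qed

end

section \<open>Cycles of a skew-reciprocal system\<close>

text \<open>The abstraction of the cycles of an irreducible matrix of size \<open>2 * g\<close> whose spectral radius
  is \<open>1 / t\<close> and whose determinant is \<open>eps\<close>; the last assumption is skew-reciprocity.\<close>
locale cycle_system =
  fixes G :: "'c set" and s :: "'c \<Rightarrow> nat set" and g :: nat and t eps :: real
  assumes fin: "finite G" and supp: "\<And>c. c \<in> G \<Longrightarrow> s c \<noteq> {} \<and> s c \<subseteq> {..<2 * g}"
    and g_pos: "0 < g" and t01: "0 < t" "t < 1"
    and zero: "clique_sum s G t = 0"
    and nonneg: "\<And>F. F \<subseteq> G \<Longrightarrow> 0 \<le> clique_sum s F t"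
    and cross: "\<And>U. U \<noteq> {} \<Longrightarrow> U \<subset> {..<2 * g} \<Longrightarrow> \<exists>c\<in>G. s c \<inter> U \<noteq> {} \<and> \<not> s c \<subseteq> U"
    and eps: "eps = 1 \<or> eps = - 1"
    and sym: "\<And>k. k \<le> 2 * g \<Longrightarrow>
      (\<Sum>K | K \<in> cliques s G \<and> (\<Sum>c\<in>K. card (s c)) = 2 * g - k. (- 1) ^ card K :: real) =
      eps * (- 1) ^ k * (\<Sum>K | K \<in> cliques s G \<and> (\<Sum>c\<in>K. card (s c)) = k. (- 1) ^ card K)"
begin

definition len :: "'c \<Rightarrow> nat" where "len c = card (s c)"
definition w :: "'c \<Rightarrow> real" where "w c = t ^ len c"
text \<open>The weight of length \<open>g\<close>, and so the threshold between short cycles, of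
  weight at least \<open>x\<close>, and long ones. All cycle weights are at least
  \<open>x\<^sup>2\<close>.\<close>

definition x :: real where "x = t ^ g"
definition total :: "'c set \<Rightarrow> nat" where "total K = (\<Sum>c\<in>K. len c)"
definition coef :: "nat \<Rightarrow> real" where
  "coef k = (\<Sum>K | K \<in> cliques s G \<and> total K = k. (- 1) ^ card K)"

lemma x01: "0 < x" "x < 1"
  using t01 g_pos by (auto simp: x_def power_Suc_less_one power_less_one_iff)

lemma x_sq: "t ^ (2 * g) = x\<^sup>2"
  by (simp add: x_def power_mult[symmetric] mult.commute)

lemma coef_sym: "k \<le> 2 * g \<Longrightarrow> coef (2 * g - k) = eps * (- 1) ^ k * coef k"
  using sym unfolding coef_def total_def len_def .

lemma finite_s: "c \<in> G \<Longrightarrow> finite (s c)"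
  using supp finite_subset by blast

lemma len_pos: "c \<in> G \<Longrightarrow> 0 < len c"
  using supp finite_s by (auto simp: len_def card_gt_0_iff)

lemma len_le: "c \<in> G \<Longrightarrow> len c \<le> 2 * g"
  using card_mono[of "{..<2 * g}" "s c"] supp by (auto simp: len_def)

lemma w_pos: "0 < w c"
  using t01 by (simp add: w_def)

lemma w_less_1: "c \<in> G \<Longrightarrow> w c < 1"
  using t01 len_pos[of c] by (auto simp: w_def power_less_one_iff)

lemma power_le_of_ge: "k \<le> m \<Longrightarrow> t ^ m \<le> t ^ k"
  using t01 by (intro power_decreasing) auto

lemma w_ge_sq: "c \<in> G \<Longrightarrow> x\<^sup>2 \<le> w c"
  unfolding w_def x_sq[symmetric] using len_le by (rule power_le_of_ge)

lemma w_short: "len c \<le> g \<Longrightarrow> x \<le> w c"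
  unfolding w_def x_def by (rule power_le_of_ge)

lemma w_long: "g < len c \<Longrightarrow> w c < x"
  unfolding w_def x_def using t01 by (intro power_strict_decreasing) auto

lemma disjnt_neq: "c \<in> G \<Longrightarrow> disjnt (s c) (s d) \<Longrightarrow> c \<noteq> d"
  using supp by (auto simp: disjnt_def)

lemma disjnt_comm: "disjnt (s c) (s d) \<Longrightarrow> disjnt (s d) (s c)"
  by (rule disjnt_sym)

lemma finite_clique: "K \<in> cliques s G \<Longrightarrow> finite K"
  using fin by (auto simp: cliques_def intro: finite_subset)

lemma cliqueD: "K \<in> cliques s G \<Longrightarrow> c \<in> K \<Longrightarrow> c \<in> G"
  "K \<in> cliques s G \<Longrightarrow> c \<in> K \<Longrightarrow> d \<in> K \<Longrightarrow> c \<noteq> d \<Longrightarrow> disjnt (s c) (s d)"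
  by (auto simp: cliques_def pairwise_def)

lemma total_eq_card_Union: "K \<in> cliques s G \<Longrightarrow> total K = card (\<Union>c\<in>K. s c)"
  unfolding total_def len_def using cliques_total[OF fin finite_s] .

lemma total_le: "K \<in> cliques s G \<Longrightarrow> total K \<le> 2 * g"
  using card_mono[of "{..<2 * g}" "\<Union>c\<in>K. s c"] supp cliqueD(1)
  unfolding total_eq_card_Union by fastforce

lemma total_full:
  assumes "K \<in> cliques s G" "total K = 2 * g"
  shows "(\<Union>c\<in>K. s c) = {..<2 * g}"
  by (rule card_subset_eq) (use assms supp cliqueD(1) in \<open>fastforce simp: total_eq_card_Union\<close>)+

lemma pair_clique: "a \<in> G \<Longrightarrow> b \<in> G \<Longrightarrow> disjnt (s a) (s b) \<Longrightarrow> {a, b} \<in> cliques s G"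
  by (auto simp: cliques_def pairwise_insert intro: disjnt_sym)

lemma len_disjoint:
  assumes "a \<in> G" "b \<in> G" "disjnt (s a) (s b)"
  shows "len a + len b \<le> 2 * g"
  using total_le[OF pair_clique[OF assms]] disjnt_neq[OF assms(1,3)] by (simp add: total_def)

lemma w_disjoint:
  assumes "a \<in> G" "b \<in> G" "disjnt (s a) (s b)"
  shows "x\<^sup>2 \<le> w a * w b"
  using power_le_of_ge[OF len_disjoint[OF assms]] by (simp add: w_def x_sq power_add)

lemma w_disjoint3:
  assumes "a \<in> G" "b \<in> G" "c \<in> G" "disjnt (s a) (s b)" "disjnt (s a) (s c)" "disjnt (s b) (s c)"
  shows "x\<^sup>2 \<le> w a * w b * w c"
proof -
  have "{a, b, c} \<in> cliques s G"
    using assms by (auto simp: cliques_def pairwise_insert intro: disjnt_sym)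
  moreover have "a \<noteq> b" "a \<noteq> c" "b \<noteq> c" using assms disjnt_neq by blast+
  ultimately have "len a + len b + len c \<le> 2 * g"
    using total_le[of "{a, b, c}"] by (simp add: total_def)
  from power_le_of_ge[OF this] show ?thesis by (simp add: w_def x_sq power_add)
qed

text \<open>This and the following inequalities are instances of \<open>nonneg\<close> for families
  of two to five cycles; the hypotheses determine the disjointness graph, and with it the clique sum
  as a polynomial in the weights.\<close>

lemma w_meeting2:
  assumes "a \<in> G" "b \<in> G" "a \<noteq> b" "\<not> disjnt (s a) (s b)"
  shows "w a + w b \<le> 1"
  using nonneg[of "{a, b}"] assms by (simp add: clique_sum_insert_Diff insert_Diff_if w_def len_def)

lemma w_meeting3:
  assumes "a \<in> G" "b \<in> G" "c \<in> G" "a \<noteq> b" "a \<noteq> c" "b \<noteq> c"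
    and "\<not> disjnt (s a) (s b)" "\<not> disjnt (s a) (s c)" "\<not> disjnt (s b) (s c)"
  shows "w a + w b + w c \<le> 1"
  using nonneg[of "{a, b, c}"] assms by (simp add: clique_sum_insert_Diff insert_Diff_if w_def len_def)

lemma w_one_disjoint:
  assumes "a \<in> G" "b \<in> G" "c \<in> G" "disjnt (s a) (s b)" "a \<noteq> c" "b \<noteq> c"
    and "\<not> disjnt (s a) (s c)" "\<not> disjnt (s b) (s c)"
  shows "w c \<le> (1 - w a) * (1 - w b)"
  using nonneg[of "{a, b, c}"] disjnt_neq[of a b] assms
  by (simp add: clique_sum_insert_Diff insert_Diff_if w_def len_def algebra_simps)

lemma w_two_disjoint:
  assumes "a \<in> G" "b \<in> G" "c \<in> G" "d \<in> G" "disjnt (s a) (s b)" "disjnt (s a) (s c)"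
    and "b \<noteq> c" "a \<noteq> d" "b \<noteq> d" "c \<noteq> d"
    and "\<not> disjnt (s b) (s c)" "\<not> disjnt (s a) (s d)" "\<not> disjnt (s b) (s d)" "\<not> disjnt (s c) (s d)"
  shows "w d \<le> (1 - w a) * (1 - w b - w c)"
  using nonneg[of "{a, b, c, d}"] disjnt_neq[of a b] disjnt_neq[of a c] assms
  by (simp add: clique_sum_insert_Diff insert_Diff_if w_def len_def algebra_simps)

lemma w_three_disjoint:
  assumes "a \<in> G" "b \<in> G" "c \<in> G" "d \<in> G" "a \<noteq> d" "b \<noteq> d" "c \<noteq> d"
    and "disjnt (s a) (s b)" "disjnt (s a) (s c)" "disjnt (s b) (s c)"
    and "\<not> disjnt (s a) (s d)" "\<not> disjnt (s b) (s d)" "\<not> disjnt (s c) (s d)"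
  shows "w d \<le> (1 - w a) * (1 - w b) * (1 - w c)"
  using nonneg[of "{a, b, c, d}"] disjnt_neq[of a b] disjnt_neq[of a c] disjnt_neq[of b c] assms
  by (simp add: clique_sum_insert_Diff insert_Diff_if w_def len_def algebra_simps)

text \<open>The disjointness graph is the path \<open>b\<close>, \<open>a\<close>, \<open>c\<close>,
  \<open>d\<close>.\<close>

lemma w_path_of_four:
  assumes "a \<in> G" "b \<in> G" "c \<in> G" "d \<in> G" "a \<noteq> d" "b \<noteq> d" "b \<noteq> c"
    and "disjnt (s a) (s b)" "disjnt (s a) (s c)" "disjnt (s c) (s d)"
    and "\<not> disjnt (s b) (s c)" "\<not> disjnt (s a) (s d)" "\<not> disjnt (s b) (s d)"
  shows "w b * (1 - w a) + w d * (1 - w c) \<le> (1 - w a) * (1 - w c)"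
  using nonneg[of "{a, b, c, d}"] disjnt_neq[of a b] disjnt_neq[of a c] disjnt_neq[of c d] assms
  by (simp add: clique_sum_insert_Diff insert_Diff_if w_def len_def algebra_simps)

text \<open>A disjoint triple \<open>a\<close>, \<open>b\<close>, \<open>c\<close> linked by
  \<open>d\<close>, which meets \<open>a\<close> and \<open>b\<close>, and by \<open>e\<close>,
  which meets \<open>b\<close> and \<open>c\<close>. The companion inequality below treats disjoint
  \<open>d\<close> and \<open>e\<close>.\<close>

lemma w_path_meeting:
  assumes "a \<in> G" "b \<in> G" "c \<in> G" "d \<in> G" "e \<in> G" "a \<noteq> d" "b \<noteq> d" "b \<noteq> e" "c \<noteq> e" "d \<noteq> e"
    and "disjnt (s a) (s b)" "disjnt (s a) (s c)" "disjnt (s b) (s c)"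
    and "disjnt (s c) (s d)" "disjnt (s a) (s e)" "\<not> disjnt (s d) (s e)"
    and "\<not> disjnt (s a) (s d)" "\<not> disjnt (s b) (s d)" "\<not> disjnt (s b) (s e)" "\<not> disjnt (s c) (s e)"
  shows "w d * (1 - w c) + w e * (1 - w a) \<le> (1 - w a) * (1 - w b) * (1 - w c)"
proof -
  have "a \<noteq> b" "a \<noteq> c" "b \<noteq> c" "c \<noteq> d" "a \<noteq> e" using assms disjnt_neq by blast+
  thus ?thesis using nonneg[of "{a, b, c, d, e}"] assms
    by (simp add: clique_sum_insert_Diff insert_Diff_if w_def len_def algebra_simps)
qed

lemma w_path_disjoint:
  assumes "a \<in> G" "b \<in> G" "c \<in> G" "d \<in> G" "e \<in> G" "a \<noteq> d" "b \<noteq> d" "b \<noteq> e" "c \<noteq> e" "d \<noteq> e"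
    and "disjnt (s a) (s b)" "disjnt (s a) (s c)" "disjnt (s b) (s c)"
    and "disjnt (s c) (s d)" "disjnt (s a) (s e)" "disjnt (s d) (s e)"
    and "\<not> disjnt (s a) (s d)" "\<not> disjnt (s b) (s d)" "\<not> disjnt (s b) (s e)" "\<not> disjnt (s c) (s e)"
  shows "w b * ((1 - w a) * (1 - w c)) \<le> (1 - w a - w d) * (1 - w c - w e)"
proof -
  have "a \<noteq> b" "a \<noteq> c" "b \<noteq> c" "c \<noteq> d" "a \<noteq> e" using assms disjnt_neq by blast+
  thus ?thesis using nonneg[of "{a, b, c, d, e}"] assms
    by (simp add: clique_sum_insert_Diff insert_Diff_if w_def len_def algebra_simps)
qed

lemma clique_sum_eq_sum_coef: "clique_sum s G t = (\<Sum>k\<le>2 * g. coef k * t ^ k)"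
  unfolding coef_def total_def len_def by (rule clique_sum_expand[OF fin]) (use supp in blast)

text \<open>The coefficients of degree above \<open>g\<close> are expressed through those below \<open>g\<close>, so that only
  cliques of total length at most \<open>g\<close> remain.\<close>
definition tau :: "nat \<Rightarrow> real" where
  "tau k = (if k < g then t ^ k + eps * (- 1) ^ k * t ^ (2 * g - k) else t ^ k)"

lemma low_cliques_zero:
  "(\<Sum>K | K \<in> cliques s G \<and> total K \<le> g. (- 1) ^ card K * tau (total K)) = 0"
proof -
  \<comment> \<open>Degree \<open>g\<close> is its own mirror image and is counted once; this is the
    reason for the case distinction in \<open>tau\<close>.\<close>
  have "{..2 * g} = {..<g} \<union> {g} \<union> {g<..2 * g}" using g_pos by auto
  moreover have "{..<g} \<inter> {g<..2 * g} = {}" by auto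
  ultimately have "(\<Sum>k\<le>2 * g. coef k * t ^ k)
      = (\<Sum>k<g. coef k * t ^ k) + coef g * t ^ g + (\<Sum>k\<in>{g<..2 * g}. coef k * t ^ k)"
    by (simp add: sum.union_disjoint)
  also have "(\<Sum>k\<in>{g<..2 * g}. coef k * t ^ k) = (\<Sum>k<g. coef (2 * g - k) * t ^ (2 * g - k))"
    by (rule sum.reindex_bij_witness[of _ "\<lambda>k. 2 * g - k" "\<lambda>k. 2 * g - k"]) auto
  also have "\<dots> = (\<Sum>k<g. coef k * (eps * (- 1) ^ k * t ^ (2 * g - k)))"
    by (intro sum.cong refl) (simp add: coef_sym)
  finally have "(\<Sum>k\<le>2 * g. coef k * t ^ k) = (\<Sum>k<g. coef k * tau k) + coef g * tau g"
    by (simp add: tau_def algebra_simps sum.distrib)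
  also have "\<dots> = (\<Sum>k\<le>g. coef k * tau k)"
    by (simp add: lessThan_Suc_atMost[symmetric])
  also have "\<dots> = (\<Sum>k\<le>g. \<Sum>K | K \<in> {K \<in> cliques s G. total K \<le> g} \<and> total K = k.
      (- 1) ^ card K * tau (total K))"
    by (intro sum.cong refl) (auto simp: coef_def sum_distrib_right intro!: sum.cong)
  also have "\<dots> = (\<Sum>K\<in>{K \<in> cliques s G. total K \<le> g}. (- 1) ^ card K * tau (total K))"
    by (rule sum.group) (use fin in auto)
  finally show ?thesis using zero clique_sum_eq_sum_coef by simp
qed

lemma coef_pos_obtain:
  assumes "0 < coef k"
  obtains K where "K \<in> cliques s G" "total K = k" "even (card K)"
proof -
  have "\<exists>K\<in>{K \<in> cliques s G. total K = k}. even (card K)"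
  proof (rule ccontr)
    assume "\<not> ?thesis"
    hence "coef k \<le> 0" unfolding coef_def by (intro sum_nonpos) auto
    thus False using assms by simp
  qed
  thus ?thesis using that by auto
qed

lemma coef_neg_obtain:
  assumes "coef k < 0"
  obtains K where "K \<in> cliques s G" "total K = k" "odd (card K)"
proof -
  have "\<exists>K\<in>{K \<in> cliques s G. total K = k}. odd (card K)"
  proof (rule ccontr)
    assume "\<not> ?thesis"
    hence "0 \<le> coef k" unfolding coef_def by (intro sum_nonneg) auto
    thus False using assms by simp
  qed
  thus ?thesis using that by auto
qed

lemma total_0_iff: "K \<in> cliques s G \<Longrightarrow> total K = 0 \<longleftrightarrow> K = {}"
  using finite_clique[of K] len_pos cliqueD(1)[of K] by (fastforce simp: total_def)

lemma coef_0: "coef 0 = 1"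
proof -
  have "{K. K \<in> cliques s G \<and> total K = 0} = {{}}"
    using total_0_iff by (auto simp: total_def)
  thus ?thesis by (simp add: coef_def)
qed

lemma coef_top: "coef (2 * g) = eps"
  using coef_sym[of 0] by (simp add: coef_0)

lemma len_le_total: "K \<in> cliques s G \<Longrightarrow> c \<in> K \<Longrightarrow> len c \<le> total K"
  unfolding total_def by (rule member_le_sum) (use finite_clique in auto)

text \<open>Otherwise only the empty clique survives in the folded identity, which becomes
  \<open>1 + eps * x\<^sup>2 = 0\<close>.\<close>

lemma exists_short: "\<exists>c\<in>G. len c \<le> g"
proof (rule ccontr)
  assume no: "\<not> ?thesis"
  have "{K. K \<in> cliques s G \<and> total K \<le> g} = {{}}"
  proof (intro subset_antisym subsetI)
    fix K assume K: "K \<in> {K. K \<in> cliques s G \<and> total K \<le> g}"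
    have "c \<notin> K" for c using len_le_total[of K c] cliqueD(1)[of K c] K no by fastforce
    thus "K \<in> {{}}" by blast
  qed (auto simp: total_def)
  with low_cliques_zero have "1 + eps * x\<^sup>2 = 0"
    using g_pos by (simp add: tau_def total_def x_sq)
  moreover have "x\<^sup>2 < 1" using x01 by (simp add: power_less_one_iff)
  moreover have "0 \<le> x\<^sup>2" by simp
  ultimately show False using eps by (elim disjE) simp_all
qed

text \<open>A cycle that leaves \<open>s a\<close> must enter another member of \<open>K\<close>,
  because \<open>K\<close> covers all vertices.\<close>

lemma full_cover_crossing:
  assumes K: "K \<in> cliques s G" "total K = 2 * g" and a: "a \<in> K" "b \<in> K" "a \<noteq> b"
  obtains d c where "d \<in> G" "c \<in> K" "a \<noteq> c" "\<not> disjnt (s a) (s d)" "\<not> disjnt (s c) (s d)"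
    "d \<notin> K"
proof -
  have "s a \<subset> {..<2 * g}"
  proof
    show "s a \<noteq> {..<2 * g}"
      using supp[OF cliqueD(1)[OF K(1) a(2)]] cliqueD(2)[OF K(1) a] by (auto simp: disjnt_def)
  qed (use supp[OF cliqueD(1)[OF K(1) a(1)]] in auto)
  moreover have "s a \<noteq> {}" using supp[OF cliqueD(1)[OF K(1) a(1)]] by simp
  ultimately have "\<exists>d\<in>G. s d \<inter> s a \<noteq> {} \<and> \<not> s d \<subseteq> s a" by (intro cross)
  then obtain d where d: "d \<in> G" "s d \<inter> s a \<noteq> {}" "\<not> s d \<subseteq> s a" by blast
  then obtain i where i: "i \<in> s d" "i \<notin> s a" by blast
  hence "i \<in> (\<Union>c\<in>K. s c)" using total_full[OF K] supp[OF d(1)] by auto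
  then obtain c where c: "c \<in> K" "i \<in> s c" by blast
  have ac: "a \<noteq> c" using i c by auto
  have "d \<notin> K"
  proof
    assume "d \<in> K"
    moreover have "d \<noteq> a" "\<not> disjnt (s d) (s a)" using i d by (auto simp: disjnt_def)
    ultimately show False using cliqueD(2)[OF K(1)] a(1) by blast
  qed
  thus ?thesis using that[of d c] d i c ac by (auto simp: disjnt_def)
qed

text \<open>If the vertices are covered by at least two disjoint cycles, a cycle through two of them
  forces \<open>x \<le> 1/2\<close>; otherwise a cycle through all vertices meets a short one.\<close>
theorem odd_bound: "x + x\<^sup>2 \<le> 1"
proof (rule ccontr)
  assume "\<not> ?thesis"
  hence gt: "1 < x + x\<^sup>2" by simp
  have half: "1/2 < x"
  proof (rule ccontr)
    assume "\<not> ?thesis"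
    hence "x * x \<le> 1/2 * (1/2)" using x01 by (intro mult_mono) auto
    thus False using gt \<open>\<not> 1/2 < x\<close> by (simp add: power2_eq_square)
  qed
  have "1/2 * (1/2) < x * x" using half by (intro mult_strict_mono) auto
  hence quarter: "1/4 < x\<^sup>2" by (simp add: power2_eq_square)
  obtain K where K: "K \<in> cliques s G" "total K = 2 * g"
  proof (cases "0 < coef (2 * g)")
    case True
    thus ?thesis using that coef_pos_obtain by metis
  next
    case False
    hence "coef (2 * g) < 0" using eps by (auto simp: coef_top)
    thus ?thesis using that coef_neg_obtain by metis
  qed
  have "K \<noteq> {}" using K g_pos by (auto simp: total_def)
  then obtain a where a: "a \<in> K" by blast
  show False
  proof (cases "K = {a}")
    case True
    obtain c where c: "c \<in> G" "len c \<le> g" using exists_short by blast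
    have full: "s a = {..<2 * g}" using total_full[OF K] True by simp
    have "len a = 2 * g" by (simp add: len_def full)
    hence "a \<noteq> c" using c(2) g_pos by (intro notI) simp
    moreover have "\<not> disjnt (s a) (s c)" using supp[OF c(1)] unfolding full disjnt_def by blast
    ultimately have "w a + w c \<le> 1" by (intro w_meeting2 c(1) cliqueD(1)[OF K(1) a])
    thus False using w_ge_sq[OF cliqueD(1)[OF K(1) a]] w_short[OF c(2)] gt by linarith
  next
    case False
    then obtain b where b: "b \<in> K" "a \<noteq> b" using a by blast
    obtain d c where dc: "d \<in> G" "c \<in> K" "a \<noteq> c" "\<not> disjnt (s a) (s d)" "\<not> disjnt (s c) (s d)"
      "d \<notin> K" using full_cover_crossing[OF K a b] by blast
    have G: "a \<in> G" "c \<in> G" using cliqueD(1)[OF K(1)] a dc by auto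
    have disj: "disjnt (s a) (s c)" using cliqueD(2)[OF K(1) a dc(2,3)] .
    have "w d \<le> (1 - w a) * (1 - w c)"
      by (rule w_one_disjoint) (use G dc disj a in auto)
    hence "x\<^sup>2 \<le> (1 - w a) * (1 - w c)" using w_ge_sq[OF dc(1)] by linarith
    moreover have "x\<^sup>2 \<le> w a * w c" by (rule w_disjoint[OF G disj])
    \<comment> \<open>The two lower bounds are multiplied so that each weight can be paired with its
      complement, at a cost of 1/4 for each pair.\<close>
    ultimately have "x\<^sup>2 * x\<^sup>2 \<le> (w a * w c) * ((1 - w a) * (1 - w c))"
      by (intro mult_mono) (use w_pos[of a] w_pos[of c] in auto)
    also have "\<dots> = (w a * (1 - w a)) * (w c * (1 - w c))" by simp
    also have "\<dots> \<le> 1/4 * (1/4)"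
      using w_less_1[OF G(1)] w_less_1[OF G(2)] w_pos[of c] by (intro mult_mono mult_one_minus_le_quarter) auto
    finally have "x\<^sup>2 * x\<^sup>2 \<le> 1/4 * (1/4)" .
    moreover have "1/4 * (1/4) < x\<^sup>2 * x\<^sup>2" using quarter by (intro mult_strict_mono) auto
    ultimately show False by simp
  qed
qed

end

section \<open>Even \<open>g\<close>: covers and short cycles\<close>

locale even_cycle_system = cycle_system G s g t eps
  for G :: "'c set" and s :: "'c \<Rightarrow> nat set" and g :: nat and t eps :: real +
  assumes even_g: "even g" and golden: "x\<^sup>2 - 3 * x + 1 < 0"
begin

sublocale above_golden x
  by unfold_locales (use x01 golden in auto)

abbreviation short :: "'c \<Rightarrow> bool" where "short c \<equiv> c \<in> G \<and> len c \<le> g"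

lemma eighth: "1/8 < x\<^sup>2"
  using xx_gt by simp

lemma no_three_disjoint_met:
  assumes "a \<in> G" "b \<in> G" "c \<in> G" "d \<in> G" "a \<noteq> d" "b \<noteq> d" "c \<noteq> d"
    and "disjnt (s a) (s b)" "disjnt (s a) (s c)" "disjnt (s b) (s c)"
    and "\<not> disjnt (s a) (s d)" "\<not> disjnt (s b) (s d)" "\<not> disjnt (s c) (s d)"
  shows False
proof -
  have "(1 - w a) * (1 - w b) * (1 - w c) < x\<^sup>2"
    by (rule prod_three_lt)
      (use assms w_pos w_less_1 w_disjoint3 eighth in \<open>auto intro: less_imp_le\<close>)
  moreover have "w d \<le> (1 - w a) * (1 - w b) * (1 - w c)"
    by (rule w_three_disjoint) (use assms in auto)
  ultimately show False using w_ge_sq[OF assms(4)] by linarith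
qed

lemma card_Un_disjoint_s:
  "a \<in> G \<Longrightarrow> b \<in> G \<Longrightarrow> disjnt (s a) (s b) \<Longrightarrow> card (s a \<union> s b) = len a + len b"
  using finite_s by (simp add: len_def card_Un_disjnt)

text \<open>The inclusions make \<open>d\<close> disjoint from \<open>c\<close> and \<open>e\<close>
  disjoint from \<open>a\<close>, and they bound the lengths of \<open>d\<close> and
  \<open>e\<close>, hence their weights from below. Whether \<open>d\<close> and \<open>e\<close>
  meet decides which of the two path inequalities applies.\<close>

lemma no_path:
  assumes G: "a \<in> G" "b \<in> G" "c \<in> G" "d \<in> G" "e \<in> G"
    and neq: "a \<noteq> d" "b \<noteq> d" "b \<noteq> e" "c \<noteq> e"
    and disj: "disjnt (s a) (s b)" "disjnt (s a) (s c)" "disjnt (s b) (s c)"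
    and meet: "\<not> disjnt (s a) (s d)" "\<not> disjnt (s b) (s d)" "\<not> disjnt (s b) (s e)" "\<not> disjnt (s c) (s e)"
    and sub: "s d \<subseteq> s a \<union> s b" "s e \<subseteq> s b \<union> s c"
  shows False
proof -
  have cd: "disjnt (s c) (s d)" and ae: "disjnt (s a) (s e)"
    using sub disj by (auto simp: disjnt_def)
  hence de: "d \<noteq> e" using meet by auto
  have pos: "0 < w c" "w c < 1" if "c \<in> G" for c using w_pos w_less_1 that by auto
  have abc: "x\<^sup>2 \<le> w a * w b * w c" by (rule w_disjoint3) (use assms in auto)
  have "len d \<le> len a + len b" "len e \<le> len b + len c"
    using card_mono[OF _ sub(1)] card_mono[OF _ sub(2)] finite_s[OF G(1)] finite_s[OF G(2)] finite_s[OF G(3)]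
      card_Un_disjoint_s[OF G(1,2) disj(1)] card_Un_disjoint_s[OF G(2,3) disj(3)]
    by (simp_all add: len_def)
  hence d: "w a * w b \<le> w d" "w b * w c \<le> w e"
    using power_le_of_ge by (simp_all add: w_def power_add[symmetric])
  show False
  proof (cases "disjnt (s d) (s e)")
    case False
    have "(1 - w a) * (1 - w b) * (1 - w c) < w d * (1 - w c) + w e * (1 - w a)"
      by (rule path_meeting_lt) (use pos G abc eighth d in auto)
    moreover have "w d * (1 - w c) + w e * (1 - w a) \<le> (1 - w a) * (1 - w b) * (1 - w c)"
      by (rule w_path_meeting) (use assms cd ae de False in auto)
    ultimately show False by linarith
  next
    case True
    have "w a + w d \<le> 1" "w c + w e \<le> 1" using w_meeting2 G neq meet by blast+
    hence "(1 - w a - w d) * (1 - w c - w e) < w b * ((1 - w a) * (1 - w c))"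
      by (intro path_disjoint_lt[where q = "x\<^sup>2"])
        (use pos G abc eighth w_disjoint[OF G(4,5) True] in auto)
    moreover have "w b * ((1 - w a) * (1 - w c)) \<le> (1 - w a - w d) * (1 - w c - w e)"
      by (rule w_path_disjoint) (use assms cd ae de True in auto)
    ultimately show False by linarith
  qed
qed

text \<open>Three cycles of the cover are linked either by one cycle through all of them or by
  two cycles, each through exactly two of them.\<close>
lemma full_cover_card_le_2:
  assumes K: "K \<in> cliques s G" "total K = 2 * g"
  shows "card K \<le> 2"
proof (rule ccontr)
  assume "\<not> card K \<le> 2"
  then obtain T where T: "T \<subseteq> K" "card T = 3"
    using obtain_subset_with_card_n[of 3 K] by auto
  then obtain a b0 c0 where abc: "a \<in> K" "b0 \<in> K" "c0 \<in> K" "a \<noteq> b0" "a \<noteq> c0" "b0 \<noteq> c0"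
    by (auto simp: card_3_iff)
  have inG: "c \<in> G" if "c \<in> K" for c using cliqueD(1)[OF K(1) that] .
  have disj: "disjnt (s c) (s d)" if "c \<in> K" "d \<in> K" "c \<noteq> d" for c d
    using cliqueD(2)[OF K(1) that] .
  have covered: "\<exists>c\<in>K. i \<in> s c" if "i < 2 * g" for i
    using total_full[OF K] that by blast
  obtain d b where d: "d \<in> G" "b \<in> K" "a \<noteq> b" "\<not> disjnt (s a) (s d)" "\<not> disjnt (s b) (s d)" "d \<notin> K"
    using full_cover_crossing[OF K abc(1,2,4)] by blast
  have three: False if "e \<in> G" "e \<notin> K" "p \<in> K" "q \<in> K" "r \<in> K" "p \<noteq> q" "p \<noteq> r" "q \<noteq> r"
    "\<not> disjnt (s p) (s e)" "\<not> disjnt (s q) (s e)" "\<not> disjnt (s r) (s e)" for e p q r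
  proof (rule no_three_disjoint_met)
    show "p \<noteq> e" "q \<noteq> e" "r \<noteq> e" using that by auto
  qed (use that inG disj in auto)
  \<comment> \<open>A cycle outside the cover that meets two members cannot meet a third, so these
    two contain it entirely.\<close>
  have inside: "s e \<subseteq> s p \<union> s q"
    if e: "e \<in> G" "e \<notin> K" "p \<in> K" "q \<in> K" "p \<noteq> q" "\<not> disjnt (s p) (s e)" "\<not> disjnt (s q) (s e)" for e p q
  proof
    fix i assume i: "i \<in> s e"
    hence "i < 2 * g" using supp[OF e(1)] by auto
    then obtain r where r: "r \<in> K" "i \<in> s r" using covered by blast
    hence "\<not> disjnt (s r) (s e)" using i by (auto simp: disjnt_def)
    hence "r = p \<or> r = q" using three[OF e(1,2,3,4) r(1) e(5)] e(6,7) by blast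
    thus "i \<in> s p \<union> s q" using r by blast
  qed
  have "\<exists>c\<in>K. c \<noteq> a \<and> c \<noteq> b" using abc by metis
  then obtain c1 where c1: "c1 \<in> K" "c1 \<noteq> a" "c1 \<noteq> b" by blast
  let ?U = "s a \<union> s b"
  have "?U \<subset> {..<2 * g}"
  proof
    show "?U \<subseteq> {..<2 * g}" using supp inG abc(1) d(2) by blast
    have "s c1 \<inter> ?U = {}" using disj[OF c1(1) abc(1) c1(2)] disj[OF c1(1) d(2) c1(3)]
      by (auto simp: disjnt_def)
    thus "?U \<noteq> {..<2 * g}" using supp[OF inG[OF c1(1)]] by blast
  qed
  moreover have "?U \<noteq> {}" using supp[OF inG[OF abc(1)]] by blast
  ultimately have "\<exists>e\<in>G. s e \<inter> ?U \<noteq> {} \<and> \<not> s e \<subseteq> ?U" by (intro cross)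
  then obtain e where e: "e \<in> G" "s e \<inter> ?U \<noteq> {}" "\<not> s e \<subseteq> ?U" by blast
  then obtain i where i: "i \<in> s e" "i \<notin> ?U" by blast
  then obtain c where c: "c \<in> K" "i \<in> s c" using covered[of i] supp[OF e(1)] by blast
  have cne: "c \<noteq> a" "c \<noteq> b" using c i by auto
  have ce: "\<not> disjnt (s c) (s e)" using c i by (auto simp: disjnt_def)
  have eK: "e \<notin> K"
  proof
    assume eK: "e \<in> K"
    hence "e = c" using disj[OF c(1) eK] ce by blast
    thus False using e(2) disj[OF c(1) abc(1) cne(1)] disj[OF c(1) d(2) cne(2)]
      by (auto simp: disjnt_def)
  qed
  \<comment> \<open>The roles of \<open>a\<close> and \<open>b\<close> are left open: the middle of
    the path is whichever of them \<open>e\<close> meets.\<close>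
  have path: False if p: "p \<in> K" "q \<in> K" "p \<noteq> q" "c \<noteq> p" "c \<noteq> q" "\<not> disjnt (s p) (s d)"
    "\<not> disjnt (s q) (s d)" "\<not> disjnt (s q) (s e)" for p q
  proof (rule no_path[of p q c d e])
    show "s d \<subseteq> s p \<union> s q" by (rule inside) (use p d in auto)
    show "s e \<subseteq> s q \<union> s c" by (rule inside) (use p c e eK ce in auto)
  qed (use p c d e eK ce inG disj in auto)
  show False
  proof (cases "disjnt (s a) (s e)")
    case False
    show False by (rule path[of b a]) (use abc d cne False in auto)
  next
    case True
    hence "\<not> disjnt (s b) (s e)" using e(2) by (auto simp: disjnt_def)
    thus False by (intro path[of a b]) (use abc d cne in auto)
  qed
qed

text \<open>\<open>eps\<close> is the coefficient of top degree, so its sign is the parity of the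
  size of some cover. Size at most two then leaves one cycle here and two complementary cycles for
  the other sign.\<close>

lemma full_cycle:
  assumes "eps = - 1"
  obtains z where "z \<in> G" "s z = {..<2 * g}"
proof -
  obtain K where K: "K \<in> cliques s G" "total K = 2 * g" "odd (card K)"
    using coef_neg_obtain[of "2 * g"] assms by (auto simp: coef_top)
  have "card K = 1" using full_cover_card_le_2[OF K(1,2)] K(3) by (cases "card K = 2") (auto elim: oddE)
  then obtain z where "K = {z}" by (rule card_1_singletonE)
  thus ?thesis using that[of z] total_full[OF K(1,2)] cliqueD(1)[OF K(1)] by simp
qed

lemma complementary_cycles:
  assumes "eps = 1"
  obtains a b where "a \<in> G" "b \<in> G" "disjnt (s a) (s b)" "s a \<union> s b = {..<2 * g}"
    "len a + len b = 2 * g"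
proof -
  obtain K where K: "K \<in> cliques s G" "total K = 2 * g" "even (card K)"
    using coef_pos_obtain[of "2 * g"] assms by (auto simp: coef_top)
  have "K \<noteq> {}" using K g_pos by (auto simp: total_def)
  hence "card K \<noteq> 0" using finite_clique[OF K(1)] by simp
  hence "card K = 2" using full_cover_card_le_2[OF K(1,2)] K(3) by (cases "card K = 1") auto
  then obtain a b where ab: "K = {a, b}" "a \<noteq> b" by (auto simp: card_2_iff)
  thus ?thesis using that[of a b] total_full[OF K(1,2)] cliqueD[OF K(1)] K(2) by (auto simp: total_def)
qed

context
  fixes a b d
  assumes ab: "a \<in> G" "b \<in> G" "disjnt (s a) (s b)" "s a \<union> s b = {..<2 * g}"
    "len a + len b = 2 * g"
    and d: "d \<in> G" "\<not> disjnt (s a) (s d)" "\<not> disjnt (s b) (s d)"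
begin

lemma complementary_w: "w a * w b = x\<^sup>2"
  using ab(5) by (simp add: w_def power_add[symmetric] x_sq)

lemma complementary_distinct: "a \<noteq> b" "a \<noteq> d" "b \<noteq> d"
  using disjnt_neq[OF ab(1,3)] ab(3) d(2,3) by (auto simp: disjnt_sym dest: disjnt_sym)

text \<open>Since \<open>w a * w b = x\<^sup>2\<close>, the inequality for three cycles bounds the
  sum of the weights by \<open>1 + x\<^sup>2\<close>, and \<open>w a + w b \<ge> 2 * x\<close>. A
  short \<open>d\<close> would add another \<open>x\<close>, against the golden inequality.\<close>

lemma crossing_long: "g < len d"
proof (rule ccontr)
  assume "\<not> ?thesis"
  hence wd: "x \<le> w d" by (intro w_short) simp
  have "w d \<le> (1 - w a) * (1 - w b)"
    by (rule w_one_disjoint) (use ab d complementary_distinct in auto)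
  hence "w a + w b + w d \<le> 1 + x\<^sup>2" using complementary_w by (simp add: algebra_simps)
  moreover have "2 * x \<le> w a + w b"
    by (rule twice_le_sum_of_mult_eq[OF complementary_w]) (use w_pos[of a] w_pos[of b] in auto)
  ultimately show False using wd golden by simp
qed

text \<open>A short cycle meeting both \<open>a\<close> and \<open>b\<close> would have to be long
  by the same computation. If it meets only one of them and avoids \<open>d\<close>, the four cycles
  form a path in the disjointness graph, which \<open>path_of_four_lt\<close> rules out.\<close>

lemma crossing_meets_short:
  assumes c: "short c"
  shows "\<not> disjnt (s c) (s d)"
proof
  assume cd: "disjnt (s c) (s d)"
  hence c_neq: "c \<noteq> a" "c \<noteq> b" "c \<noteq> d" using d disjnt_neq[OF _ cd] c by auto
  have *: False if p: "p \<in> G" "q \<in> G" "disjnt (s p) (s q)" "w p * w q = x\<^sup>2" "p \<noteq> d" "q \<noteq> d" "q \<noteq> c"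
    "\<not> disjnt (s p) (s d)" "\<not> disjnt (s q) (s d)" "disjnt (s p) (s c)" "\<not> disjnt (s q) (s c)" for p q
  proof -
    have "w q * (1 - w p) + w d * (1 - w c) \<le> (1 - w p) * (1 - w c)"
      by (rule w_path_of_four) (use p c d cd in auto)
    moreover have "(1 - w p) * (1 - w c) < w q * (1 - w p) + w d * (1 - w c)"
      by (rule path_of_four_lt[where q = "x\<^sup>2"])
        (use p c w_pos w_less_1 eighth w_disjoint[OF d(1) _ disjnt_comm[OF cd]] in auto)
    ultimately show False by linarith
  qed
  have "\<not> disjnt (s a) (s c) \<or> \<not> disjnt (s b) (s c)"
    using supp[of c] c ab(4) by (auto simp: disjnt_def)
  moreover have "\<not> (\<not> disjnt (s a) (s c) \<and> \<not> disjnt (s b) (s c))"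
  proof
    assume meets: "\<not> disjnt (s a) (s c) \<and> \<not> disjnt (s b) (s c)"
    have "w c \<le> (1 - w a) * (1 - w b)"
      by (rule w_one_disjoint) (use ab c c_neq meets in auto)
    hence "w a + w b + w c \<le> 1 + x\<^sup>2" using complementary_w by (simp add: algebra_simps)
    moreover have "2 * x \<le> w a + w b"
      by (rule twice_le_sum_of_mult_eq[OF complementary_w]) (use w_pos[of a] w_pos[of b] in auto)
    ultimately show False using w_short[of c] c golden by simp
  qed
  ultimately consider "disjnt (s a) (s c)" "\<not> disjnt (s b) (s c)"
    | "disjnt (s b) (s c)" "\<not> disjnt (s a) (s c)" by blast
  thus False
  proof cases
    case 1
    show False by (rule *[of a b]) (use 1 ab d c_neq complementary_distinct complementary_w in auto)
  next
    case 2
    show False by (rule *[of b a])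
      (use 2 ab d c_neq complementary_distinct complementary_w disjnt_comm in \<open>auto simp: mult.commute\<close>)
  qed
qed

end

lemma complementary_crossing:
  assumes ab: "a \<in> G" "b \<in> G" "disjnt (s a) (s b)" "s a \<union> s b = {..<2 * g}"
  obtains d where "d \<in> G" "\<not> disjnt (s a) (s d)" "\<not> disjnt (s b) (s d)"
proof -
  have "s a \<noteq> {}" "s a \<subset> {..<2 * g}" using supp[OF ab(1)] supp[OF ab(2)] ab(3,4)
    by (auto simp: disjnt_def)
  hence "\<exists>d\<in>G. s d \<inter> s a \<noteq> {} \<and> \<not> s d \<subseteq> s a" by (intro cross)
  then obtain d where "d \<in> G" "s d \<inter> s a \<noteq> {}" "\<not> s d \<subseteq> s a" by blast
  thus ?thesis using that[of d] supp[of d] ab(4) by (auto simp: disjnt_def)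
qed

text \<open>Depending on the sign, \<open>z\<close> is a cycle through all vertices or a cycle linking two complementary
  cycles.\<close>
lemma universal_cycle:
  obtains z where "z \<in> G" "g < len z" "\<And>c. short c \<Longrightarrow> \<not> disjnt (s c) (s z)"
proof (cases "eps = 1")
  case True
  obtain a b where ab: "a \<in> G" "b \<in> G" "disjnt (s a) (s b)" "s a \<union> s b = {..<2 * g}"
    "len a + len b = 2 * g"
    using complementary_cycles[OF True] .
  obtain d where d: "d \<in> G" "\<not> disjnt (s a) (s d)" "\<not> disjnt (s b) (s d)"
    using complementary_crossing[OF ab(1-4)] .
  show ?thesis using that[OF d(1) crossing_long[OF ab d]] crossing_meets_short[OF ab d] by blast
next
  case False
  then obtain z where z: "z \<in> G" "s z = {..<2 * g}" using full_cycle eps by metis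
  have "\<not> disjnt (s c) (s z)" if "short c" for c
    using supp[of c] that z(2) by (auto simp: disjnt_def)
  thus ?thesis using that[of z] z g_pos by (simp add: len_def)
qed

text \<open>Up to permutation there are four disjointness patterns. With three or two disjoint pairs
  the universal cycle is added as a fourth member; with one or none the three short cycles already
  conflict.\<close>

lemma no_three_short:
  assumes abc: "short a" "short b" "short c" "a \<noteq> b" "a \<noteq> c" "b \<noteq> c"
  shows False
proof -
  obtain z where z: "z \<in> G" "g < len z" "\<And>c. short c \<Longrightarrow> \<not> disjnt (s c) (s z)"
    using universal_cycle by blast
  have zne: "c \<noteq> z" if "short c" for c using that z(2) by auto
  have wx: "x \<le> w c" "w c \<le> 1" if "short c" for c
    using that w_short w_less_1[of c] by auto
  have two: False if p: "short p" "short q" "short r" "p \<noteq> q" "p \<noteq> r" "q \<noteq> r"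
    "disjnt (s p) (s q)" "disjnt (s p) (s r)" "\<not> disjnt (s q) (s r)" for p q r
  proof -
    have "w z \<le> (1 - w p) * (1 - w q - w r)"
      by (rule w_two_disjoint) (use p z zne in auto)
    moreover have "(1 - w p) * (1 - w q - w r) < w z"
      by (rule two_disjoint_lt) (use p wx w_ge_sq[OF z(1)] in auto)
    ultimately show False by linarith
  qed
  have one: False if p: "short p" "short q" "short r" "p \<noteq> q" "p \<noteq> r" "q \<noteq> r"
    "disjnt (s p) (s q)" "\<not> disjnt (s p) (s r)" "\<not> disjnt (s q) (s r)" for p q r
  proof -
    have "w r \<le> (1 - w p) * (1 - w q)"
      by (rule w_one_disjoint) (use p in auto)
    moreover have "(1 - w p) * (1 - w q) < w r"
      by (rule one_disjoint_lt) (use p wx in auto)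
    ultimately show False by linarith
  qed
  show False
  proof (cases "disjnt (s a) (s b)"; cases "disjnt (s a) (s c)"; cases "disjnt (s b) (s c)")
    assume "disjnt (s a) (s b)" "disjnt (s a) (s c)" "disjnt (s b) (s c)"
    thus False using no_three_disjoint_met[of a b c z] abc z zne by blast
  next
    assume "\<not> disjnt (s a) (s b)" "\<not> disjnt (s a) (s c)" "\<not> disjnt (s b) (s c)"
    hence "w a + w b + w c \<le> 1" using w_meeting3[of a b c] abc by blast
    thus False using wx[OF abc(1)] wx[OF abc(2)] wx[OF abc(3)] x_gt by linarith
  qed (use abc two[of a b c] two[of b a c] two[of c a b] one[of a b c] one[of a c b] one[of b c a]
      disjnt_comm in \<open>metis+\<close>)
qed

text \<open>In terms of lengths: two short cycles have total length above \<open>g\<close>, so they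
  never form a clique of the folded identity.\<close>

lemma product_lt:
  assumes ce: "short c" "short e" "c \<noteq> e"
  shows "w c * w e < x"
proof (cases "disjnt (s c) (s e)")
  case True
  obtain z where z: "z \<in> G" "g < len z" "\<And>c. short c \<Longrightarrow> \<not> disjnt (s c) (s z)"
    using universal_cycle by blast
  have "w z \<le> (1 - w c) * (1 - w e)"
    by (rule w_one_disjoint) (use True ce z in auto)
  thus ?thesis using w_ge_sq[OF z(1)] ce w_short w_less_1 by (intro product_lt_disjoint) auto
next
  case False
  thus ?thesis using w_meeting2[of c e] ce w_short by (intro product_lt_meeting) auto
qed

lemma subset_short: "K \<in> cliques s G \<Longrightarrow> total K \<le> g \<Longrightarrow> K \<subseteq> {c. short c}"
  using len_le_total cliqueD(1) le_trans by blast

lemma tau_0: "tau 0 = 1 + eps * x\<^sup>2"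
  using g_pos by (simp add: tau_def x_sq)

lemma coef_middle: "eps = - 1 \<Longrightarrow> coef g = 0"
  using coef_sym[of g] even_g by simp

lemma singleton_clique: "c \<in> G \<Longrightarrow> {c} \<in> cliques s G"
  by (simp add: cliques_def)

lemma total_singleton [simp]: "total {} = 0" "total {c} = len c"
  by (simp_all add: total_def)

text \<open>The folded identity is \<open>1 + eps * x\<^sup>2 = tau (len c)\<close>. Since
  \<open>w c * v = x\<^sup>2\<close>, even length gives \<open>(1 - w c) * (1 - v) = 0\<close> or
  \<open>(1 - w c) * (1 + v) = 0\<close> according to the sign, and odd length with
  \<open>eps = 1\<close> gives \<open>1 + x\<^sup>2 = w c - v\<close>. All three are impossible.
  Length \<open>g\<close> fails because the middle coefficient vanishes for
  \<open>eps = - 1\<close>.\<close>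

lemma single_short:
  assumes S: "{c. short c} = {c}"
  shows "eps = - 1" "odd (len c)" "len c < g" "x\<^sup>2 + w c + t ^ (2 * g - len c) = 1"
proof -
  have c: "c \<in> G" "len c \<le> g" using S by auto
  have low: "{K. K \<in> cliques s G \<and> total K \<le> g} = {{}, {c}}"
  proof (intro subset_antisym subsetI)
    fix K assume "K \<in> {K. K \<in> cliques s G \<and> total K \<le> g}"
    hence "K \<subseteq> {c}" using subset_short S by blast
    thus "K \<in> {{}, {c}}" by blast
  qed (use c singleton_clique in auto)
  have eq: "1 + eps * x\<^sup>2 = tau (len c)"
    using low_cliques_zero unfolding low by (simp add: tau_0)
  define v where "v = t ^ (2 * g - len c)"
  have wv: "w c * v = x\<^sup>2" using c by (simp add: w_def v_def power_add[symmetric] x_sq)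
  have v: "0 < v" using t01 by (simp add: v_def)
  have w1: "0 < w c" "w c < 1" using w_pos w_less_1 c by auto
  show less: "len c < g"
  proof (rule ccontr)
    assume "\<not> ?thesis"
    hence g: "len c = g" using c by simp
    hence x: "1 + eps * x\<^sup>2 = x" using eq by (simp add: tau_def x_def)
    have "{K. K \<in> cliques s G \<and> total K = g} = {{c}}"
    proof -
      have "{K. K \<in> cliques s G \<and> total K = g} = {K \<in> {{}, {c}}. total K = g}"
        unfolding low[symmetric] by auto
      moreover have "K \<in> {K \<in> {{}, {c}}. total K = g} \<longleftrightarrow> K = {c}" for K
        using g g_pos by (cases "K = {}"; cases "K = {c}") simp_all
      ultimately show ?thesis by (intro subset_antisym subsetI) simp_all
    qed
    hence "coef g = - 1" by (simp add: coef_def)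
    hence "eps = 1" using coef_middle eps by auto
    hence "1 + x\<^sup>2 = x" using x by simp
    moreover have "0 < x\<^sup>2" using x01 by simp
    ultimately show False using x01 by linarith
  qed
  have T: "1 + eps * x\<^sup>2 = w c + eps * (- 1) ^ len c * v"
    using eq less by (simp add: tau_def w_def v_def)
  show "eps = - 1"
  proof (rule ccontr)
    assume "eps \<noteq> - 1"
    hence e: "eps = 1" using eps by simp
    show False
    proof (cases "even (len c)")
      case True
      have "v < 1" using t01 len_pos[of c] c g_pos less by (simp add: v_def power_less_one_iff)
      hence "0 < (1 - w c) * (1 - v)" using w1 by simp
      thus False using T e True wv by (simp add: algebra_simps)
    next
      case False
      hence "1 + x\<^sup>2 = w c - v" using T e by simp
      moreover have "0 \<le> x\<^sup>2" by simp
      ultimately show False using v w1 by linarith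
    qed
  qed
  show odd: "odd (len c)"
  proof
    assume "even (len c)"
    hence "1 - x\<^sup>2 = w c - v" using T \<open>eps = - 1\<close> by simp
    moreover have "(1 - w c) * (1 + v) = 1 + v - w c - w c * v" by (simp add: algebra_simps)
    ultimately have "(1 - w c) * (1 + v) = 0" using wv by simp
    thus False using w1 v by simp
  qed
  show "x\<^sup>2 + w c + t ^ (2 * g - len c) = 1" using T \<open>eps = - 1\<close> odd by (simp add: v_def)
qed

lemma two_short_low:
  assumes S: "{c. short c} = {c, e}" and ce: "c \<noteq> e"
  shows "{K. K \<in> cliques s G \<and> total K \<le> g} = {{}, {c}, {e}}"
proof (intro subset_antisym subsetI)
  have sh: "short c" "short e" using S by auto
  fix K assume "K \<in> {K. K \<in> cliques s G \<and> total K \<le> g}"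
  hence K: "K \<in> cliques s G" "total K \<le> g" by auto
  have "K \<noteq> {c, e}"
  proof
    assume "K = {c, e}"
    hence "x \<le> w c * w e"
      using K(2) ce power_le_of_ge[of "len c + len e" g] by (simp add: total_def w_def x_def power_add)
    thus False using product_lt[OF sh ce] by simp
  qed
  moreover have "K \<subseteq> {c, e}" using subset_short[OF K] S by blast
  ultimately show "K \<in> {{}, {c}, {e}}" by blast
next
  have sh: "short c" "short e" using S by auto
  fix K assume "K \<in> {{}, {c}, {e}}"
  thus "K \<in> {K. K \<in> cliques s G \<and> total K \<le> g}" using sh singleton_clique by auto
qed

lemma two_short_eq:
  assumes S: "{c. short c} = {c, e}" and ce: "c \<noteq> e"
  shows "1 + eps * x\<^sup>2 = tau (len c) + tau (len e)"
  using low_cliques_zero ce unfolding two_short_low[OF S ce] by (simp add: tau_0)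

lemma two_short_coef:
  assumes S: "{c. short c} = {c, e}" and ce: "c \<noteq> e" and k: "len c \<le> g"
  shows "coef (len c) < 0"
proof -
  have sh: "short c" "short e" using S by auto
  have "{K. K \<in> cliques s G \<and> total K = len c} = {K \<in> {{}, {c}, {e}}. total K = len c}"
    unfolding two_short_low[OF S ce, symmetric] using k by auto
  also have "\<dots> = (if len e = len c then {{c}, {e}} else {{c}})"
    using len_pos[of c] sh by auto
  finally show ?thesis using ce by (simp add: coef_def)
qed

lemma two_short_less_middle:
  assumes S: "{c. short c} = {c, e}" and ce: "c \<noteq> e" and e: "eps = - 1"
  shows "len c < g"
  using two_short_coef[OF S ce] coef_middle[OF e] S by (metis insertI1 le_neq_implies_less mem_Collect_eq less_irrefl)

text \<open>The shorter of two complementary cycles must be \<open>c\<close> or \<open>e\<close>;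
  call the other short cycle \<open>f\<close>. It lies inside the long complement \<open>b\<close>,
  and a cycle crossing \<open>a\<close> and \<open>b\<close> meets it, so the four cycles satisfy
  \<open>w_two_disjoint\<close>.\<close>

lemma complementary_short:
  assumes S: "{c. short c} = {c, e}" and ce: "c \<noteq> e" "disjnt (s c) (s e)" and "eps = 1" "len c < g"
  shows "x\<^sup>2 \<le> w c * (1 - w c) * (1 - w e) \<or> x\<^sup>2 \<le> w e * (1 - w e) * (1 - w c)"
proof -
  obtain a b where ab: "a \<in> G" "b \<in> G" "disjnt (s a) (s b)" "s a \<union> s b = {..<2 * g}"
    "len a + len b = 2 * g" "len a \<le> g"
  proof -
    obtain a b where ab: "a \<in> G" "b \<in> G" "disjnt (s a) (s b)" "s a \<union> s b = {..<2 * g}"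
      "len a + len b = 2 * g"
      using complementary_cycles[OF assms(4)] .
    show ?thesis
    proof (cases "len a \<le> g")
      case True
      thus ?thesis using that[of a b] ab by blast
    next
      case False
      thus ?thesis using that[of b a] ab disjnt_comm by (simp add: Un_commute)
    qed
  qed
  have a: "a = c \<or> a = e" using ab S by blast
  have sh: "short c" "short e" using S by auto
  obtain f where f: "{a, f} = {c, e}" "a \<noteq> f" using a ce by auto
  have fG: "short f" using f sh by auto
  have af: "disjnt (s a) (s f)" using f ce disjnt_comm by (metis doubleton_eq_iff)
  have b_long: "g < len b"
  proof (rule ccontr)
    assume "\<not> ?thesis"
    hence "short b" "len a = g" "len b = g" using ab by auto
    moreover have "a \<noteq> b" using disjnt_neq ab by blast
    ultimately show False using S a assms(5) by (metis insertE mem_Collect_eq less_irrefl singletonD)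
  qed
  obtain d where d: "d \<in> G" "\<not> disjnt (s a) (s d)" "\<not> disjnt (s b) (s d)"
    using complementary_crossing[OF ab(1-4)] .
  note ctx = ab(1-5) d
  have "s f \<subseteq> s b" using supp[of f] fG ab(4) af by (auto simp: disjnt_def)
  hence fb: "\<not> disjnt (s f) (s b)" using supp[of f] fG by (auto simp: disjnt_def)
  have "w d \<le> (1 - w a) * (1 - w f - w b)"
    by (rule w_two_disjoint)
      (use ab fG af fb d b_long f complementary_distinct[OF ctx] crossing_long[OF ctx]
        crossing_meets_short[OF ctx fG] in auto)
  hence "x\<^sup>2 \<le> (1 - w a) * (1 - w f - w b)" using w_ge_sq[OF d(1)] by linarith
  \<comment> \<open>Expanding the product yields a term \<open>w a * w b\<close>, which equals and
    cancels \<open>x\<^sup>2\<close>.\<close>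
  hence "w b \<le> (1 - w a) * (1 - w f)"
    using complementary_w[OF ctx] by (simp add: algebra_simps)
  hence "w a * w b \<le> w a * ((1 - w a) * (1 - w f))" using w_pos[of a] by (intro mult_left_mono) auto
  hence "x\<^sup>2 \<le> w a * (1 - w a) * (1 - w f)" using complementary_w[OF ctx] by simp
  thus ?thesis using f by (auto simp: doubleton_eq_iff)
qed

text \<open>A negative sign makes the coefficient symmetric to that of \<open>c\<close> positive, and only a pair of
  disjoint cycles can contribute positively to it.\<close>
lemma negative_sign_pair:
  assumes S: "{c. short c} = {c, e}" and ce: "c \<noteq> e" and sgn: "eps * (- 1) ^ len c = - 1"
  obtains "disjnt (s c) (s e)" "len c + len e = 2 * g - len c"
  | p where "p \<in> G" "g < len p" "disjnt (s e) (s p)" "len e + len p = 2 * g - len c"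
  | p where "p \<in> G" "g < len p" "disjnt (s c) (s p)" "len c + len p = 2 * g - len c"
proof -
  have sh: "short c" "short e" using S by auto
  have mem: "a \<in> {c, e}" if "a \<in> G" "len a \<le> g" for a
    using that unfolding S[symmetric] by simp
  have "0 < coef (2 * g - len c)"
    using two_short_coef[OF S ce] sh sgn by (simp add: coef_sym)
  then obtain K where K: "K \<in> cliques s G" "total K = 2 * g - len c" "even (card K)"
    using coef_pos_obtain by blast
  have "K \<noteq> {}" using K(2) sh g_pos by auto
  hence "card K \<noteq> 0" using finite_clique[OF K(1)] by simp
  \<comment> \<open>Two disjoint long cycles do not fit into \<open>2 * g\<close> vertices, so
    \<open>K\<close> has at most one member besides \<open>c\<close> and \<open>e\<close>; parity
    then reduces its size to two.\<close>
  moreover have "card K \<le> 3"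
  proof -
    have "card {p \<in> K. g < len p} \<le> 1"
    proof (rule ccontr)
      assume "\<not> ?thesis"
      then obtain T where T: "T \<subseteq> {p \<in> K. g < len p}" "card T = 2"
        using obtain_subset_with_card_n[of 2 "{p \<in> K. g < len p}"] by auto
      then obtain p q where "T = {p, q}" "p \<noteq> q" by (auto simp: card_2_iff)
      with T(1) have pq: "p \<in> K" "q \<in> K" "p \<noteq> q" "g < len p" "g < len q" by auto
      have "len p + len q \<le> 2 * g"
        by (rule len_disjoint) (use cliqueD[OF K(1)] pq in auto)
      thus False using pq by linarith
    qed
    moreover have "card {c, e} = 2" using ce by simp
    moreover have "K \<subseteq> {c, e} \<union> {p \<in> K. g < len p}"
    proof
      fix p assume p: "p \<in> K"
      show "p \<in> {c, e} \<union> {p \<in> K. g < len p}"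
        using mem[OF cliqueD(1)[OF K(1) p]] p by (cases "len p \<le> g") simp_all
    qed
    hence "card K \<le> card ({c, e} \<union> {p \<in> K. g < len p})"
      using finite_clique[OF K(1)] by (intro card_mono) auto
    ultimately show ?thesis using card_Un_le[of "{c, e}" "{p \<in> K. g < len p}"] by linarith
  qed
  moreover have "card K \<noteq> 1" "card K \<noteq> 3" using K(3) by auto
  ultimately have "card K = 2" by linarith
  then obtain p q where pq: "K = {p, q}" "p \<noteq> q" by (auto simp: card_2_iff)
  have G: "p \<in> G" "q \<in> G" and disj: "disjnt (s p) (s q)" and tot: "len p + len q = 2 * g - len c"
    using cliqueD[OF K(1)] pq K(2) by (auto simp: total_def)
  have "p \<in> {c, e} \<or> g < len p" "q \<in> {c, e} \<or> g < len q"
    using mem G leI by blast+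
  moreover have "\<not> (g < len p \<and> g < len q)" using len_disjoint[OF G disj] by linarith
  ultimately show ?thesis
    using that pq(2) G disj disjnt_comm[OF disj] tot by (elim disjE insertE) (auto simp: add.commute)
qed

text \<open>Each alternative of \<open>negative_sign_pair\<close> is an equation between lengths,
  hence between weights: \<open>u\<^sup>2 * v\<close>, \<open>w p * (u * v)\<close> or
  \<open>w p * u\<^sup>2\<close> equals \<open>x\<^sup>2\<close>. The second is a product of two
  factors below \<open>x\<close>. In the others, \<open>eps = 1\<close> supplies the inequality from
  complementary cycles, and \<open>eps = - 1\<close> a second polynomial identity or a cycle through
  all vertices; in the third, meeting cycles conflict directly.\<close>

lemma negative_sign_False:
  assumes S: "{c. short c} = {c, e}" and ce: "c \<noteq> e" and sgn: "eps * (- 1) ^ len c = - 1"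
    and less: "len c < g"
  shows False
proof -
  have sh: "short c" "short e" using S by auto
  define u v where "u = w c" and "v = w e"
  have u: "x \<le> u" "u < 1" "0 < u" and v: "x \<le> v" "v < 1" "0 < v"
    using sh w_short w_less_1 w_pos by (auto simp: u_def v_def)
  have uv: "u * v < x" using product_lt[OF sh ce] by (simp add: u_def v_def)
  have S': "{c. short c} = {e, c}" using S by auto
  have meet: "u + v \<le> 1" if "\<not> disjnt (s c) (s e)"
    using w_meeting2[of c e] sh ce that by (simp add: u_def v_def)
  have comp: "x\<^sup>2 \<le> u * (1 - u) * (1 - v) \<or> x\<^sup>2 \<le> v * (1 - v) * (1 - u)"
    if "disjnt (s c) (s e)" "eps = 1"
    using complementary_short[OF S ce that less] by (simp add: u_def v_def)
  from S ce sgn show False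
  proof (cases rule: negative_sign_pair)
    case 1
    have sum: "2 * len c + len e = 2 * g" using 1 sh by linarith
    hence "t ^ (2 * len c + len e) = x\<^sup>2" by (simp only: x_sq)
    hence exact: "x\<^sup>2 = u\<^sup>2 * v"
      by (simp add: u_def v_def w_def power_add power_mult[symmetric] mult.commute)
    show False
    proof (cases "eps = 1")
      case True
      thus False using comp[OF 1(1)] complementary_exact_False[of u v]
          complementary_exact_other_False[of v u] u v exact by blast
    next
      case False
      hence eps: "eps = - 1" using eps by simp
      have less': "len e < g" by (rule two_short_less_middle[OF S' _ eps]) (use ce in auto)
      have "2 * g - len c = len c + len e" "2 * g - len e = 2 * len c"
        using 1 sh by linarith+
      moreover have "even (2 * len c + len e)" using sum by simp
      hence "eps * (- 1) ^ len e = - 1" using eps by simp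
      ultimately have "tau (len c) = u - u * v" "tau (len e) = v - u\<^sup>2"
        using less less' sgn
        by (simp_all add: tau_def u_def v_def w_def power_add power_mult[symmetric] mult.commute)
      \<comment> \<open>With \<open>x\<^sup>2 = u\<^sup>2 * v\<close> the folded identity becomes a
        polynomial in \<open>u\<close> and \<open>v\<close> that factors.\<close>
      hence "(1 - v) * (1 - u + u\<^sup>2) = 0"
        using two_short_eq[OF S ce] eps exact by (simp add: algebra_simps)
      moreover have "0 \<le> u\<^sup>2" by simp
      hence "0 < 1 - u + u\<^sup>2" using u by linarith
      ultimately show False using v by simp
    qed
  next
    case (2 p)
    have "len p + (len c + len e) = 2 * g" using 2 sh by linarith
    hence "t ^ (len p + (len c + len e)) = x\<^sup>2" by (simp only: x_sq)
    hence "w p * (u * v) = x\<^sup>2" by (simp add: u_def v_def w_def power_add)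
    moreover have "w p * (u * v) < x * x"
      using w_long[OF 2(2)] w_pos[of p] uv u v by (intro mult_strict_mono) auto
    ultimately show False by (simp add: power2_eq_square)
  next
    case (3 p)
    have "len p + 2 * len c = 2 * g" using 3 sh by linarith
    hence "t ^ (len p + 2 * len c) = x\<^sup>2" by (simp only: x_sq)
    hence pu: "w p * u\<^sup>2 = x\<^sup>2" by (simp add: u_def w_def power_add power_mult[symmetric] mult.commute)
    have p: "0 < w p" "w p < x" using w_long[OF 3(2)] w_pos by auto
    have sq: "x < u\<^sup>2" by (rule sq_gt_of_long[OF p pu])
    show False
    proof (cases "disjnt (s c) (s e)")
      case False
      show False by (rule meeting_sq_False[OF sq u(3) v(1) meet[OF False]])
    next
      case True
      show False
      proof (cases "eps = 1")
        case eps: True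
        show False using comp[OF True eps] complementary_sq_False[of u v]
            complementary_sq_other_False[of v u] u v sq by blast
      next
        case False
        then obtain z where z: "z \<in> G" "s z = {..<2 * g}" using full_cycle eps by metis
        have meets: "\<not> disjnt (s a) (s z)" if "a \<in> G" for a
          using supp[OF that] z(2) by (auto simp: disjnt_def)
        have zlen: "len z = 2 * g" by (simp add: len_def z(2))
        have zne: "c \<noteq> z" "e \<noteq> z" using sh zlen g_pos by auto
        have pz: "p \<noteq> z" using 3(3) meets[of c] sh by auto
        have ep: "e \<noteq> p" using sh 3(2) by auto
        show False
        proof (cases "disjnt (s e) (s p)")
          case dis: True
          show False using no_three_disjoint_met[of c e p z] sh 3 z zne pz True dis meets by blast
        next
          case nd: False
          have "w z \<le> (1 - w c) * (1 - w e - w p)"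
            by (rule w_two_disjoint) (use sh 3 z zne pz ep True nd meets in auto)
          hence "x\<^sup>2 \<le> (1 - u) * (1 - v - w p)"
            using w_ge_sq[OF z(1)] by (simp add: u_def v_def)
          thus False using disjoint_long_False[OF p pu v(1) u(3,2)] by blast
        qed
      qed
    qed
  qed
qed

lemma tau_ge:
  assumes "c \<in> G" "len c < g" "eps * (- 1) ^ len c \<noteq> - 1"
  shows "2 * x \<le> tau (len c)"
proof -
  define v where "v = t ^ (2 * g - len c)"
  have wv: "w c * v = x\<^sup>2" using assms by (simp add: w_def v_def power_add[symmetric] x_sq)
  have v: "0 < v" using t01 by (simp add: v_def)
  have "eps * (- 1) ^ len c = 1" using assms eps by (cases "even (len c)") auto
  hence "tau (len c) = w c + v" using assms by (simp add: tau_def w_def v_def)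
  moreover have "2 * x \<le> w c + v"
    by (rule twice_le_sum_of_mult_eq[OF wv]) (use w_pos[of c] v in auto)
  ultimately show ?thesis by simp
qed

text \<open>With the negative sign excluded, each \<open>tau\<close> is at least
  \<open>2 * x\<close>, or equal to \<open>x\<close> at length \<open>g\<close>. Unless both lengths
  are \<open>g\<close>, the sum is at least \<open>3 * x\<close>, which exceeds
  \<open>1 + x\<^sup>2\<close>; two cycles of length \<open>g\<close> give
  \<open>(1 - x)\<^sup>2 = 0\<close>.\<close>

lemma not_two_short:
  assumes S: "{c. short c} = {c, e}" and ce: "c \<noteq> e"
  shows False
proof -
  have S': "{c. short c} = {e, c}" "e \<noteq> c" using S ce by auto
  have sh: "short c" "short e" using S by auto
  have ge: "2 * x \<le> tau (len a)" if "{c. short c} = {a, b}" "a \<noteq> b" "len a < g" for a b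
    using negative_sign_False[OF that(1,2) _ that(3)] tau_ge[of a] that by blast
  have eqg: "tau (len a) = x" if "len a = g" for a using that by (simp add: tau_def x_def)
  have tau_x: "x \<le> tau (len c)" "x \<le> tau (len e)"
    using ge[OF S ce] ge[OF S'] eqg[of c] eqg[of e] sh x01 by (cases "len c = g"; cases "len e = g"; force)+
  have "eps * x\<^sup>2 \<le> x\<^sup>2" using eps by auto
  hence lt: "1 + eps * x\<^sup>2 < 3 * x" using golden by linarith
  consider "len c = g" "len e = g" | "len c < g" | "len e < g" using sh by linarith
  thus False
  proof cases
    case 1
    hence "eps = 1" using two_short_less_middle[OF S ce] eps by auto
    hence "(1 - x)\<^sup>2 = 0" using two_short_eq[OF S ce] eqg[OF 1(1)] eqg[OF 1(2)]
      by (simp add: power2_eq_square algebra_simps)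
    thus False using x01 by simp
  next
    case 2
    have "1 + eps * x\<^sup>2 \<ge> 3 * x" using two_short_eq[OF S ce] ge[OF S ce 2] tau_x by linarith
    thus False using lt by simp
  next
    case 3
    have "1 + eps * x\<^sup>2 \<ge> 3 * x" using two_short_eq[OF S ce] ge[OF S' 3] tau_x by linarith
    thus False using lt by simp
  qed
qed

theorem unique_short:
  obtains c where "odd (len c)" "len c < g" "x\<^sup>2 + t ^ len c + t ^ (2 * g - len c) = 1"
proof -
  obtain c where c: "short c" using exists_short by blast
  show ?thesis
  proof (cases "{c. short c} = {c}")
    case True
    from single_short[OF this] show ?thesis using that[of c] by (simp add: w_def)
  next
    case False
    then obtain e where e: "short e" "c \<noteq> e" using c by blast
    have "{c. short c} = {c, e}"
    proof (intro subset_antisym subsetI)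
      fix a assume "a \<in> {c. short c}"
      thus "a \<in> {c, e}" using no_three_short[of a c e] c e by blast
    qed (use c e in auto)
    thus ?thesis using not_two_short e by blast
  qed
qed

end

section \<open>Determinants as clique sums\<close>

lemma cycle_of_list_nth:
  assumes "distinct cs" "i < length cs"
  shows "cycle_of_list cs (cs ! i) = cs ! (Suc i mod length cs)"
proof -
  have "map (cycle_of_list cs) cs = rotate1 cs" using cyclic_rotation[OF assms(1), of 1] by simp
  hence "map (cycle_of_list cs) cs ! i = rotate1 cs ! i" by simp
  thus ?thesis using assms by (simp add: nth_rotate1)
qed

lemma sign_cycle_of_list:
  assumes "distinct cs"
  shows "sign (cycle_of_list cs) = (- 1) ^ (length cs - 1)"
  using assms
proof (induction cs rule: cycle_of_list.induct)
  case (1 i j cs)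
  have "sign (cycle_of_list (i # j # cs)) = sign (transpose i j) * sign (cycle_of_list (j # cs))"
    by (simp add: sign_compose permutation_swap_id permutation_of_cycle)
  thus ?case using 1 by (simp add: sign_swap_id del: cycle_of_list.simps)
qed (simp_all add: sign_id)

definition cycles_from :: "'a \<Rightarrow> 'a set \<Rightarrow> 'a list set" where
  "cycles_from v U = {cs. cs \<noteq> [] \<and> distinct cs \<and> hd cs = v \<and> set cs \<subseteq> U}"

lemma finite_cycles_from: "finite U \<Longrightarrow> finite (cycles_from v U)"
  by (rule finite_subset[OF _ finite_subset_distinct]) (auto simp: cycles_from_def)

lemma funpow_cycle_of_list_compose:
  assumes cs: "cs \<in> cycles_from v U" and q: "q permutes U - set cs"
  shows "((cycle_of_list cs \<circ> q) ^^ i) v = cs ! (i mod length cs)"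
proof (induction i)
  case 0
  thus ?case using cs hd_conv_nth[of cs] by (auto simp: cycles_from_def)
next
  case (Suc i)
  have len: "i mod length cs < length cs" using cs by (simp add: cycles_from_def)
  have "q (cs ! (i mod length cs)) = cs ! (i mod length cs)"
    using q nth_mem[OF len] by (intro permutes_not_in) auto
  thus ?case using Suc cycle_of_list_nth[OF _ len] cs by (simp add: cycles_from_def mod_Suc_eq)
qed

lemma support_cycle_of_list_compose:
  assumes cs: "cs \<in> cycles_from v U" and q: "q permutes U - set cs"
  shows "support (cycle_of_list cs \<circ> q) v = cs"
proof -
  let ?p = "cycle_of_list cs \<circ> q"
  have pos: "0 < length cs" "distinct cs" using cs by (auto simp: cycles_from_def)
  have v: "v = cs ! 0" using cs hd_conv_nth[of cs] by (auto simp: cycles_from_def)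
  note pow = funpow_cycle_of_list_compose[OF cs q]
  have "least_power ?p v = length cs"
    unfolding least_power_def
  proof (rule Least_equality)
    show "(?p ^^ length cs) v = v \<and> 0 < length cs" using pos v pow[of "length cs"] by simp
    fix i assume i: "(?p ^^ i) v = v \<and> 0 < i"
    show "length cs \<le> i"
    proof (rule ccontr)
      assume "\<not> ?thesis"
      hence "cs ! i = cs ! 0" "i < length cs" using i v pow[of i] by simp_all
      thus False using i pos by (simp add: nth_eq_iff_index_eq)
    qed
  qed
  thus ?thesis by (intro nth_equalityI) (simp_all add: pow)
qed

text \<open>A permutation is determined by its cycle through \<open>v\<close> and its restriction to
  the remaining points. This splits a Leibniz sum the way clique sums split at a vertex.\<close>

lemma sum_permutes_cycles_from:
  fixes f :: "('a \<Rightarrow> 'a) \<Rightarrow> 'b :: comm_monoid_add"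
  assumes U: "finite U" and v: "v \<in> U"
  shows "(\<Sum>p | p permutes U. f p)
    = (\<Sum>cs\<in>cycles_from v U. \<Sum>q | q permutes U - set cs. f (cycle_of_list cs \<circ> q))"
proof -
  let ?S = "SIGMA cs:cycles_from v U. {q. q permutes U - set cs}"
  \<comment> \<open>The restriction of \<open>p\<close> off the orbit of \<open>v\<close>, extended
    by the identity.\<close>
  let ?r = "\<lambda>p y. if y \<in> U - set (support p v) then p y else y"
  have perm: "permutation p" if "p permutes U" for p using that U permutation_permutes by blast
  have "(\<Sum>p | p permutes U. f p) = (\<Sum>(cs, q)\<in>?S. f (cycle_of_list cs \<circ> q))"
  proof (rule sum.reindex_bij_witness[of _ "\<lambda>(cs, q). cycle_of_list cs \<circ> q" "\<lambda>p. (support p v, ?r p)"])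
    fix p assume "p \<in> {p. p permutes U}"
    hence p: "p permutes U" by simp
    let ?cs = "support p v"
    note perm = perm[OF p]
    have sub: "set ?cs \<subseteq> U"
      using permutes_in_image[OF permutes_funpow[OF p]] v by auto
    have "hd ?cs = v" using least_power_of_permutation(2)[OF perm, of v] by (simp add: hd_map)
    moreover have "?cs \<noteq> []" using least_power_of_permutation(2)[OF perm, of v] by simp
    ultimately have "?cs \<in> cycles_from v U"
      using sub cycle_of_permutation[OF perm] unfolding cycles_from_def by blast
    thus "(?cs, ?r p) \<in> ?S" using semidecomposition[OF p U] by simp
    have "cycle_of_list ?cs (?r p y) = p y" for y
    proof -
      consider "y \<in> set ?cs" | "y \<in> U - set ?cs" | "y \<notin> U" using sub by blast
      thus ?thesis
      proof cases
        case 1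
        thus ?thesis using cycle_restrict[OF perm 1] by simp
      next
        case 2
        hence "?r p y \<in> U - set ?cs"
          using permutes_in_image[OF semidecomposition[OF p U, of v], of y] by simp
        hence "cycle_of_list ?cs (?r p y) = ?r p y" by (intro id_outside_supp) blast
        thus ?thesis using 2 by simp
      next
        case 3
        hence "y \<notin> set ?cs" using sub by blast
        hence "cycle_of_list ?cs y = y" by (rule id_outside_supp)
        thus ?thesis using 3 permutes_not_in[OF p 3] by simp
      qed
    qed
    thus eq: "(case (?cs, ?r p) of (cs, q) \<Rightarrow> cycle_of_list cs \<circ> q) = p" by (simp add: fun_eq_iff)
    thus "(case (?cs, ?r p) of (cs, q) \<Rightarrow> f (cycle_of_list cs \<circ> q)) = f p" by simp
  next
    fix b assume "b \<in> ?S"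
    then obtain cs q where b: "b = (cs, q)" "cs \<in> cycles_from v U" "q permutes U - set cs" by auto
    have sub: "set cs \<subseteq> U" using b by (simp add: cycles_from_def)
    have "cycle_of_list cs permutes U" "q permutes U"
      using permutes_subset[OF cycle_permutes sub] permutes_subset[OF b(3)] by auto
    thus "(case b of (cs, q) \<Rightarrow> cycle_of_list cs \<circ> q) \<in> {p. p permutes U}"
      using permutes_compose b(1) by auto
    have supp: "support (cycle_of_list cs \<circ> q) v = cs"
      by (rule support_cycle_of_list_compose[OF b(2,3)])
    have "?r (cycle_of_list cs \<circ> q) y = q y" for y
    proof (cases "y \<in> U - set cs")
      case True
      hence "q y \<notin> set cs" using permutes_in_image[OF b(3), of y] by blast
      thus ?thesis using True by (simp only: supp) (simp add: id_outside_supp)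
    next
      case False
      thus ?thesis using permutes_not_in[OF b(3)] by (simp only: supp) auto
    qed
    thus "(support (case b of (cs, q) \<Rightarrow> cycle_of_list cs \<circ> q) v,
        ?r (case b of (cs, q) \<Rightarrow> cycle_of_list cs \<circ> q)) = b"
      using supp by (simp only: b(1) prod.case prod.inject fun_eq_iff simp_thms)
  qed
  also have "\<dots> = (\<Sum>cs\<in>cycles_from v U. \<Sum>q | q permutes U - set cs. f (cycle_of_list cs \<circ> q))"
    by (subst sum.Sigma) (use U in \<open>auto simp: finite_cycles_from finite_permutations\<close>)
  finally show ?thesis .
qed

definition cycle_weight :: "('a \<Rightarrow> 'a \<Rightarrow> int) \<Rightarrow> 'a list \<Rightarrow> int" where
  "cycle_weight a cs = (\<Prod>i\<in>set cs. a i (cycle_of_list cs i))"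

text \<open>The principal minor of \<open>1 - t * A\<close> with index set \<open>U\<close>, as a
  Leibniz sum so that arbitrary sets of vertices can be deleted in an induction.\<close>

definition minor :: "(nat \<Rightarrow> nat \<Rightarrow> int) \<Rightarrow> 'a::comm_ring_1 \<Rightarrow> nat set \<Rightarrow> 'a" where
  "minor a t U = (\<Sum>p | p permutes U. of_int (sign p) *
     (\<Prod>i\<in>U. (if i = p i then 1 else 0) - t * of_int (a i (p i))))"

text \<open>The sign of a cycle of length \<open>m\<close> times \<open>(- t) ^ m\<close> is
  \<open>- (t ^ m)\<close>. Only the trivial cycle \<open>[v]\<close> also picks up the entry 1 of
  the identity matrix, which produces the minor without \<open>v\<close>.\<close>

lemma minor_rec:
  assumes U: "finite U" and v: "v \<in> U"
  shows "minor a t U = minor a t (U - {v})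
    - (\<Sum>cs\<in>cycles_from v U. t ^ length cs * of_int (cycle_weight a cs) * minor a t (U - set cs))"
proof -
  let ?M = "\<lambda>i j. (if i = j then 1 else 0) - t * of_int (a i j)"
  define kap where "kap cs = of_int (sign (cycle_of_list cs)) *
    (\<Prod>i\<in>set cs. ?M i (cycle_of_list cs i))" for cs
  have "minor a t U = (\<Sum>cs\<in>cycles_from v U. kap cs * minor a t (U - set cs))"
    unfolding minor_def sum_permutes_cycles_from[OF U v] sum_distrib_left
  proof (intro sum.cong refl)
    fix cs q assume cs: "cs \<in> cycles_from v U" and "q \<in> {q. q permutes U - set cs}"
    hence q: "q permutes U - set cs" by simp
    have perm: "permutation q" using q U permutation_permutes by blast
    have sub: "set cs \<subseteq> U" using cs by (simp add: cycles_from_def)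
    let ?p = "cycle_of_list cs \<circ> q"
    have "(\<Prod>i\<in>U. ?M i (?p i)) = (\<Prod>i\<in>U - set cs. ?M i (?p i)) * (\<Prod>i\<in>set cs. ?M i (?p i))"
      by (rule prod.subset_diff[OF sub U])
    also have "(\<Prod>i\<in>set cs. ?M i (?p i)) = (\<Prod>i\<in>set cs. ?M i (cycle_of_list cs i))"
      by (intro prod.cong refl) (simp add: permutes_not_in[OF q])
    also have "(\<Prod>i\<in>U - set cs. ?M i (?p i)) = (\<Prod>i\<in>U - set cs. ?M i (q i))"
    proof (intro prod.cong refl)
      fix i assume "i \<in> U - set cs"
      hence "q i \<notin> set cs" using permutes_in_image[OF q, of i] by blast
      thus "?M i (?p i) = ?M i (q i)" by (simp add: id_outside_supp)
    qed
    finally show "of_int (sign ?p) * (\<Prod>i\<in>U. ?M i (?p i))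
        = kap cs * (of_int (sign q) * (\<Prod>i\<in>U - set cs. ?M i (q i)))"
      by (simp add: kap_def sign_compose[OF permutation_of_cycle perm])
  qed
  also have "\<dots> = (\<Sum>cs\<in>cycles_from v U. (if cs = [v] then minor a t (U - set cs) else 0)
      - t ^ length cs * of_int (cycle_weight a cs) * minor a t (U - set cs))"
  proof (intro sum.cong refl)
    fix cs assume cs: "cs \<in> cycles_from v U"
    have "kap cs = (if cs = [v] then 1 else 0) - t ^ length cs * of_int (cycle_weight a cs)"
    proof (cases "length cs = 1")
      case True
      then obtain y where "cs = [y]" by (auto simp: length_Suc_conv)
      hence "cs = [v]" using cs by (simp add: cycles_from_def)
      thus ?thesis by (simp add: kap_def cycle_weight_def sign_id)
    next
      case False
      have len: "2 \<le> length cs" "distinct cs"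
        using False cs by (cases cs; auto simp: cycles_from_def Suc_le_eq)+
      have "i \<noteq> cycle_of_list cs i" if i: "i \<in> set cs" for i
      proof -
        obtain k where k: "k < length cs" "i = cs ! k" using i by (auto simp: in_set_conv_nth)
        have "Suc k mod length cs < length cs" by (intro mod_less_divisor) (use len in linarith)
        moreover have "k \<noteq> Suc k mod length cs" using k len
          by (cases "Suc k = length cs") auto
        ultimately show ?thesis using k cycle_of_list_nth[OF len(2) k(1)] len(2)
          by (simp add: nth_eq_iff_index_eq)
      qed
      hence "(\<Prod>i\<in>set cs. ?M i (cycle_of_list cs i))
          = (\<Prod>i\<in>set cs. - t * of_int (a i (cycle_of_list cs i)))"
        by (intro prod.cong refl) simp
      also have "\<dots> = (- t) ^ length cs * of_int (cycle_weight a cs)"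
        using len by (simp only: prod.distrib cycle_weight_def of_int_prod) (simp add: distinct_card)
      finally have "kap cs = (- 1) ^ (length cs - 1) * ((- t) ^ length cs * of_int (cycle_weight a cs))"
        by (simp add: kap_def sign_cycle_of_list[OF len(2)])
      moreover obtain m where m: "length cs = Suc m" using len by (cases "length cs") auto
      moreover have "(- 1) ^ m * ((- t) ^ Suc m * y) = ((- 1) ^ m * (- 1) ^ m) * - (t ^ Suc m * y)" for y
        by (subst power_minus) (simp only: power_Suc mult_minus_left mult_minus_right mult_1 mult_ac)
      ultimately have "kap cs = - (t ^ length cs * of_int (cycle_weight a cs))"
        by (simp only: diff_Suc_1 minus_one_mult_self mult_1)
      moreover have "cs \<noteq> [v]" using len by auto
      ultimately show ?thesis by simp
    qed
    thus "kap cs * minor a t (U - set cs) = (if cs = [v] then minor a t (U - set cs) else 0)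
      - t ^ length cs * of_int (cycle_weight a cs) * minor a t (U - set cs)"
      by (simp add: left_diff_distrib)
  qed
  also have "\<dots> = (\<Sum>cs\<in>cycles_from v U. if cs = [v] then minor a t (U - set cs) else 0)
      - (\<Sum>cs\<in>cycles_from v U. t ^ length cs * of_int (cycle_weight a cs) * minor a t (U - set cs))"
    by (rule sum_subtractf)
  also have "(\<Sum>cs\<in>cycles_from v U. if cs = [v] then minor a t (U - set cs) else 0) = minor a t (U - {v})"
    using v by (subst sum.delta[OF finite_cycles_from[OF U]]) (auto simp: cycles_from_def)
  finally show ?thesis .
qed

text \<open>A cycle of a graph on the natural numbers is the list of its vertices, starting with the
  smallest one. The second component enumerates parallel copies, so that the weight becomes
  the number of cycles.\<close>
definition labelled_cycles :: "(nat \<Rightarrow> nat \<Rightarrow> int) \<Rightarrow> nat set \<Rightarrow> (nat list \<times> nat) set" where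
  "labelled_cycles a U = {(cs, l). cs \<noteq> [] \<and> distinct cs \<and> hd cs = Min (set cs) \<and> set cs \<subseteq> U \<and>
     l < nat (cycle_weight a cs)}"

abbreviation vertices :: "nat list \<times> nat \<Rightarrow> nat set" where "vertices c \<equiv> set (fst c)"

lemma finite_labelled_cycles:
  assumes "finite U"
  shows "finite (labelled_cycles a U)"
proof (rule finite_subset)
  show "labelled_cycles a U \<subseteq> (SIGMA cs:{cs. set cs \<subseteq> U \<and> distinct cs}. {..<nat (cycle_weight a cs)})"
    by (auto simp: labelled_cycles_def)
qed (use finite_subset_distinct[OF assms] in auto)

text \<open>Both sides obey the same recursion at \<open>v = Min U\<close>. With this choice the
  cycles through \<open>v\<close> are exactly the normalised lists starting at \<open>v\<close>, and
  they meet pairwise.\<close>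

lemma minor_eq_clique_sum:
  assumes "finite U" and a: "\<And>i j. i \<in> U \<Longrightarrow> j \<in> U \<Longrightarrow> 0 \<le> a i j"
  shows "minor a t U = clique_sum vertices (labelled_cycles a U) t"
  using assms
proof (induction U rule: finite_psubset_induct)
  case (psubset U)
  show ?case
  proof (cases "U = {}")
    case True
    have "labelled_cycles a {} = {}" by (auto simp: labelled_cycles_def)
    thus ?thesis using True by (simp add: minor_def sign_id)
  next
    case False
    define v where "v = Min U"
    have v: "v \<in> U" using False psubset.hyps by (simp add: v_def)
    have minor: "minor a t W = clique_sum vertices (labelled_cycles a W) t" if "W \<subset> U" for W
      using psubset.IH[OF that] psubset.prems that by blast
    define H where "H = (SIGMA cs:cycles_from v U. {..<nat (cycle_weight a cs)})"
    have Min_v: "Min (set cs) = v" if "cs \<in> cycles_from v U" for cs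
    proof (rule Min_eqI)
      show "v \<in> set cs" using that by (auto simp: cycles_from_def)
      show "v \<le> y" if "y \<in> set cs" for y
        using \<open>cs \<in> cycles_from v U\<close> that psubset.hyps by (auto simp: cycles_from_def v_def)
    qed simp
    have split: "labelled_cycles a U = labelled_cycles a (U - {v}) \<union> H"
    proof (intro subset_antisym subsetI)
      fix c assume c: "c \<in> labelled_cycles a U"
      obtain cs l where cl: "c = (cs, l)" by (cases c)
      show "c \<in> labelled_cycles a (U - {v}) \<union> H"
      proof (cases "v \<in> set cs")
        case True
        have "Min (set cs) = v"
        proof (rule Min_eqI)
          show "v \<le> y" if "y \<in> set cs" for y
            using c cl that psubset.hyps by (auto simp: labelled_cycles_def v_def)
        qed (use True in auto)
        thus ?thesis using c cl by (auto simp: labelled_cycles_def H_def cycles_from_def)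
      qed (use c cl in \<open>auto simp: labelled_cycles_def\<close>)
    next
      fix c assume "c \<in> labelled_cycles a (U - {v}) \<union> H"
      thus "c \<in> labelled_cycles a U"
      proof
        assume "c \<in> H"
        then obtain cs l where "c = (cs, l)" "cs \<in> cycles_from v U" "l < nat (cycle_weight a cs)"
          by (auto simp: H_def)
        thus ?thesis using Min_v by (auto simp: labelled_cycles_def cycles_from_def)
      qed (auto simp: labelled_cycles_def)
    qed
    have vH: "v \<in> vertices c" if "c \<in> H" for c
      using that by (auto simp: H_def cycles_from_def)
    have "clique_sum vertices (labelled_cycles a U) t = clique_sum vertices (labelled_cycles a (U - {v})) t
        - (\<Sum>c\<in>H. t ^ card (vertices c) *
            clique_sum vertices {d \<in> labelled_cycles a (U - {v}). disjnt (vertices c) (vertices d)} t)"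
      unfolding split
    proof (rule clique_sum_pairwise_meeting)
      show "finite H" using finite_cycles_from[OF psubset.hyps] by (simp add: H_def)
      show "labelled_cycles a (U - {v}) \<inter> H = {}" using vH by (fastforce simp: labelled_cycles_def)
      show "\<not> disjnt (vertices c) (vertices d)" if "c \<in> H" "d \<in> H" for c d
        using vH[OF that(1)] vH[OF that(2)] by (auto simp: disjnt_def)
    qed (use psubset.hyps finite_labelled_cycles in auto)
    also have "(\<Sum>c\<in>H. t ^ card (vertices c) *
            clique_sum vertices {d \<in> labelled_cycles a (U - {v}). disjnt (vertices c) (vertices d)} t)
        = (\<Sum>(cs, l)\<in>H. t ^ length cs * minor a t (U - set cs))"
    proof (intro sum.cong refl)
      fix c assume c: "c \<in> H"
      obtain cs l where cl: "c = (cs, l)" by (cases c)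
      have cs: "distinct cs" "v \<in> set cs" using c cl vH[OF c] by (auto simp: H_def cycles_from_def)
      have "{d \<in> labelled_cycles a (U - {v}). disjnt (vertices c) (vertices d)} = labelled_cycles a (U - set cs)"
        using cs(2) by (auto simp: cl labelled_cycles_def disjnt_def)
      moreover have "U - set cs \<subset> U" using cs v by blast
      ultimately show "t ^ card (vertices c) *
            clique_sum vertices {d \<in> labelled_cycles a (U - {v}). disjnt (vertices c) (vertices d)} t
          = (case c of (cs, l) \<Rightarrow> t ^ length cs * minor a t (U - set cs))"
        using cs(1) by (simp add: cl minor distinct_card)
    qed
    also have "\<dots> = (\<Sum>cs\<in>cycles_from v U. \<Sum>l<nat (cycle_weight a cs). t ^ length cs * minor a t (U - set cs))"
      unfolding H_def by (rule sum.Sigma[symmetric]) (use finite_cycles_from[OF psubset.hyps] in auto)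
    also have "\<dots> = (\<Sum>cs\<in>cycles_from v U. t ^ length cs * of_int (cycle_weight a cs) * minor a t (U - set cs))"
    proof (intro sum.cong refl)
      fix cs assume cs: "cs \<in> cycles_from v U"
      have sub: "set cs \<subseteq> U" using cs by (simp add: cycles_from_def)
      have "0 \<le> cycle_weight a cs" unfolding cycle_weight_def
      proof (rule prod_nonneg)
        fix i assume i: "i \<in> set cs"
        have "cycle_of_list cs i \<in> set cs" using permutes_in_image[OF cycle_permutes[of cs], of i] i by simp
        thus "0 \<le> a i (cycle_of_list cs i)" using psubset.prems[of i] sub i by auto
      qed
      hence "of_nat (nat (cycle_weight a cs)) = (of_int (cycle_weight a cs) :: 'a)" by simp
      thus "(\<Sum>l<nat (cycle_weight a cs). t ^ length cs * minor a t (U - set cs))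
          = t ^ length cs * of_int (cycle_weight a cs) * minor a t (U - set cs)"
        by (simp add: algebra_simps)
    qed
    also have "clique_sum vertices (labelled_cycles a (U - {v})) t = minor a t (U - {v})"
      by (rule minor[symmetric]) (use v in blast)
    finally show ?thesis by (simp only: minor_rec[OF psubset.hyps v, of a t])
  qed
qed

section \<open>Irreducibility and crossing cycles\<close>

lemma minor_eq_det:
  assumes A: "A \<in> carrier_mat n n"
  shows "minor (\<lambda>i j. A $$ (i, j)) t {..<n} = det (1\<^sub>m n - t \<cdot>\<^sub>m map_mat of_int A)"
proof -
  have B: "1\<^sub>m n - t \<cdot>\<^sub>m map_mat of_int A \<in> carrier_mat n n" using A by auto
  show ?thesis
    unfolding det_def'[OF B] minor_def atLeast0LessThan
  proof (intro sum.cong refl)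
    fix p assume "p \<in> {p. p permutes {..<n}}"
    hence "p i < n" if "i < n" for i using permutes_in_image[of p "{..<n}" i] that by simp
    hence "(\<Prod>i<n. (1\<^sub>m n - t \<cdot>\<^sub>m map_mat of_int A) $$ (i, p i))
        = (\<Prod>i<n. (if i = p i then 1 else 0) - t * of_int (A $$ (i, p i)))"
      using A by (intro prod.cong refl) simp
    thus "of_int (sign p) * (\<Prod>i<n. (if i = p i then 1 else 0) - t * of_int (A $$ (i, p i)))
        = of_int (sign p) * (\<Prod>i<n. (1\<^sub>m n - t \<cdot>\<^sub>m map_mat of_int A) $$ (i, p i))" by simp
  qed
qed

lemma char_poly_eq_minor:
  assumes A: "A \<in> carrier_mat n n" and z: "z \<noteq> 0"
  shows "poly (char_poly (map_mat complex_of_int A)) z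
    = z ^ n * minor (\<lambda>i j. A $$ (i, j)) (1 / z) {..<n}"
proof -
  let ?A = "map_mat complex_of_int A"
  have "- char_matrix ?A z = z \<cdot>\<^sub>m (1\<^sub>m n - (1 / z) \<cdot>\<^sub>m ?A)"
    using A z by (intro eq_matI) (auto simp: char_matrix_def algebra_simps)
  moreover have "?A \<in> carrier_mat n n" using A by simp
  ultimately show ?thesis
    using A by (simp add: char_poly_matrix minor_eq_det)
qed

lemma distinct_path_of_rtrancl:
  assumes "(i, j) \<in> E\<^sup>*"
  obtains xs where "xs \<noteq> []" "distinct xs" "hd xs = i" "last xs = j" "successively (\<lambda>x y. (x, y) \<in> E) xs"
proof -
  have "\<exists>xs. xs \<noteq> [] \<and> distinct xs \<and> hd xs = i \<and> last xs = j \<and> successively (\<lambda>x y. (x, y) \<in> E) xs"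
    using assms
  proof (induction rule: rtrancl_induct)
    case base
    show ?case by (rule exI[of _ "[i]"]) simp
  next
    case (step j k)
    then obtain xs where xs: "xs \<noteq> []" "distinct xs" "hd xs = i" "last xs = j"
      "successively (\<lambda>x y. (x, y) \<in> E) xs" by blast
    show ?case
    proof (cases "k \<in> set xs")
      case True
      then obtain ys zs where "xs = ys @ k # zs" by (auto dest: split_list)
      thus ?thesis using xs
        by (intro exI[of _ "ys @ [k]"]) (auto simp: successively_append_iff hd_append)
    next
      case False
      thus ?thesis using xs step.hyps
        by (intro exI[of _ "xs @ [k]"]) (auto simp: successively_append_iff)
    qed
  qed
  thus ?thesis using that by blast
qed

lemma labelled_cycle_of_list:
  assumes xs: "xs \<noteq> []" "distinct xs" "set xs \<subseteq> U"
    and pos: "\<And>x. x \<in> set xs \<Longrightarrow> 0 < a x (cycle_of_list xs x)"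
  obtains c where "c \<in> labelled_cycles a U" "vertices c = set xs"
proof -
  have "Min (set xs) \<in> set xs" using xs by simp
  then obtain k where k: "k < length xs" "xs ! k = Min (set xs)" by (auto simp: in_set_conv_nth)
  let ?ys = "rotate k xs"
  have "hd ?ys = Min (set ?ys)" using k xs by (simp add: hd_rotate_conv_nth)
  moreover have "0 < cycle_weight a ?ys"
    using pos cycle_of_list_rotate_independent[OF xs(2), of k]
    by (auto simp: cycle_weight_def intro!: prod_pos)
  ultimately have "(?ys, 0) \<in> labelled_cycles a U"
    using xs by (simp add: labelled_cycles_def)
  thus ?thesis using that[of "(?ys, 0)"] by simp
qed

lemma cycle_of_list_edge:
  assumes xs: "distinct xs" "successively P xs" "P (last xs) (hd xs)" "x \<in> set xs"
  shows "P x (cycle_of_list xs x)"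
proof -
  obtain k where k: "k < length xs" "x = xs ! k" using xs(4) by (auto simp: in_set_conv_nth)
  have ne: "xs \<noteq> []" using k by auto
  have c: "cycle_of_list xs x = xs ! (Suc k mod length xs)"
    using cycle_of_list_nth[OF xs(1) k(1)] k(2) by simp
  show ?thesis
  proof (cases "Suc k = length xs")
    case True
    hence "x = last xs" using k ne by (metis diff_Suc_1 last_conv_nth)
    thus ?thesis using c True xs(3) ne by (simp add: hd_conv_nth)
  next
    case False
    hence less: "Suc k < length xs" using k by simp
    have "xs = take (Suc k) xs @ drop (Suc k) xs" by simp
    hence "P (last (take (Suc k) xs)) (hd (drop (Suc k) xs))"
      using xs(2) less ne by (metis successively_append_iff drop_eq_Nil2 not_less take_eq_Nil nat.distinct(1))
    moreover have "last (take (Suc k) xs) = x" using k by (simp add: take_Suc_conv_app_nth)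
    ultimately show ?thesis using c less by (simp add: hd_drop_conv_nth)
  qed
qed

text \<open>The hypothesis is strong connectivity: an edge from \<open>i\<close> out of
  \<open>U\<close> to \<open>j\<close> is closed up by a simple path from \<open>j\<close> back to
  \<open>i\<close>.\<close>

lemma crossing_cycle:
  assumes closed: "\<And>W. W \<noteq> {} \<Longrightarrow> W \<subset> {..<n} \<Longrightarrow> \<exists>i\<in>W. \<exists>j\<in>{..<n} - W. 0 < a i j"
    and U: "U \<noteq> {}" "U \<subset> {..<n}"
  shows "\<exists>c\<in>labelled_cycles a {..<n}. vertices c \<inter> U \<noteq> {} \<and> \<not> vertices c \<subseteq> U"
proof -
  obtain i j where ij: "i \<in> U" "j < n" "j \<notin> U" "0 < a i j" using closed[OF U] by blast
  define E where "E = {(x, y). x < n \<and> y < n \<and> 0 < a x y}"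
  have "(j, i) \<in> E\<^sup>*"
  proof (rule ccontr)
    assume not: "(j, i) \<notin> E\<^sup>*"
    define W where "W = {k. k < n \<and> (j, k) \<in> E\<^sup>*}"
    have "i < n" using ij U by auto
    hence "W \<subset> {..<n}" "W \<noteq> {}" using not ij by (auto simp: W_def)
    then obtain x y where "x \<in> W" "y < n" "y \<notin> W" "0 < a x y" using closed by blast
    thus False by (auto simp: W_def E_def intro: rtrancl_into_rtrancl)
  qed
  then obtain xs where xs: "xs \<noteq> []" "distinct xs" "hd xs = j" "last xs = i"
    "successively (\<lambda>x y. (x, y) \<in> E) xs" by (rule distinct_path_of_rtrancl)
  have "i < n" using ij U by auto
  hence E: "(last xs, hd xs) \<in> E" using xs ij by (simp add: E_def)
  have edge: "(x, cycle_of_list xs x) \<in> E" if "x \<in> set xs" for x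
    by (rule cycle_of_list_edge[OF xs(2,5) E that])
  hence "set xs \<subseteq> {..<n}" "\<And>x. x \<in> set xs \<Longrightarrow> 0 < a x (cycle_of_list xs x)"
    by (auto simp: E_def)
  then obtain c where c: "c \<in> labelled_cycles a {..<n}" "vertices c = set xs"
    using labelled_cycle_of_list[OF xs(1,2)] by blast
  have "i \<in> set xs" "j \<in> set xs" using xs by auto
  thus ?thesis using c ij by blast
qed

text \<open>Conjugation only relabels the indices. The second part holds because \<open>Q\<close>,
  being inverse to \<open>P\<close>, must be its transpose.\<close>

lemma permutation_mat_conj:
  fixes A :: "int mat"
  assumes A: "A \<in> carrier_mat n n" and p: "p permutes {..<n}"
  defines "P \<equiv> mat n n (\<lambda>(i, j). if i = p j then 1 else 0)"
  shows "similar_mat_wit A (mat n n (\<lambda>(i, j). A $$ (p i, p j))) P (transpose_mat P)"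
    and "similar_mat_wit A B P Q \<Longrightarrow> B = mat n n (\<lambda>(i, j). A $$ (p i, p j))"
proof -
  have P: "P \<in> carrier_mat n n" by (simp add: P_def)
  have pn: "p i < n" if "i < n" for i using permutes_in_image[OF p, of i] that by simp
  have inj: "p i = p j \<longleftrightarrow> i = j" for i j using permutes_inj[OF p] by (auto dest: injD)
  have TP: "transpose_mat P * P = 1\<^sub>m n"
  proof (rule eq_matI)
    fix i j assume "i < dim_row (1\<^sub>m n :: int mat)" "j < dim_col (1\<^sub>m n :: int mat)"
    hence ij: "i < n" "j < n" by auto
    have "(transpose_mat P * P) $$ (i, j)
        = (\<Sum>k = 0..<n. (if k = p i then 1 else 0) * (if k = p j then 1 else 0))"
      using ij by (simp add: P_def scalar_prod_def)
    also have "\<dots> = (\<Sum>k = 0..<n. if k = p i then if i = j then 1 else 0 else 0)"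
      by (intro sum.cong refl) (auto simp: inj)
    also have "\<dots> = (if i = j then 1 else 0)" using pn[OF ij(1)] by simp
    finally show "(transpose_mat P * P) $$ (i, j) = 1\<^sub>m n $$ (i, j)" using ij by simp
  qed (simp_all add: P_def)
  have PT: "P * transpose_mat P = 1\<^sub>m n"
  proof (rule eq_matI)
    fix i j assume "i < dim_row (1\<^sub>m n :: int mat)" "j < dim_col (1\<^sub>m n :: int mat)"
    hence ij: "i < n" "j < n" by auto
    have inv_p: "i = p k \<longleftrightarrow> k = inv_into UNIV p i" for i k using permutes_inv_eq[OF p] by metis
    have "inv_into UNIV p i < n" using permutes_in_image[OF permutes_inv[OF p], of i] ij by simp
    have "(P * transpose_mat P) $$ (i, j)
        = (\<Sum>k = 0..<n. (if i = p k then 1 else 0) * (if j = p k then 1 else 0))"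
      using ij by (simp add: P_def scalar_prod_def)
    also have "\<dots> = (\<Sum>k = 0..<n. if k = inv_into UNIV p i then if i = j then 1 else 0 else 0)"
      by (intro sum.cong refl) (auto simp: inv_p[symmetric])
    also have "\<dots> = (if i = j then 1 else 0)" using \<open>inv_into UNIV p i < n\<close> by simp
    finally show "(P * transpose_mat P) $$ (i, j) = 1\<^sub>m n $$ (i, j)" using ij by simp
  qed (simp_all add: P_def)
  have conj: "transpose_mat P * A * P = mat n n (\<lambda>(i, j). A $$ (p i, p j))"
  proof (rule eq_matI)
    fix i j assume "i < dim_row (mat n n (\<lambda>(i, j). A $$ (p i, p j)))"
      "j < dim_col (mat n n (\<lambda>(i, j). A $$ (p i, p j)))"
    hence ij: "i < n" "j < n" by auto
    have TA: "(transpose_mat P * A) $$ (i, k) = A $$ (p i, k)" if "k < n" for k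
    proof -
      have "(transpose_mat P * A) $$ (i, k) = (\<Sum>l = 0..<n. (if l = p i then 1 else 0) * A $$ (l, k))"
        using ij that A by (simp add: P_def scalar_prod_def)
      also have "\<dots> = (\<Sum>l = 0..<n. if l = p i then A $$ (l, k) else 0)"
        by (intro sum.cong refl) auto
      also have "\<dots> = A $$ (p i, k)" using pn[OF ij(1)] by simp
      finally show ?thesis .
    qed
    have "(transpose_mat P * A * P) $$ (i, j)
        = (\<Sum>k = 0..<n. (transpose_mat P * A) $$ (i, k) * (if k = p j then 1 else 0))"
    proof -
      have "transpose_mat P * A \<in> carrier_mat n n" using A P by auto
      moreover have "(B * P) $$ (i, j) = (\<Sum>k = 0..<n. B $$ (i, k) * (if k = p j then 1 else 0))"
        if "B \<in> carrier_mat n n" for B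
        using ij that by (simp add: P_def scalar_prod_def)
      ultimately show ?thesis by blast
    qed
    also have "\<dots> = (\<Sum>k = 0..<n. if k = p j then A $$ (p i, k) else 0)"
      by (intro sum.cong refl) (auto simp: TA)
    also have "\<dots> = A $$ (p i, p j)" using pn[OF ij(2)] by simp
    finally show "(transpose_mat P * A * P) $$ (i, j) = mat n n (\<lambda>(i, j). A $$ (p i, p j)) $$ (i, j)"
      using ij by simp
  qed (use A P in auto)
  have PBT: "P * (transpose_mat P * A * P) * transpose_mat P = A"
  proof -
    have "P * (transpose_mat P * A * P) * transpose_mat P
        = (P * transpose_mat P) * A * (P * transpose_mat P)"
      using A P by (simp add: assoc_mult_mat[of _ n n _ n _ n])
    thus ?thesis using A PT by simp
  qed
  show "similar_mat_wit A (mat n n (\<lambda>(i, j). A $$ (p i, p j))) P (transpose_mat P)"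
    by (rule similar_mat_witI[OF PT TP PBT[symmetric, unfolded conj] A]) (use P in auto)
  assume "similar_mat_wit A B P Q"
  note sim = similar_mat_witD2[OF A this]
  have "Q = transpose_mat P * P * Q" using TP sim by simp
  also have "\<dots> = transpose_mat P" using sim P by (simp add: assoc_mult_mat[of _ n n _ n _ n])
  finally have Q: "Q = transpose_mat P" .
  have "Q * A * P = (Q * P) * B * (Q * P)"
    unfolding sim(3) using sim(4-7) by (simp add: assoc_mult_mat[of _ n n _ n _ n])
  hence "Q * A * P = B" using sim by simp
  thus "B = mat n n (\<lambda>(i, j). A $$ (p i, p j))" using conj Q by simp
qed

text \<open>If no edge left \<open>W\<close>, a permutation placing \<open>W\<close> after its
  complement would give two diagonal blocks with zeros below them.\<close>

lemma irreducible_matD: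
  fixes A :: "int mat"
  assumes A: "A \<in> carrier_mat n n" and irr: "irreducible_mat A" and W: "W \<noteq> {}" "W \<subset> {..<n}"
  shows "\<exists>i\<in>W. \<exists>j\<in>{..<n} - W. A $$ (i, j) \<noteq> 0"
proof (rule ccontr)
  assume "\<not> ?thesis"
  hence zero: "A $$ (i, j) = 0" if "i \<in> W" "j < n" "j \<notin> W" for i j using that by blast
  have finW: "finite W" using W finite_subset by blast
  define k where "k = n - card W"
  have card: "0 < card W" "card W < n"
    using W finW psubset_card_mono[of "{..<n}" W] by (auto simp: card_gt_0_iff)
  have "card ({..<n} - W) = card {..<k}" using W finW by (simp add: k_def card_Diff_subset psubset_imp_subset)
  then obtain f where f: "bij_betw f {..<k} ({..<n} - W)"
    by (metis finite_same_card_bij finite_Diff finite_lessThan)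
  have "card W = card {k..<n}" using card by (simp add: k_def)
  then obtain h where h: "bij_betw h {k..<n} W"
    by (metis finite_same_card_bij finW finite_atLeastLessThan)
  define p where "p i = (if i < k then f i else if i < n then h i else i)" for i
  have kn: "k \<le> n" by (simp add: k_def)
  have "bij_betw p ({..<k} \<union> {k..<n}) (({..<n} - W) \<union> W)"
  proof (rule bij_betw_combine)
    show "bij_betw p {..<k} ({..<n} - W)"
      using f by (rule bij_betw_cong[THEN iffD1, rotated]) (simp add: p_def)
    show "bij_betw p {k..<n} W"
      using h by (rule bij_betw_cong[THEN iffD1, rotated]) (simp add: p_def)
  qed blast
  moreover have "{..<k} \<union> {k..<n} = {..<n}" "({..<n} - W) \<union> W = {..<n}" using kn W by auto
  ultimately have p: "p permutes {..<n}"
    using kn by (intro bij_imp_permutes) (auto simp: p_def)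
  let ?P = "mat n n (\<lambda>(i, j). if i = p j then 1 else 0) :: int mat"
  let ?B = "mat n n (\<lambda>(i, j). A $$ (p i, p j))"
  have "permutation_mat (dim_row A) ?P" using A p unfolding permutation_mat_def by auto
  moreover have "block_upper_triangular [k, n - k] ?B"
    unfolding block_upper_triangular_def
  proof (intro conjI allI impI)
    fix m i j assume m: "m < length [k, n - k]"
      and ij: "j < sum_list (take m [k, n - k]) \<and> sum_list (take m [k, n - k]) \<le> i \<and> i < sum_list [k, n - k]"
    \<comment> \<open>The boundary \<open>m = 0\<close> is vacuous: no column index lies below
      0.\<close>
    have "m = 1" using m ij by (cases m) auto
    hence ij: "j < k" "k \<le> i" "i < n" using ij kn by auto
    have "p i \<in> W" using ij bij_betwE[OF h] by (auto simp: p_def)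
    moreover have "p j \<in> {..<n} - W" using ij bij_betwE[OF f] by (auto simp: p_def)
    ultimately show "?B $$ (i, j) = 0" using ij kn zero by simp
  qed (use kn in auto)
  moreover have "0 \<notin> set [k, n - k]" using card by (auto simp: k_def)
  ultimately show False
    using irr permutation_mat_conj(1)[OF A p] unfolding irreducible_mat_def
    by (metis One_nat_def Suc_1 le_refl length_Cons list.size(3))
qed

text \<open>The first block boundary suffices: the indices behind it correspond to a proper nonempty
  set without outgoing edges.\<close>

lemma irreducible_matI:
  fixes A :: "int mat"
  assumes A: "A \<in> carrier_mat n n"
    and W: "\<And>W. W \<noteq> {} \<Longrightarrow> W \<subset> {..<n} \<Longrightarrow> \<exists>i\<in>W. \<exists>j\<in>{..<n} - W. A $$ (i, j) \<noteq> 0"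
  shows "irreducible_mat A"
  unfolding irreducible_mat_def
proof (intro conjI notI)
  show "square_mat A" using A by simp
  assume "\<exists>B P Q ns. permutation_mat (dim_row A) P \<and> similar_mat_wit A B P Q \<and>
    2 \<le> length ns \<and> 0 \<notin> set ns \<and> block_upper_triangular ns B"
  then obtain B P Q ns where *: "permutation_mat n P" "similar_mat_wit A B P Q"
    "2 \<le> length ns" "0 \<notin> set ns" "block_upper_triangular ns B" using A by auto
  obtain p where p: "p permutes {..<n}" "P = mat n n (\<lambda>(i, j). if i = p j then 1 else 0)"
    using *(1) by (auto simp: permutation_mat_def)
  have B: "B = mat n n (\<lambda>(i, j). A $$ (p i, p j))"
    using permutation_mat_conj(2)[OF A p(1)] *(2) p(2) by blast
  obtain k l ns' where ns: "ns = k # l # ns'"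
  proof (cases ns)
    case (Cons k ns)
    thus ?thesis using *(3) that by (cases ns) auto
  qed (use *(3) in simp)
  have n: "sum_list ns = n" using *(5) B by (auto simp: block_upper_triangular_def)
  have k: "0 < k" "k < n" using *(4) n ns by auto
  have zero: "B $$ (i, j) = 0" if "j < k" "k \<le> i" "i < n" for i j
  proof -
    have "1 < length ns" "sum_list (take 1 ns) = k" using ns by auto
    thus ?thesis using *(5) that n unfolding block_upper_triangular_def by metis
  qed
  let ?W = "p ` {k..<n}"
  have pn: "p i < n" if "i < n" for i using permutes_in_image[OF p(1), of i] that by simp
  have inj: "p i = p j \<longleftrightarrow> i = j" for i j using permutes_inj[OF p(1)] by (auto dest: injD)
  have "?W \<noteq> {}" using k by simp
  moreover have "?W \<subset> {..<n}"
  proof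
    show "?W \<subseteq> {..<n}" using pn by auto
    have "p 0 \<notin> ?W" using k by (auto simp: inj)
    moreover have "p 0 \<in> {..<n}" using k pn[of 0] by simp
    ultimately show "?W \<noteq> {..<n}" by metis
  qed
  ultimately have "\<exists>i\<in>?W. \<exists>j\<in>{..<n} - ?W. A $$ (i, j) \<noteq> 0" by (rule W)
  then obtain i j where ij: "i \<in> ?W" "j \<in> {..<n} - ?W" "A $$ (i, j) \<noteq> 0" by (elim bexE)
  then obtain i' where i: "i = p i'" "k \<le> i'" "i' < n" by auto
  have "j \<in> p ` {..<n}" using permutes_image[OF p(1)] ij(2) by simp
  then obtain j' where j: "j = p j'" "j' < n" by auto
  have "j' < k"
  proof (rule ccontr)
    assume "\<not> j' < k"
    hence "j \<in> ?W" using j by simp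
    thus False using ij(2) by simp
  qed
  thus False using zero[of j' i'] i j ij(3) B by simp
qed

section \<open>Spectral radius and skew-reciprocity\<close>

definition mat_cycles :: "int mat \<Rightarrow> (nat list \<times> nat) set" where
  "mat_cycles A = labelled_cycles (\<lambda>i j. A $$ (i, j)) {..<dim_row A}"

lemma finite_mat_cycles [simp]: "finite (mat_cycles A)"
  by (simp add: mat_cycles_def finite_labelled_cycles)

lemma mat_cycles_vertices:
  "c \<in> mat_cycles A \<Longrightarrow> vertices c \<noteq> {} \<and> vertices c \<subseteq> {..<dim_row A}"
  by (auto simp: mat_cycles_def labelled_cycles_def)

lemma card_vertices_pos: "c \<in> mat_cycles A \<Longrightarrow> 0 < card (vertices c)"
  using mat_cycles_vertices[of c A] by (simp add: card_gt_0_iff)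

lemma char_poly_eq_clique_sum:
  assumes A: "A \<in> carrier_mat n n" "nonneg_mat A" and z: "z \<noteq> 0"
  shows "poly (char_poly (map_mat complex_of_int A)) z = z ^ n * clique_sum vertices (mat_cycles A) (1 / z)"
proof -
  have "minor (\<lambda>i j. A $$ (i, j)) (1 / z) {..<n}
      = clique_sum vertices (labelled_cycles (\<lambda>i j. A $$ (i, j)) {..<n}) (1 / z)"
    by (rule minor_eq_clique_sum) (use A in \<open>auto simp: nonneg_mat_def\<close>)
  thus ?thesis using char_poly_eq_minor[OF A(1) z] A by (simp add: mat_cycles_def)
qed

text \<open>Nonzero eigenvalues are the inverses of the zeros of the clique sum, so an eigenvalue of
  maximal modulus gives a zero of minimal modulus.\<close>

lemma spectral_radius_clique_sum:
  assumes A: "A \<in> carrier_mat n n" "nonneg_mat A" and n: "0 < n"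
    and rho: "0 < spectral_radius (map_mat complex_of_int A)"
  defines "t \<equiv> 1 / spectral_radius (map_mat complex_of_int A)"
  shows "clique_sum vertices (mat_cycles A) t = 0"
    and "F \<subseteq> mat_cycles A \<Longrightarrow> 0 \<le> clique_sum vertices F t"
proof -
  let ?A = "map_mat complex_of_int A"
  have A': "?A \<in> carrier_mat n n" using A by simp
  have root: "z \<in> spectrum ?A \<longleftrightarrow> clique_sum vertices (mat_cycles A) (1 / z) = 0" if "z \<noteq> 0" for z
    using char_poly_eq_clique_sum[OF A that] that by (simp add: spectrum_root_char_poly[OF A'])
  obtain z where z: "z \<in> spectrum ?A" "norm z = spectral_radius ?A"
    using spectral_radius_mem_max(1)[OF A' n] by (metis imageE)
  have "z \<noteq> 0" using z rho by auto
  have zero: "clique_sum vertices (mat_cycles A) (1 / z) = 0" using root[OF \<open>z \<noteq> 0\<close>] z by simp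
  have nz: "1 / z \<noteq> 0" using \<open>z \<noteq> 0\<close> by simp
  have t: "norm (1 / z) = t" using z by (simp add: t_def norm_divide)
  have min: "clique_sum vertices (mat_cycles A) u \<noteq> 0" if u: "norm u < norm (1 / z)" for u :: complex
  proof (cases "u = 0")
    case True
    thus ?thesis by (simp add: clique_sum_0 card_vertices_pos)
  next
    case False
    show ?thesis
    proof
      assume "clique_sum vertices (mat_cycles A) u = 0"
      hence "1 / u \<in> spectrum ?A" using root[of "1 / u"] False by simp
      hence "norm (1 / u) \<le> spectral_radius ?A"
        by (intro spectral_radius_mem_max(2)[OF A' n] imageI)
      thus False using u t rho False by (simp add: t_def norm_divide field_simps)
    qed
  qed
  show "clique_sum vertices (mat_cycles A) t = 0"
    using clique_sum_first_zero(1)[OF finite_mat_cycles card_vertices_pos zero nz min] t by simp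
  show "F \<subseteq> mat_cycles A \<Longrightarrow> 0 \<le> clique_sum vertices F t"
    using clique_sum_first_zero(2)[OF finite_mat_cycles card_vertices_pos zero nz min] t by simp
qed

lemma char_poly_prod_eigenvalues:
  assumes A: "A \<in> carrier_mat n n"
  shows "char_poly A = (\<Prod>e\<in>#eigenvalue_mset A. [:- e, 1:])" "size (eigenvalue_mset A) = n"
proof -
  have "degree (char_poly A) = n \<and> coeff (char_poly A) n = 1" by (rule degree_monic_char_poly[OF A])
  thus "char_poly A = (\<Prod>e\<in>#eigenvalue_mset A. [:- e, 1:])" "size (eigenvalue_mset A) = n"
    using complex_poly_decompose_multiset[of "char_poly A"] size_proots_complex[of "char_poly A"]
    by (simp_all add: eigenvalue_mset_def)
qed

lemma prod_mset_reflect: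
  fixes z :: complex
  assumes "z \<noteq> 0" "0 \<notin># M"
  shows "z ^ size M * (\<Prod>e\<in>#M. - (1 / z) - e)
    = (\<Prod>e\<in>#M. - e) * (\<Prod>e\<in>#image_mset (\<lambda>t. - inverse t) M. z - e)"
  using assms(2)
proof (induction M)
  case (add e M)
  have eq: "z * (- (1 / z) - e) = - e * (z - (- inverse e))" using assms(1) add.prems by (simp add: field_simps)
  have IH: "z ^ size M * (\<Prod>e\<in>#M. - (1 / z) - e)
      = (\<Prod>e\<in>#M. - e) * (\<Prod>e\<in>#image_mset (\<lambda>t. - inverse t) M. z - e)" using add by simp
  have "z ^ size (add_mset e M) * (\<Prod>e\<in>#add_mset e M. - (1 / z) - e)
      = (z * (- (1 / z) - e)) * (z ^ size M * (\<Prod>e\<in>#M. - (1 / z) - e))"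
    by (simp only: size_add_mset power_Suc image_mset_add_mset prod_mset.add_mset mult_ac)
  also have "\<dots> = (- e * (z - (- inverse e))) *
      ((\<Prod>e\<in>#M. - e) * (\<Prod>e\<in>#image_mset (\<lambda>t. - inverse t) M. z - e))"
    by (simp only: eq IH)
  also have "\<dots> = (\<Prod>e\<in>#add_mset e M. - e) *
      (\<Prod>e\<in>#image_mset (\<lambda>t. - inverse t) (add_mset e M). z - e)"
    by (simp only: image_mset_add_mset prod_mset.add_mset mult_ac)
  finally show ?case .
qed simp

lemma poly_char_poly_eigenvalues:
  assumes A: "A \<in> carrier_mat n n"
  shows "poly (char_poly A) w = (\<Prod>e\<in>#eigenvalue_mset A. w - e)"
  by (subst char_poly_prod_eigenvalues(1)[OF A]) (simp add: poly_prod_mset)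

lemma poly_skew_functional:
  assumes A: "A \<in> carrier_mat n n" and "0 \<notin># eigenvalue_mset A" and z: "z \<noteq> 0"
  shows "z ^ n * poly (char_poly A) (- (1 / z)) = (\<Prod>e\<in>#eigenvalue_mset A. - e) *
    (\<Prod>e\<in>#image_mset (\<lambda>t. - inverse t) (eigenvalue_mset A). z - e)"
  using prod_mset_reflect[OF z assms(2)]
  by (simp only: poly_char_poly_eigenvalues[OF A] char_poly_prod_eigenvalues(2)[OF A])

text \<open>\<open>eps\<close> is the product of the negated eigenvalues, which is the determinant
  as \<open>n\<close> is even. Invariance of the eigenvalues makes it also the product of their
  inverses, so its square is \<open>(- 1) ^ n = 1\<close>.\<close>

lemma skew_reciprocal_sign:
  assumes A: "A \<in> carrier_mat n n" and n: "even n" and skew: "skew_reciprocal A"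
  obtains eps :: real where "eps = 1 \<or> eps = - 1"
    "\<And>z. z \<noteq> 0 \<Longrightarrow> z ^ n * poly (char_poly A) (- (1 / z)) = of_real eps * poly (char_poly A) z"
proof -
  let ?M = "eigenvalue_mset A"
  have M: "0 \<notin># ?M" "image_mset (\<lambda>t. - inverse t) ?M = ?M" using skew by (auto simp: skew_reciprocal_def)
  define eps where "eps = (\<Prod>e\<in>#?M. - e)"
  have "eps = (\<Prod>e\<in>#image_mset (\<lambda>t. - inverse t) ?M. - e)" by (simp add: eps_def M(2))
  also have "\<dots> = (\<Prod>e\<in>#?M. inverse e)" by (simp add: image_mset.compositionality comp_def)
  finally have "eps * eps = (\<Prod>e\<in>#?M. inverse e) * (\<Prod>e\<in>#?M. - e)" by (simp add: eps_def)
  also have "\<dots> = (\<Prod>e\<in>#?M. - 1)"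
    unfolding prod_mset.distrib[symmetric]
  proof (intro arg_cong[where f = prod_mset] image_mset_cong)
    fix e assume "e \<in># ?M"
    hence "e \<noteq> 0" using M(1) by metis
    thus "inverse e * - e = - 1" by simp
  qed
  also have "\<dots> = 1" using char_poly_prod_eigenvalues(2)[OF A] n by (simp add: prod_mset_constant)
  finally have "eps = 1 \<or> eps = - 1" by (simp add: square_eq_1_iff)
  moreover have "z ^ n * poly (char_poly A) (- (1 / z)) = eps * poly (char_poly A) z" if "z \<noteq> 0" for z
    using poly_skew_functional[OF A M(1) that]
    by (simp only: M(2) eps_def poly_char_poly_eigenvalues[OF A])
  ultimately show ?thesis using that[of 1] that[of "- 1"] by auto
qed

lemma clique_coefficients_skew:
  assumes A: "A \<in> carrier_mat n n" "nonneg_mat A" and n: "even n"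
    and skew: "skew_reciprocal (map_mat complex_of_int A)"
  obtains eps :: real where "eps = 1 \<or> eps = - 1"
    "\<And>k. k \<le> n \<Longrightarrow>
      (\<Sum>K | K \<in> cliques vertices (mat_cycles A) \<and> (\<Sum>c\<in>K. card (vertices c)) = n - k. (- 1) ^ card K :: real) =
      eps * (- 1) ^ k *
      (\<Sum>K | K \<in> cliques vertices (mat_cycles A) \<and> (\<Sum>c\<in>K. card (vertices c)) = k. (- 1) ^ card K)"
proof -
  let ?A = "map_mat complex_of_int A"
  have A': "?A \<in> carrier_mat n n" using A by simp
  obtain eps :: real where eps: "eps = 1 \<or> eps = - 1"
    "\<And>z. z \<noteq> 0 \<Longrightarrow> z ^ n * poly (char_poly ?A) (- (1 / z)) = of_real eps * poly (char_poly ?A) z"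
    using skew_reciprocal_sign[OF A' n skew] by blast
  define c :: "nat \<Rightarrow> real" where "c k = (\<Sum>K | K \<in> cliques vertices (mat_cycles A) \<and>
    (\<Sum>c\<in>K. card (vertices c)) = k. (- 1) ^ card K)" for k
  have expand: "clique_sum vertices (mat_cycles A) z = (\<Sum>k\<le>n. of_real (c k) * z ^ k)" for z :: complex
    using clique_sum_expand[OF finite_mat_cycles, of A vertices n z] mat_cycles_vertices[of _ A] A
    by (auto simp: c_def)
  have fun_eq: "(\<Sum>k\<le>n. (of_real (c k) * (- 1) ^ k - of_real eps * of_real (c (n - k))) * z ^ k) = 0"
    if z: "z \<noteq> 0" for z :: complex
  proof -
    have "z ^ n * ((- (1 / z)) ^ n * clique_sum vertices (mat_cycles A) (- z))
        = of_real eps * (z ^ n * clique_sum vertices (mat_cycles A) (1 / z))"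
      using eps(2)[OF z] char_poly_eq_clique_sum[OF A, of "- (1 / z)"] char_poly_eq_clique_sum[OF A z] z by simp
    moreover have "z ^ n * (- (1 / z)) ^ n = 1" using z n by (simp add: power_mult_distrib[symmetric])
    ultimately have "clique_sum vertices (mat_cycles A) (- z)
        = of_real eps * (z ^ n * clique_sum vertices (mat_cycles A) (1 / z))"
      by (metis mult.assoc mult_1)
    moreover have "z ^ n * (\<Sum>k\<le>n. of_real (c k) * (1 / z) ^ k) = (\<Sum>k\<le>n. of_real (c (n - k)) * z ^ k)"
    proof -
      have "(\<Sum>k\<le>n. of_real (c (n - k)) * z ^ k) = (\<Sum>k\<le>n. of_real (c k) * z ^ (n - k))"
        by (rule sum.reindex_bij_witness[of _ "\<lambda>k. n - k" "\<lambda>k. n - k"]) auto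
      also have "\<dots> = (\<Sum>k\<le>n. z ^ n * (of_real (c k) * (1 / z) ^ k))"
        using z by (intro sum.cong refl) (simp add: power_diff power_divide)
      finally show ?thesis by (simp add: sum_distrib_left)
    qed
    moreover have "(\<Sum>k\<le>n. of_real (c k) * (- z) ^ k) = (\<Sum>k\<le>n. of_real (c k) * (- 1) ^ k * z ^ k)"
      by (intro sum.cong refl) (simp add: power_minus[of z])
    ultimately have "(\<Sum>k\<le>n. of_real (c k) * (- 1) ^ k * z ^ k)
        = of_real eps * (\<Sum>k\<le>n. of_real (c (n - k)) * z ^ k)"
      unfolding expand by metis
    thus ?thesis by (simp add: left_diff_distrib sum_subtractf sum_distrib_left mult.assoc)
  qed
  have "c (n - k) = eps * (- 1) ^ k * c k" if k: "k \<le> n" for k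
  proof (rule ccontr)
    assume neq: "c (n - k) \<noteq> eps * (- 1) ^ k * c k"
    have "of_real (c k) * (- 1) ^ k - of_real eps * of_real (c (n - k)) \<noteq> (0 :: complex)"
    proof
      assume "of_real (c k) * (- 1) ^ k - of_real eps * of_real (c (n - k)) = (0 :: complex)"
      hence "of_real (c k * (- 1) ^ k - eps * c (n - k)) = (0 :: complex)" by simp
      hence "c k * (- 1) ^ k = eps * c (n - k)" by (simp only: of_real_eq_0_iff right_minus_eq)
      moreover have "eps * eps = 1" using eps(1) by auto
      ultimately have "eps * (c k * (- 1) ^ k) = c (n - k)" by (simp flip: mult.assoc)
      thus False using neq by (simp add: mult_ac)
    qed
    \<comment> \<open>The functional equation holds at every nonzero \<open>z\<close>; infinitely
      many roots force all coefficients of the difference to vanish.\<close>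
    from polyfun_roots_finite[of "\<lambda>k. of_real (c k) * (- 1) ^ k - of_real eps * of_real (c (n - k))", OF this k]
    have "finite {z :: complex. (\<Sum>i\<le>n. (of_real (c i) * (- 1) ^ i - of_real eps * of_real (c (n - i))) * z ^ i) = 0}" .
    moreover have "- {0} \<subseteq> {z :: complex. (\<Sum>i\<le>n. (of_real (c i) * (- 1) ^ i - of_real eps * of_real (c (n - i))) * z ^ i) = 0}"
      using fun_eq by auto
    ultimately have "finite (- {0 :: complex})" by (rule rev_finite_subset)
    thus False using infinite_UNIV_char_0[where 'a = complex] finite_compl[of "{0 :: complex}"] by simp
  qed
  thus ?thesis using that eps(1) unfolding c_def by blast
qed

section \<open>The extremal value\<close>

lemma power_pred_succ:
  assumes "1 \<le> g"
  shows "r ^ (g - 1) * r ^ (g + 1) = (r ^ g * r ^ g :: 'a :: monoid_mult)"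
proof -
  have "g - 1 + (g + 1) = g + g" using assms by simp
  thus ?thesis by (simp only: power_add[symmetric])
qed

text \<open>Write \<open>y = sqrt x\<close>. Since \<open>p * q = x\<^sup>2\<close> and
  \<open>p\<close> lies between \<open>x * y\<close> and \<open>y\<close>, convexity gives
  \<open>p + q \<le> y * (1 + x)\<close>. Without the golden inequality
  \<open>y \<le> 1 - x\<close>, and the bound becomes \<open>1 - x\<^sup>2\<close>. For
  \<open>g = 2\<close> one has \<open>p = y\<close>, so the threshold cannot be raised
  uniformly.\<close>

lemma golden_of_gt:
  fixes t :: real
  assumes t: "0 < t" "t < 1" and g: "2 \<le> g" and gt: "1 < (t ^ g)\<^sup>2 + t ^ (g - 1) + t ^ (g + 1)"
  shows "(t ^ g)\<^sup>2 - 3 * t ^ g + 1 < 0"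
proof (rule ccontr)
  assume neg: "\<not> ?thesis"
  define x p q y where "x = t ^ g" and "p = t ^ (g - 1)" and "q = t ^ (g + 1)" and "y = sqrt x"
  have x: "0 < x" "x < 1" using t g by (auto simp: x_def power_less_one_iff)
  have y: "0 < y" "y * y = x" "y < 1" using x by (simp_all add: y_def)
  have y2: "y\<^sup>2 = x" using y by (simp add: power2_eq_square)
  have "x \<le> (1 - x)\<^sup>2" using neg by (simp add: x_def power2_eq_square algebra_simps)
  hence "y\<^sup>2 \<le> (1 - x)\<^sup>2" by (simp only: y2)
  hence yx: "y \<le> 1 - x" by (rule power2_le_imp_le) (use x in simp)
  have p0: "0 < p" using t by (simp add: p_def)
  have pq: "p * q = x * x"
    unfolding p_def q_def x_def by (rule power_pred_succ) (use g in simp)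
  have "p\<^sup>2 = t ^ (2 * (g - 1))" by (simp add: p_def power_mult[symmetric] mult.commute)
  also have "\<dots> \<le> x" unfolding x_def using t g by (intro power_decreasing) auto
  finally have "p\<^sup>2 \<le> y\<^sup>2" by (simp only: y2)
  hence py: "p \<le> y" by (rule power2_le_imp_le) (use y in simp)
  have px: "x \<le> p" unfolding x_def p_def using t g by (intro power_decreasing) auto
  have xy: "x \<le> y" using mult_left_mono[of y 1 y] y by simp
  have "x * x \<le> p * y" using px xy x p0 by (intro mult_mono) auto
  hence "0 \<le> (y - p) * (p * y - x * x)" using py by (intro mult_nonneg_nonneg) auto
  also have "\<dots> = (y * y) * p + (x * x) * p - (x * x) * y - p * p * y" by (simp add: algebra_simps)
  also have "\<dots> = p * y * (y * (1 + x)) - p * y * (p + q)"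
  proof -
    have "p * y * (y * (1 + x)) = p * (y * y) + p * x * (y * y)" by (simp add: algebra_simps)
    moreover have "p * y * (p + q) = p * p * y + y * (p * q)" by (simp add: algebra_simps)
    ultimately show ?thesis using y(2) pq by (simp add: algebra_simps)
  qed
  finally have "p * y * (p + q) \<le> p * y * (y * (1 + x))" by simp
  hence "p + q \<le> y * (1 + x)" using p0 y(1) by simp
  also have "\<dots> \<le> (1 - x) * (1 + x)" using yx x by (intro mult_right_mono) auto
  also have "\<dots> = 1 - x\<^sup>2" by (simp add: power2_eq_square algebra_simps)
  finally show False using gt by (simp add: p_def q_def x_def)
qed

lemma poly_lambda_poly:
  "poly (lambda_poly g) r = (if odd g then r ^ (2 * g) - r ^ g - 1
     else r ^ (2 * g) - r ^ (g + 1) - r ^ (g - 1) - 1)"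
  by (simp add: lambda_poly_def poly_monom)

lemma lambda_poly_root_inverse:
  assumes g: "1 \<le> g" and r: "0 < r" "poly (lambda_poly g) r = 0"
  shows "odd g \<Longrightarrow> ((1 / r) ^ g)\<^sup>2 + (1 / r) ^ g = 1"
    and "even g \<Longrightarrow> ((1 / r) ^ g)\<^sup>2 + (1 / r) ^ (g - 1) + (1 / r) ^ (g + 1) = 1"
proof -
  define X where "X = r ^ g"
  have X: "0 < X" "(1 / r) ^ g = 1 / X" using r by (simp_all add: X_def power_one_over)
  have split: "r ^ (2 * g) = X * X" by (simp add: X_def mult_2 power_add)
  show "((1 / r) ^ g)\<^sup>2 + (1 / r) ^ g = 1" if "odd g"
  proof -
    have "X * X = X + 1" using r(2) that by (simp add: poly_lambda_poly split X_def)
    hence "(1 / X)\<^sup>2 * (X + 1) = 1" using X by (simp add: power2_eq_square)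
    moreover have "(1 / X)\<^sup>2 * (X + 1) = (1 / X)\<^sup>2 + 1 / X"
      using X by (simp add: power2_eq_square field_simps)
    ultimately show ?thesis by (simp only: X)
  qed
  show "((1 / r) ^ g)\<^sup>2 + (1 / r) ^ (g - 1) + (1 / r) ^ (g + 1) = 1" if "even g"
  proof -
    define p q where "p = r ^ (g - 1)" and "q = r ^ (g + 1)"
    have pq: "p * q = X * X" "0 < p" "0 < q"
      using r power_pred_succ[OF g, of r] by (simp_all only: p_def q_def X_def zero_less_power)
    have "X * X = q + p + 1" using r(2) that by (simp add: poly_lambda_poly split p_def q_def)
    hence "1 + q + p = p * q" using pq by simp
    hence "(1 + q + p) / (p * q) = 1" using pq(2,3) by simp
    moreover have "(1 + q + p) / (p * q) = 1 / (p * q) + 1 / p + 1 / q"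
      using pq by (simp add: field_simps)
    moreover have "(1 / X)\<^sup>2 = 1 / (p * q)" using pq by (simp add: power2_eq_square)
    ultimately have "(1 / X)\<^sup>2 + 1 / p + 1 / q = 1" by linarith
    moreover have "(1 / r) ^ (g - 1) = 1 / p" "(1 / r) ^ (g + 1) = 1 / q"
      by (simp_all only: p_def q_def power_one_over)
    ultimately show ?thesis by (simp only: X(2))
  qed
qed

text \<open>An arbitrary real root is allowed, so that the extremal matrix can later be inserted to
  bound all roots. If \<open>r\<close> exceeded the spectral radius, the equation for
  \<open>1 / r\<close> would become a strict inequality at the larger point
  \<open>t\<close>.\<close>

lemma lambda_poly_root_le:
  assumes g: "1 \<le> g" and A: "A \<in> skew_reciprocal_nonneg_irreducible (2 * g)"
    and rho: "1 < spectral_radius (map_mat complex_of_int A)" and r: "poly (lambda_poly g) r = 0"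
  shows "r \<le> spectral_radius (map_mat complex_of_int A)"
proof (rule ccontr)
  assume gt: "\<not> ?thesis"
  let ?rho = "spectral_radius (map_mat complex_of_int A)"
  define t u where "t = 1 / ?rho" and "u = 1 / r"
  have u: "0 < u" "u < t" and t: "0 < t" "t < 1"
    using gt rho by (auto simp: t_def u_def field_simps)
  have A': "A \<in> carrier_mat (2 * g) (2 * g)" "nonneg_mat A" "irreducible_mat A"
    "skew_reciprocal (map_mat complex_of_int A)"
    using A by (auto simp: skew_reciprocal_nonneg_irreducible_def GL_int_def)
  obtain eps :: real where eps: "eps = 1 \<or> eps = - 1"
    "\<And>k. k \<le> 2 * g \<Longrightarrow>
      (\<Sum>K | K \<in> cliques vertices (mat_cycles A) \<and> (\<Sum>c\<in>K. card (vertices c)) = 2 * g - k. (- 1) ^ card K :: real) =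
      eps * (- 1) ^ k *
      (\<Sum>K | K \<in> cliques vertices (mat_cycles A) \<and> (\<Sum>c\<in>K. card (vertices c)) = k. (- 1) ^ card K)"
    using clique_coefficients_skew[OF A'(1,2) _ A'(4)] by auto
  interpret cycle_system "mat_cycles A" vertices g t eps
  proof
    show "\<exists>c\<in>mat_cycles A. vertices c \<inter> U \<noteq> {} \<and> \<not> vertices c \<subseteq> U"
      if U: "U \<noteq> {}" "U \<subset> {..<2 * g}" for U
    proof -
      have pos: "\<exists>i\<in>W. \<exists>j\<in>{..<2 * g} - W. 0 < A $$ (i, j)" if W: "W \<noteq> {}" "W \<subset> {..<2 * g}" for W
      proof -
        obtain i j where ij: "i \<in> W" "j \<in> {..<2 * g} - W" "A $$ (i, j) \<noteq> 0"
          using irreducible_matD[OF A'(1,3) W] by blast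
        have "0 \<le> A $$ (i, j)" using A'(1,2) ij W by (auto simp: nonneg_mat_def)
        thus ?thesis using ij by force
      qed
      from crossing_cycle[where a = "\<lambda>i j. A $$ (i, j)", OF pos U] show ?thesis
        using A'(1) by (simp add: mat_cycles_def)
    qed
    show "vertices c \<noteq> {} \<and> vertices c \<subseteq> {..<2 * g}" if "c \<in> mat_cycles A" for c
      using mat_cycles_vertices[OF that] A'(1) by simp
    show "clique_sum vertices (mat_cycles A) t = 0"
      "\<And>F. F \<subseteq> mat_cycles A \<Longrightarrow> 0 \<le> clique_sum vertices F t"
      using spectral_radius_clique_sum[OF A'(1,2)] g rho by (auto simp: t_def)
  qed (use g t eps in auto)
  have mono: "u ^ k < t ^ k" if "0 < k" for k using u that by (intro power_strict_mono) auto
  have mono': "u ^ k \<le> t ^ k" for k using u by (intro power_mono) auto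
  have sq: "(u ^ g)\<^sup>2 \<le> (t ^ g)\<^sup>2" using mono' u by (intro power_mono) auto
  have r0: "0 < r" using gt rho by simp
  show False
  proof (cases "odd g")
    case True
    have "(u ^ g)\<^sup>2 + u ^ g = 1" using lambda_poly_root_inverse(1)[OF g r0 r True] by (simp add: u_def)
    moreover have "t ^ g + (t ^ g)\<^sup>2 \<le> 1" using odd_bound by (simp add: x_def)
    ultimately show False using sq mono[of g] g by simp
  next
    case False
    hence g2: "2 \<le> g" using g by (cases "g = 1") auto
    have "(u ^ g)\<^sup>2 + u ^ (g - 1) + u ^ (g + 1) = 1"
      using lambda_poly_root_inverse(2)[OF g r0 r] False by (simp add: u_def)
    hence one: "1 < (t ^ g)\<^sup>2 + t ^ (g - 1) + t ^ (g + 1)"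
      using sq mono[of "g - 1"] mono[of "g + 1"] g2 by linarith
    interpret even_cycle_system "mat_cycles A" vertices g t eps
      by unfold_locales (use False golden_of_gt[OF t g2 one] in \<open>auto simp: x_def\<close>)
    obtain c where c: "len c < g" "x\<^sup>2 + t ^ len c + t ^ (2 * g - len c) = 1"
      using unique_short by blast
    \<comment> \<open>With fixed exponent sum \<open>2 * g\<close>, the sum of two powers is
      smallest when the exponents are closest; oddness has excluded nothing below
      \<open>g - 1\<close>, which is the largest length available here.\<close>
    have "t ^ (g - 1) \<le> t ^ len c" "t ^ (g + 1 - len c) \<le> 1"
      using t c by (auto intro: power_decreasing power_le_one)
    hence "0 \<le> (t ^ len c - t ^ (g - 1)) * (1 - t ^ (g + 1 - len c))"
      by (intro mult_nonneg_nonneg) auto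
    also have "\<dots> = t ^ len c + t ^ (g - 1 + (g + 1 - len c)) - t ^ (g - 1) - t ^ (len c + (g + 1 - len c))"
      by (simp only: power_add) (simp add: algebra_simps)
    also have "g - 1 + (g + 1 - len c) = 2 * g - len c" using c g2 by simp
    also have "len c + (g + 1 - len c) = g + 1" using c by simp
    finally show False using one c(2) by (simp add: x_def)
  qed
qed

section \<open>The companion matrix attaining the bound\<close>

definition companion :: "nat \<Rightarrow> (nat \<Rightarrow> 'a) \<Rightarrow> 'a::comm_ring_1 mat" where
  "companion n c = mat n n (\<lambda>(i, j). if Suc i = n then c j else if j = Suc i then 1 else 0)"

lemma companion_carrier [simp]: "companion n c \<in> carrier_mat n n"
  by (simp add: companion_def)

text \<open>In the first column only the rows 0 and \<open>n\<close> contribute. Deleting row and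
  column 0 leaves a companion matrix for the shifted coefficients.\<close>

lemma det_companion:
  assumes "0 < n"
  shows "det (z \<cdot>\<^sub>m 1\<^sub>m n - companion n c) = z ^ n - (\<Sum>j<n. c j * z ^ j)"
  using assms
proof (induction n arbitrary: c)
  case (Suc n)
  let ?M = "z \<cdot>\<^sub>m 1\<^sub>m (Suc n) - companion (Suc n) c"
  have M: "?M \<in> carrier_mat (Suc n) (Suc n)" by (intro minus_carrier_mat companion_carrier)
  show ?case
  proof (cases "n = 0")
    case True
    have "det ?M = ?M $$ (0, 0)" by (rule det_single) (use M True in simp)
    thus ?thesis using True by (simp add: companion_def)
  next
    case False
    have "det ?M = (\<Sum>i<Suc n. ?M $$ (i, 0) * cofactor ?M i 0)"
      by (rule laplace_expansion_column[OF M]) simp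
    also have "\<dots> = (\<Sum>i\<in>{0, n}. ?M $$ (i, 0) * cofactor ?M i 0)"
      by (rule sum.mono_neutral_right) (auto simp: companion_def)
    also have "\<dots> = z * cofactor ?M 0 0 - c 0 * cofactor ?M n 0"
      using False by (simp add: companion_def)
    also have "cofactor ?M 0 0 = det (z \<cdot>\<^sub>m 1\<^sub>m n - companion n (c \<circ> Suc))"
      unfolding cofactor_def
      by (simp, rule arg_cong[where f = det], rule eq_matI) (auto simp: mat_delete_def companion_def)
    also have "\<dots> = z ^ n - (\<Sum>j<n. c (Suc j) * z ^ j)" using Suc.IH False by simp
    \<comment> \<open>The remaining block is lower triangular with diagonal entries
      \<open>- 1\<close>, so its determinant cancels the cofactor sign.\<close>
    also have "cofactor ?M n 0 = 1"
    proof -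
      let ?D = "mat_delete ?M n 0"
      have D: "?D \<in> carrier_mat n n" using mat_delete_carrier[OF M] by simp
      have entry: "?D $$ (i, j) = (if Suc j = i then z else 0) - (if i = j then 1 else 0)"
        if "i < n" "j < n" for i j
        using that by (auto simp: mat_delete_def companion_def)
      have "det ?D = prod_list (diag_mat ?D)"
        by (rule det_lower_triangular[OF _ D]) (simp add: entry)
      also have "diag_mat ?D = replicate n (- 1)"
        using D by (intro nth_equalityI) (auto simp: diag_mat_def entry)
      finally have "det ?D = (- 1) ^ n" by simp
      thus ?thesis by (simp add: cofactor_def)
    qed
    finally show ?thesis
      by (simp add: sum.lessThan_Suc_shift sum_distrib_left algebra_simps del: sum.lessThan_Suc)
  qed
qed simp

definition lambda_coeff :: "nat \<Rightarrow> nat \<Rightarrow> int" where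
  "lambda_coeff g j = (if j = 0 \<or> (if odd g then j = g else j = g - 1 \<or> j = g + 1) then 1 else 0)"

lemma sum_lambda_coeff:
  fixes z :: "'a::comm_ring_1"
  assumes "1 \<le> g"
  shows "z ^ (2 * g) - (\<Sum>j<2 * g. of_int (lambda_coeff g j) * z ^ j)
    = (if odd g then z ^ (2 * g) - z ^ g - 1 else z ^ (2 * g) - z ^ (g + 1) - z ^ (g - 1) - 1)"
proof -
  let ?S = "if odd g then {0, g} else {0, g - 1, g + 1}"
  \<comment> \<open>For even \<open>g\<close> this keeps 0 and \<open>g - 1\<close> distinct, so
    that the set really has three elements.\<close>
  have g: "g \<noteq> 1" if "even g" using that by auto
  have "(\<Sum>j<2 * g. of_int (lambda_coeff g j) * z ^ j) = (\<Sum>j\<in>?S. z ^ j)"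
    using assms g by (intro sum.mono_neutral_cong_right) (auto simp: lambda_coeff_def)
  also have "\<dots> = (if odd g then 1 + z ^ g else 1 + z ^ (g - 1) + z ^ (g + 1))"
    using assms g by (auto simp: add.assoc)
  finally show ?thesis by (simp add: algebra_simps)
qed

lemma map_mat_companion: "map_mat of_int (companion n c) = companion n (\<lambda>j. of_int (c j))"
  by (rule eq_matI) (auto simp: companion_def)

lemma poly_char_poly_companion:
  assumes "0 < n"
  shows "poly (char_poly (companion n c)) (z::complex) = z ^ n - (\<Sum>j<n. c j * z ^ j)"
proof -
  have "- char_matrix (companion n c) z = z \<cdot>\<^sub>m 1\<^sub>m n - companion n c"
    by (rule eq_matI) (auto simp: char_matrix_def companion_def)
  thus ?thesis by (simp add: char_poly_matrix[OF companion_carrier] det_companion[OF assms])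
qed

lemma proots_prod_linear: "proots (\<Prod>e\<in>#N. [:- e, 1:]) = (N :: complex multiset)"
proof (induction N)
  case (add e N)
  have "(\<Prod>e\<in>#N. [:- e, 1:]) \<noteq> 0" by auto
  thus ?case using add by (simp add: proots_mult del: mult_pCons_left)
qed simp

lemma skew_reciprocalI:
  assumes A: "A \<in> carrier_mat n n" and zero: "poly (char_poly A) 0 = - 1"
    and fe: "\<And>z. z \<noteq> 0 \<Longrightarrow> z ^ n * poly (char_poly A) (- (1 / z)) = - poly (char_poly A) z"
  shows "skew_reciprocal A"
proof -
  let ?M = "eigenvalue_mset A"
  let ?N = "image_mset (\<lambda>t. - inverse t) ?M"
  have "char_poly A \<noteq> 0" using zero by auto
  hence M: "0 \<notin># ?M" using zero by (simp add: eigenvalue_mset_def)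
  have "(\<Prod>e\<in>#?M. - e) = - 1" using zero poly_char_poly_eigenvalues[OF A, of 0] by simp
  hence eq: "poly (\<Prod>e\<in>#?N. [:- e, 1:]) z = poly (char_poly A) z" if "z \<noteq> 0" for z
    using poly_skew_functional[OF A M that] fe[OF that] by (simp add: poly_prod_mset)
  \<comment> \<open>The functional equation says nothing at 0; the factor \<open>[:0, 1:]\<close>
    makes both sides agree there as well.\<close>
  have "[:0, 1:] * (\<Prod>e\<in>#?N. [:- e, 1:]) = [:0, 1:] * char_poly A"
    by (subst poly_eq_poly_eq_iff[symmetric]) (use eq in \<open>auto simp: fun_eq_iff simp del: mult_pCons_left\<close>)
  hence "(\<Prod>e\<in>#?N. [:- e, 1:]) = char_poly A" by (simp del: mult_pCons_left)
  hence "?N = ?M" using proots_prod_linear[of ?N] by (simp add: eigenvalue_mset_def)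
  thus ?thesis using M by (simp add: skew_reciprocal_def)
qed

lemma companion_irreducible:
  fixes c :: "nat \<Rightarrow> int"
  assumes "c 0 \<noteq> 0"
  shows "irreducible_mat (companion n c)"
proof (rule irreducible_matI[OF companion_carrier], rule ccontr)
  fix W assume W: "W \<noteq> {}" "W \<subset> {..<n}"
    and no: "\<not> (\<exists>i\<in>W. \<exists>j\<in>{..<n} - W. companion n c $$ (i, j) \<noteq> 0)"
  have closed: "j \<in> W" if "i \<in> W" "j < n" "companion n c $$ (i, j) \<noteq> 0" for i j
    using no that by blast
  have less: "i < n" if "i \<in> W" for i using W that by blast
  have suc: "Suc i \<in> W" if "i \<in> W" "Suc i < n" for i
    using closed[OF that] less[OF that(1)] that by (simp add: companion_def)
  have up: "i + k \<in> W" if "i \<in> W" "i + k < n" for i k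
    using that by (induction k) (auto intro: suc)
  obtain i where i: "i \<in> W" using W by blast
  have "n - 1 \<in> W" using up[OF i, of "n - 1 - i"] less[OF i] by simp
  hence "0 \<in> W" using closed[of "n - 1" 0] assms less[OF i] by (simp add: companion_def)
  hence "{..<n} \<subseteq> W" using up[of 0] by auto
  thus False using W by blast
qed

lemma companion_GL:
  assumes "0 < n" "even n" "c 0 = 1"
  shows "companion n c \<in> GL_int n"
proof -
  let ?C = "companion n c"
  have "0 \<cdot>\<^sub>m 1\<^sub>m n - ?C = (- 1) \<cdot>\<^sub>m ?C" by (rule eq_matI) (auto simp: companion_def)
  moreover have "dim_col ?C = n" by (simp add: companion_def)
  ultimately have "det ?C = 0 ^ n - (\<Sum>j<n. c j * 0 ^ j)"
    using det_companion[OF assms(1), of 0 c] assms(2) by simp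
  also have "(\<Sum>j<n. c j * 0 ^ j) = (\<Sum>j\<in>{0}. c j * 0 ^ j)"
    by (rule sum.mono_neutral_right) (use assms in auto)
  finally have det: "det ?C = - 1" using assms by simp
  \<comment> \<open>The determinant is \<open>- 1\<close>, so the negated adjugate is an integral
    inverse.\<close>
  let ?B = "- 1 \<cdot>\<^sub>m adj_mat ?C"
  note adj = adj_mat[OF companion_carrier[of n c]]
  have "?C * ?B = - 1 \<cdot>\<^sub>m (?C * adj_mat ?C)" "?B * ?C = - 1 \<cdot>\<^sub>m (adj_mat ?C * ?C)"
    by (rule mult_smult_distrib[OF companion_carrier adj(1)], rule mult_smult_assoc_mat[OF adj(1) companion_carrier])
  moreover have "- 1 \<cdot>\<^sub>m (det ?C \<cdot>\<^sub>m 1\<^sub>m n) = 1\<^sub>m n" unfolding det by (rule eq_matI) auto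
  ultimately have "?C * ?B = 1\<^sub>m n" "?B * ?C = 1\<^sub>m n" by (simp_all add: adj)
  hence "inverts_mat ?C ?B" "inverts_mat ?B ?C"
    using adj(1) by (auto simp: inverts_mat_def companion_def)
  thus ?thesis by (auto simp: GL_int_def invertible_mat_def companion_def)
qed

lemma lambda_poly_root_gt_1:
  assumes g: "1 \<le> g"
  obtains r where "1 < r" "poly (lambda_poly g) r = 0"
proof -
  have neg: "poly (lambda_poly g) 1 < 0" by (simp add: poly_lambda_poly)
  have pos: "0 < poly (lambda_poly g) 2"
  proof (cases "odd g")
    case True
    have "(2::real) \<le> 2 ^ g" using power_increasing[of 1 g "2::real"] g by simp
    moreover from this have "2 * 2 ^ g \<le> (2::real) ^ g * 2 ^ g" by (intro mult_right_mono) auto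
    moreover have "(2::real) ^ (2 * g) = 2 ^ g * 2 ^ g" by (simp add: mult_2 power_add)
    ultimately have "1 < (2::real) ^ (2 * g) - 2 ^ g" by linarith
    thus ?thesis using True by (simp add: poly_lambda_poly)
  next
    case False
    hence g2: "2 \<le> g" using g by (cases "g = 1") auto
    define y where "y = (2::real) ^ (g - 1)"
    have y: "2 \<le> y" using power_increasing[of 1 "g - 1" "2::real"] g2 by (simp add: y_def)
    have e: "(2::real) ^ g = 2 * y" using g2 by (simp add: y_def power_eq_if)
    have "(2::real) ^ (g + g) = 4 * (y * y)" by (simp only: power_add e)
    hence "(2::real) ^ (2 * g) = 4 * (y * y)" by (simp only: mult_2)
    moreover have "(2::real) ^ (g + 1) = 4 * y" by (simp only: power_add e) simp
    moreover have "2 * y \<le> y * y" using y by (intro mult_right_mono) auto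
    ultimately have "0 < (2::real) ^ (2 * g) - 2 ^ (g + 1) - y - 1" using y by linarith
    thus ?thesis using False by (simp add: poly_lambda_poly y_def)
  qed
  obtain r where "1 < r" "r < 2" "poly (lambda_poly g) r = 0"
    using poly_IVT_pos[OF _ neg pos] by auto
  thus ?thesis using that by blast
qed

text \<open>The spectral radius is itself a root, not merely the modulus of one, because the clique
  sum vanishes at its inverse. It exceeds 1 because the polynomial has a root above 1.\<close>

lemma companion_lambda:
  assumes g: "1 \<le> g"
  defines "C \<equiv> companion (2 * g) (lambda_coeff g)"
  shows "C \<in> skew_reciprocal_nonneg_irreducible (2 * g)"
    and "1 < spectral_radius (map_mat complex_of_int C)"
    and "poly (lambda_poly g) (spectral_radius (map_mat complex_of_int C)) = 0"
proof -
  let ?C = "map_mat complex_of_int C"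
  have C: "C \<in> carrier_mat (2 * g) (2 * g)" "?C \<in> carrier_mat (2 * g) (2 * g)" by (simp_all add: C_def)
  have n: "0 < 2 * g" using g by simp
  have char: "poly (char_poly ?C) z = (if odd g then z ^ (2 * g) - z ^ g - 1
     else z ^ (2 * g) - z ^ (g + 1) - z ^ (g - 1) - 1)" for z
    unfolding C_def map_mat_companion poly_char_poly_companion[OF n] by (rule sum_lambda_coeff[OF g])
  have real: "poly (char_poly ?C) (of_real r) = of_real (poly (lambda_poly g) r)" for r
    by (simp add: char poly_lambda_poly)
  have c0: "lambda_coeff g 0 = 1" by (simp add: lambda_coeff_def)
  have nonneg: "nonneg_mat C"
    by (auto simp: C_def nonneg_mat_def companion_def lambda_coeff_def)
  have "skew_reciprocal ?C"
  proof (rule skew_reciprocalI[OF C(2)])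
    show "poly (char_poly ?C) 0 = - 1"
    proof -
      have "g \<noteq> 1" if "even g" using that by auto
      thus ?thesis using g by (auto simp: char power_0_left)
    qed
    fix z :: complex assume z: "z \<noteq> 0"
    have sq: "(- (1 / z)) ^ (2 * g) * z ^ (2 * g) = 1"
      using z by (simp add: power_mult_distrib[symmetric])
    show "z ^ (2 * g) * poly (char_poly ?C) (- (1 / z)) = - poly (char_poly ?C) z"
    proof (cases "odd g")
      case True
      have "z ^ (2 * g) * (- (1 / z)) ^ g = - (z ^ g)"
        using z True by (simp add: power_minus[of "1 / z"] power_divide mult_2 power_add)
      thus ?thesis using True sq by (simp add: char algebra_simps)
    next
      case False
      hence g2: "2 \<le> g" using g by (cases "g = 1") auto
      have "z ^ (2 * g) = z ^ (g - 1) * z ^ (g + 1)" using power_pred_succ[OF g, of z] by (simp only: mult_2 power_add)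
      hence "z ^ (2 * g) * (- (1 / z)) ^ (g + 1) = - (z ^ (g - 1))"
        "z ^ (2 * g) * (- (1 / z)) ^ (g - 1) = - (z ^ (g + 1))"
        using z False g by (simp_all add: power_minus[of "1 / z"] power_divide)
      thus ?thesis using False sq by (simp add: char algebra_simps)
    qed
  qed
  thus "C \<in> skew_reciprocal_nonneg_irreducible (2 * g)"
    using nonneg companion_GL[of "2 * g" "lambda_coeff g"] n companion_irreducible[of "lambda_coeff g" "2 * g"] c0
    by (simp add: skew_reciprocal_nonneg_irreducible_def C_def)
  obtain r where r: "1 < r" "poly (lambda_poly g) r = 0" using lambda_poly_root_gt_1[OF g] .
  have "of_real r \<in> spectrum ?C"
    using real[of r] r by (simp add: spectrum_root_char_poly[OF C(2)])
  hence "norm (of_real r :: complex) \<le> spectral_radius ?C"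
    by (intro spectral_radius_mem_max(2)[OF C(2) n] imageI)
  thus gt: "1 < spectral_radius ?C" using r by simp
  have "clique_sum vertices (mat_cycles C) (1 / spectral_radius ?C) = 0"
    by (rule spectral_radius_clique_sum(1)[OF C(1) nonneg n]) (use gt in simp)
  hence "clique_sum vertices (mat_cycles C) (1 / complex_of_real (spectral_radius ?C)) = 0"
    using clique_sum_of_real[of vertices "mat_cycles C" "1 / spectral_radius ?C", where 'a = complex] by simp
  hence "poly (char_poly ?C) (of_real (spectral_radius ?C)) = 0"
    using char_poly_eq_clique_sum[OF C(1) nonneg, of "of_real (spectral_radius ?C)"] gt by simp
  thus "poly (lambda_poly g) (spectral_radius ?C) = 0" by (simp add: real)
qed

lemma largest_real_root_eq:
  assumes "poly p r = 0" "\<And>q. poly p q = 0 \<Longrightarrow> q \<le> r" "p \<noteq> 0"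
  shows "largest_real_root p = r"
  unfolding largest_real_root_def
  by (rule Max_eqI) (use assms poly_roots_finite in auto)

theorem theorem4:
  fixes g :: nat
  assumes "g \<ge> 1"
  shows "(\<exists>A \<in> skew_reciprocal_nonneg_irreducible (2 * g).
            spectral_radius (map_mat complex_of_int A) > 1 \<and>
            spectral_radius (map_mat complex_of_int A) = largest_real_root (lambda_poly g)) \<and>
         (\<forall>A \<in> skew_reciprocal_nonneg_irreducible (2 * g).
            spectral_radius (map_mat complex_of_int A) > 1 \<longrightarrow>
            largest_real_root (lambda_poly g) \<le> spectral_radius (map_mat complex_of_int A))"
proof -
  let ?C = "companion (2 * g) (lambda_coeff g)"
  note C = companion_lambda[OF assms]
  have "poly (lambda_poly g) 1 \<noteq> 0" by (simp add: poly_lambda_poly)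
  hence "lambda_poly g \<noteq> 0" by auto
  \<comment> \<open>The lower bound applied to the extremal matrix itself shows that no real root
    exceeds its spectral radius.\<close>
  hence eq: "largest_real_root (lambda_poly g) = spectral_radius (map_mat complex_of_int ?C)"
    using C(3) lambda_poly_root_le[OF assms C(1,2)] by (intro largest_real_root_eq)
  show ?thesis
  proof (intro conjI ballI impI)
    show "\<exists>A \<in> skew_reciprocal_nonneg_irreducible (2 * g).
      spectral_radius (map_mat complex_of_int A) > 1 \<and>
      spectral_radius (map_mat complex_of_int A) = largest_real_root (lambda_poly g)"
      using C(1,2) eq by auto
    fix A :: "int mat"
    assume "A \<in> skew_reciprocal_nonneg_irreducible (2 * g)" "spectral_radius (map_mat complex_of_int A) > 1"
    thus "largest_real_root (lambda_poly g) \<le> spectral_radius (map_mat complex_of_int A)"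
      using lambda_poly_root_le[OF assms] C(3) unfolding eq by blast
  qed
qed

end
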